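(* Assume that for every $u\in\mathcal{D}$, $W^u(w)=W^{u(w)}(w)$ for $\nu$-a.e. $w$. Let $a,b,c:\mathbb{W}\to\mathbb{R}$ be positive and measurable, such that for every $h,k\in H_b$ and every $t\in[0,1]$ one has $\nu$-a.s. $$a\circ W^{th+(1-t)k}\,\exp\left(-\tfrac12|th+(1-t)k|_H^2\right)\ge\left(b\circ W^h\exp\left(-\tfrac12|h|_H^2\right)\right)^t\left(c\circ W^k\exp\left(-\tfrac12|k|_H^2\right)\right)^{1-t}.$$ Then for any probability density $d$ with respect to $\nu$ such that $h\in H_b\mapsto-\log d\circ W^h$ is $\nu$-a.s. convex, denoting by $\theta$ the measure on $\mathbb{W}$ with $\frac{d\theta}{d\nu}=d$, one has, in $\overline{\mathbb{R}}$, for every $t\in[0,1]$, $$\mathbb{E}_\theta[a]\ge\left(\mathbb{E}_\theta[b]\right)^t\left(\mathbb{E}_\theta[c]\right)^{1-t}.$$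
   Context: Notation. Let $n\ge 1$, $\mathbb{W}=C([0,1],\mathbb{R}^n)$, $H=\{\int_0^\cdot\dot h(s)ds:\dot h\in L^2([0,1],\mathbb{R}^n)\}$ with $|h|_H^2=\int_0^1|\dot h(s)|^2ds$. $W=(W(t))_{t\in[0,1]}$ is the coordinate process on $\mathbb{W}$ (so, as a map, $W=I_{\mathbb{W}}$, the identity). $\nu$ is a probability measure on $\mathbb{W}$; all filtrations are completed with respect to $\nu$, and $(\mathcal{F}_t)$ is the filtration of $W$. For $p\ge 0$, $L^p_a(\nu,H)$ is the set of $u\in L^p(\nu,H)$ whose density $\dot u$ is $(\mathcal{F}_t)$-adapted ($L^0$: all measurable maps). $\mathcal{D}=\{u\in L^0_a(\nu,H):\dot u \text{ is } d\nu\times dt\text{-a.s. bounded}\}$. $H_b=\{h\in H:\dot h\text{ is }dt\text{-a.s. bounded}\}$, viewed as a subset of $\mathcal{D}$ (constant maps); for $u\in\mathcal{D}$, $u(w)\in H_b$ for $\nu$-a.e. $w$. For a $\nu$-Brownian motion $\beta$, $\delta_\beta u=\int_0^1\dot u(s)d\beta(s)$ and $\rho(-\delta_\beta u)=\exp\left(-\int_0^1\dot u(s)d\beta(s)-\frac12\int_0^1|\dot u(s)|^2ds\right)$. Convention: $\log 0=-\infty$, $\log\infty=\infty$. Standing assumption. There are an $\mathbb{R}^n$-valued $\nu$-Brownian motion $\beta$ defined on $\mathbb{W}$ and a family $(W^u)_{u\in\mathcal{D}}$ of continuous processes on $\mathbb{W}$ (i.e. measurable maps $W^u:\mathbb{W}\to\mathbb{W}$)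 such that: (i) the canonical (completed) filtration of $\beta$ equals that of $W$; (ii) $W^0=W$; (iii) for every $u\in\mathcal{D}$, the law of $W^u$ under $\tilde\nu^u$, where $\frac{d\tilde\nu^u}{d\nu}=\rho(-\delta_\beta u)$, equals the law of $W$ under $\nu$; (iv) for every $u\in\mathcal{D}$, $\beta\circ W^u=\beta+u$ $\nu$-a.s.; (v) for all $u,v\in\mathcal{D}$, $W^u\circ W^v=W^{v+u\circ W^v}$ $\nu$-a.s. (These imply $W^u\nu\sim\nu$ for $u\in\mathcal{D}$.) *)

theory Defs
  imports "HOL-Probability.Probability"
begin

text \<open>
  Paths on [0,1] are represented by total functions on the reals vanishing outside [0,1], so
  that pointwise operations do not leave the space.
\<close>

type_synonym 'n path = "real \<Rightarrow> real ^ 'n"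

definition paths :: "('n::finite) path set" where
  "paths = {w. continuous_on {0..1} w \<and> (\<forall>t. t \<notin> {0..1} \<longrightarrow> w t = 0)}"

text \<open>
  The sigma-algebra generated by the coordinates; it is also the Borel sigma-algebra of the
  supremum norm. Only the underlying measurable space of the following object is used.
\<close>

definition path_space :: "('n::finite) path measure" where
  "path_space = sigma paths {{w \<in> paths. w t \<in> A} | t A. t \<in> {0..1} \<and> A \<in> sets borel}"

definition unit_time :: "real measure" where
  "unit_time = restrict_space lborel {0..1}"

subsection \<open>The Cameron-Martin space\<close>

definition is_density :: "('n::finite) path \<Rightarrow> (real \<Rightarrow> real ^ 'n) \<Rightarrow> bool" where
  "is_density h g \<longleftrightarrow>
     g \<in> borel_measurable unit_time \<and>
     integrable unit_time (\<lambda>s. (norm (g s))\<^sup>2) \<and>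
     h = (\<lambda>t. if t \<in> {0..1} then (LINT s:{0..t}|unit_time. g s) else 0)"

definition CM :: "('n::finite) path set" where
  "CM = {h. \<exists>g. is_density h g}"

text \<open>Two densities of the same path agree almost everywhere, so the choice is immaterial.\<close>

definition CM_normsq :: "('n::finite) path \<Rightarrow> real" where
  "CM_normsq h = (LINT s|unit_time. (norm ((SOME g. is_density h g) s))\<^sup>2)"

definition CM_open :: "('n::finite) path set \<Rightarrow> bool" where
  "CM_open U \<longleftrightarrow> U \<subseteq> CM \<and>
     (\<forall>h\<in>U. \<exists>e>0. \<forall>k\<in>CM. sqrt (CM_normsq (\<lambda>s. k s - h s)) < e \<longrightarrow> k \<in> U)"

definition CM_borel :: "('n::finite) path measure" where
  "CM_borel = sigma CM {U. CM_open U}"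

definition CM_bounded :: "('n::finite) path set" where
  "CM_bounded = {h. \<exists>g C. is_density h g \<and> (AE s in unit_time. norm (g s) \<le> C)}"

subsection \<open>Filtrations, Brownian motion, adapted drifts\<close>

text \<open>
  The filtration generated by the path-valued map \<open>X\<close>, completed with the null sets of
  (the completion of) \<open>\<nu>\<close>. The coordinate process is \<open>X = (\<lambda>w. w)\<close>.
\<close>

definition filtration ::
    "('n::finite) path measure \<Rightarrow> ('n path \<Rightarrow> 'n path) \<Rightarrow> real \<Rightarrow> 'n path measure" where
  "filtration \<nu> X t = sigma (space \<nu>)
     ({{w \<in> space \<nu>. X w s \<in> A} | s A. s \<in> {0..t} \<and> A \<in> sets borel}
        \<union> null_sets (completion \<nu>))"

definition brownian_motion :: "('n::finite) path measure \<Rightarrow> ('n path \<Rightarrow> 'n path) \<Rightarrow> bool" where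
  "brownian_motion \<nu> \<beta> \<longleftrightarrow>
     \<beta> \<in> measurable (completion \<nu>) path_space \<and>
     (AE w in \<nu>. \<beta> w 0 = 0) \<and>
     (\<forall>s t. 0 \<le> s \<and> s < t \<and> t \<le> 1 \<longrightarrow>
        distributed (completion \<nu>) lborel (\<lambda>w. \<beta> w t - \<beta> w s)
          (\<lambda>x. ennreal (\<Prod>i\<in>UNIV. normal_density 0 (sqrt (t - s)) (x $ i)))) \<and>
     (\<forall>(m::nat) \<tau>. 0 \<le> \<tau> 0 \<and> \<tau> m \<le> (1::real) \<and> (\<forall>i<m. \<tau> i < \<tau> (Suc i)) \<longrightarrow>
        prob_space.indep_vars (completion \<nu>) (\<lambda>_. borel)
          (\<lambda>i w. \<beta> w (\<tau> (Suc i)) - \<beta> w (\<tau> i)) {..<m})"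

text \<open>\<open>g\<close> is an adapted version of the density process of the random path \<open>u\<close>.\<close>

definition adapted_density ::
    "('n::finite) path measure \<Rightarrow> ('n path \<Rightarrow> 'n path) \<Rightarrow> ('n path \<Rightarrow> real \<Rightarrow> real ^ 'n) \<Rightarrow> bool" where
  "adapted_density \<nu> u g \<longleftrightarrow>
     case_prod g \<in> borel_measurable (completion \<nu> \<Otimes>\<^sub>M unit_time) \<and>
     (\<forall>s\<in>{0..1}. (\<lambda>w. g w s) \<in> borel_measurable (filtration \<nu> (\<lambda>w. w) s)) \<and>
     (AE w in \<nu>. is_density (u w) (g w))"

text \<open>
  Maps rather than classes of maps modulo \<open>\<nu>\<close>; the embedding of bounded paths sends
  \<open>h\<close> to \<open>\<lambda>_. h\<close>.
\<close>

definition drifts :: "('n::finite) path measure \<Rightarrow> ('n path \<Rightarrow> 'n path) set" where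
  "drifts \<nu> = {u. u \<in> measurable (completion \<nu>) CM_borel \<and>
     (\<exists>g C. adapted_density \<nu> u g \<and>
        (AE x in completion \<nu> \<Otimes>\<^sub>M unit_time. norm (case_prod g x) \<le> C))}"

lemma constant_drift:
  fixes h :: "('n::finite) path"
  assumes "prob_space \<nu>" and "h \<in> CM_bounded"
  shows "(\<lambda>_. h) \<in> drifts \<nu>"
proof -
  obtain g C where g: "is_density h g" and C: "AE s in unit_time. norm (g s) \<le> C"
    using assms(2) by (auto simp: CM_bounded_def)
  interpret P: prob_space "completion \<nu>" by (rule prob_space.prob_space_completion[OF assms(1)])
  have gm[measurable]: "g \<in> borel_measurable unit_time"
    using g by (simp add: is_density_def)
  have "finite_measure unit_time"
    by (rule finite_measureI) (simp add: unit_time_def emeasure_restrict_space space_restrict_space)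
  then interpret T: finite_measure unit_time .
  interpret PT: pair_sigma_finite "completion \<nu>" unit_time ..
  have 1: "AE x in completion \<nu> \<Otimes>\<^sub>M unit_time. norm (case_prod (\<lambda>_. g) x) \<le> C"
    by (rule PT.AE_pair_measure) (use C in auto)
  have "h \<in> space CM_borel"
    using g by (auto simp: CM_borel_def CM_def CM_open_def space_measure_of_conv)
  then have 2: "(\<lambda>_. h) \<in> measurable (completion \<nu>) CM_borel" by simp
  have 3: "adapted_density \<nu> (\<lambda>_. h) (\<lambda>_. g)"
    using g by (auto simp: adapted_density_def)
  show ?thesis using 1 2 3 unfolding drifts_def by blast
qed

subsection \<open>The stochastic integral\<close>

definition simple_integrand ::
    "('n::finite) path measure \<Rightarrow> nat \<Rightarrow> (nat \<Rightarrow> real) \<Rightarrow> (nat \<Rightarrow> 'n path \<Rightarrow> real ^ 'n) \<Rightarrow> bool" where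
  "simple_integrand \<nu> m \<tau> \<xi> \<longleftrightarrow>
     0 \<le> \<tau> 0 \<and> \<tau> m \<le> 1 \<and> (\<forall>i<m. \<tau> i \<le> \<tau> (Suc i)) \<and>
     (\<forall>i<m. \<xi> i \<in> borel_measurable (filtration \<nu> (\<lambda>w. w) (\<tau> i)) \<and>
            (\<exists>C. \<forall>w\<in>space \<nu>. norm (\<xi> i w) \<le> C))"

definition simple_process ::
    "nat \<Rightarrow> (nat \<Rightarrow> real) \<Rightarrow> (nat \<Rightarrow> ('n::finite) path \<Rightarrow> real ^ 'n) \<Rightarrow> 'n path \<Rightarrow> real \<Rightarrow> real ^ 'n" where
  "simple_process m \<tau> \<xi> w s = (\<Sum>i<m. indicator {\<tau> i<..\<tau> (Suc i)} s *\<^sub>R \<xi> i w)"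

definition simple_integral ::
    "(('n::finite) path \<Rightarrow> 'n path) \<Rightarrow> nat \<Rightarrow> (nat \<Rightarrow> real) \<Rightarrow> (nat \<Rightarrow> 'n path \<Rightarrow> real ^ 'n) \<Rightarrow> 'n path \<Rightarrow> real" where
  "simple_integral \<beta> m \<tau> \<xi> w = (\<Sum>i<m. \<xi> i w \<bullet> (\<beta> w (\<tau> (Suc i)) - \<beta> w (\<tau> i)))"

text \<open>
  \<open>X\<close> is a version of the Ito integral of the density of \<open>u\<close> against \<open>\<beta>\<close>: the \<open>L\<^sup>2\<close>-limit of the
  integrals of simple processes approximating that density in \<open>L\<^sup>2\<close>. It is unique up to
  \<open>\<nu>\<close>-null sets, and the integrability this requires holds for bounded densities.
\<close>

definition has_ito_integral ::
    "('n::finite) path measure \<Rightarrow> ('n path \<Rightarrow> 'n path) \<Rightarrow> ('n path \<Rightarrow> 'n path) \<Rightarrow> ('n path \<Rightarrow> real) \<Rightarrow> bool" where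
  "has_ito_integral \<nu> \<beta> u X \<longleftrightarrow>
     X \<in> borel_measurable (completion \<nu>) \<and>
     (\<exists>g m \<tau> \<xi>. adapted_density \<nu> u g \<and>
        (\<forall>k::nat. simple_integrand \<nu> (m k) (\<tau> k) (\<xi> k)) \<and>
        (\<lambda>k. \<integral>\<^sup>+x. ennreal ((norm (case_prod g x - case_prod (simple_process (m k) (\<tau> k) (\<xi> k)) x))\<^sup>2)
           \<partial>(completion \<nu> \<Otimes>\<^sub>M unit_time)) \<longlonglongrightarrow> 0 \<and>
        (\<lambda>k. \<integral>\<^sup>+w. ennreal ((X w - simple_integral \<beta> (m k) (\<tau> k) (\<xi> k) w)\<^sup>2)
           \<partial>completion \<nu>) \<longlonglongrightarrow> 0)"

subsection \<open>The perturbed processes\<close>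

text \<open>
  Since the coordinate process is the identity of the path space, its law under \<open>\<nu>\<close> is
  \<open>\<nu>\<close> itself.
\<close>

definition perturbation_family ::
    "('n::finite) path measure \<Rightarrow> ('n path \<Rightarrow> 'n path) \<Rightarrow> (('n path \<Rightarrow> 'n path) \<Rightarrow> 'n path \<Rightarrow> 'n path) \<Rightarrow> bool" where
  "perturbation_family \<nu> \<beta> W \<longleftrightarrow>
     brownian_motion \<nu> \<beta> \<and>
     (\<forall>u\<in>drifts \<nu>. W u \<in> measurable (completion \<nu>) path_space) \<and>
     (\<forall>t\<in>{0..1}. sets (filtration \<nu> \<beta> t) = sets (filtration \<nu> (\<lambda>w. w) t)) \<and>
     (AE w in \<nu>. W (\<lambda>_ _. 0) w = w) \<and>
     (\<forall>u\<in>drifts \<nu>. \<forall>X. has_ito_integral \<nu> \<beta> u X \<longrightarrow>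
        distr (density (completion \<nu>) (\<lambda>w. ennreal (exp (- X w - CM_normsq (u w) / 2))))
          path_space (W u) = \<nu>) \<and>
     (\<forall>u\<in>drifts \<nu>. AE w in \<nu>. \<beta> (W u w) = (\<lambda>s. \<beta> w s + u w s)) \<and>
     (\<forall>u\<in>drifts \<nu>. \<forall>v\<in>drifts \<nu>. AE w in \<nu>.
        W u (W v w) = W (\<lambda>w' s. v w' s + u (W v w') s) w)"

definition path_comb :: "real \<Rightarrow> ('n::finite) path \<Rightarrow> 'n path \<Rightarrow> 'n path" where
  "path_comb t h k = (\<lambda>s. t *\<^sub>R h s + (1 - t) *\<^sub>R k s)"

definition neg_log :: "real \<Rightarrow> ereal" where
  "neg_log x = (if x = 0 then \<infinity> else ereal (- ln x))"

text \<open>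
  Almost sure convexity of a map with values in random variables: the exceptional null set
  may depend on \<open>h\<close>, \<open>k\<close> and \<open>t\<close>. In \<open>ereal\<close>, zero times infinity is zero.
\<close>

definition as_convex_neg_log ::
    "('n::finite) path measure \<Rightarrow> (('n path \<Rightarrow> 'n path) \<Rightarrow> 'n path \<Rightarrow> 'n path) \<Rightarrow> ('n path \<Rightarrow> real) \<Rightarrow> bool" where
  "as_convex_neg_log \<nu> W d \<longleftrightarrow>
     (\<forall>h\<in>CM_bounded. \<forall>k\<in>CM_bounded. \<forall>t\<in>{0..1}. AE w in \<nu>.
        neg_log (d (W (\<lambda>_. path_comb t h k) w))
          \<le> ereal t * neg_log (d (W (\<lambda>_. h) w)) + ereal (1 - t) * neg_log (d (W (\<lambda>_. k) w)))"

text \<open>Powers of extended nonnegative numbers with nonnegative exponent; \<open>x\<^sup>0 = 1\<close> for every \<open>x\<close>.\<close>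

definition ennreal_powr :: "ennreal \<Rightarrow> real \<Rightarrow> ennreal" where
  "ennreal_powr x t =
     (if t = 0 then 1 else if x = \<infinity> then \<infinity> else ennreal (enn2real x powr t))"

end

theory Submission
  imports Defs
begin

text \<open>
  Only deterministic drifts \<open>h\<close> with step densities are needed. For these, \<open>W\<^sup>h\<close> is the translation by
  \<open>h\<close> of the Brownian motion \<open>\<beta>\<close>: every random variable is a function \<open>F \<circ> \<beta>\<close> because the
  filtrations agree, and \<open>F \<circ> \<beta> \<circ> W\<^sup>h = F (\<beta> + h)\<close>. With \<open>p = a d\<close>, \<open>q = b d\<close>, \<open>r = c d\<close> the
  hypotheses give, almost surely for each fixed pair of step paths \<open>h, k\<close>,
  \<open>p (\<beta> + t h + (1 - t) k) \<ge> q (\<beta> + h)\<^sup>t r (\<beta> + k)\<^sup>1\<^sup>-\<^sup>t exp (- t (1 - t) |h - k|\<^sup>2 / 2)\<close>.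
  Resampling one Gaussian coordinate of \<open>\<beta>\<close> preserves this inequality, by the one-dimensional
  Prekopa-Leindler inequality with an almost-everywhere hypothesis. Resampling all increments of \<open>\<beta>\<close>
  over a fine grid replaces \<open>p, q, r\<close> by functions close in \<open>L\<^sup>1\<close> to their expectations, since
  functions of finitely many increments are dense; no disintegration or martingale convergence is needed.
\<close>

subsection \<open>The one-dimensional essential Prekopa-Leindler inequality\<close>

text \<open>The null set in the hypothesis depends on \<open>h\<close> and \<open>k\<close>, and
  this shapes the whole argument. No inequality is available for one path and all shifts at once;
  Fubini only moves Lebesgue-almost every shift, in finitely many directions, inside the almost-sure
  quantifier. Sumsets and pointwise suprema are unusable under such an assumption, since a null set
  of shifts can change them; hence the essential versions below. A single averaging must reproduce
  an inequality of the same kind, so the invariant \<open>PL_hyp\<close> ranges over all pairs of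
  shifts, although only the zero shifts are read off at the end. The exponential factor is exactly
  what the Gaussian density loses: for the standard normal density \<open>g\<close>,
  \<open>g(x)^t g(y)^(1-t)\<close> is \<open>g(t x + (1-t) y)\<close> times
  \<open>exp(- t (1-t) (x-y)^2 / 2)\<close>. Multiplying by Gaussian densities therefore leaves the
  plain inequality for Lebesgue measure, with no dimension-dependent loss to control as the grid is
  refined.\<close>

lemma essential_endpoint:
  fixes A :: "real set"
  assumes A [measurable]: "A \<in> sets borel" and sub: "A \<subseteq> {-n..n}" and pos: "emeasure lborel A > 0"
  obtains \<alpha> where "AE x in lborel. x \<in> A \<longrightarrow> x \<le> \<alpha>"
    and "\<And>\<epsilon>. \<epsilon> > 0 \<Longrightarrow> emeasure lborel {x \<in> A. \<alpha> - \<epsilon> \<le> x} > 0"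
proof -
  \<comment> \<open>\<open>S\<close> collects the almost-everywhere upper bounds of
    \<open>A\<close>. Its infimum is the essential supremum: unlike the true supremum it ignores
    null sets, and by minimality \<open>A\<close> has mass arbitrarily close below it.\<close>
  define S where "S = {s. AE x in lborel. x \<in> A \<longrightarrow> x \<le> s}"
  have nS: "n \<in> S" using sub by (auto simp: S_def intro!: AE_I2)
  \<comment> \<open>The positive mass of \<open>A\<close> keeps \<open>S\<close> bounded below: for
    a null set every real number would be an almost-everywhere upper bound.\<close>
  have lb: "- n \<le> s" if "s \<in> S" for s
  proof (rule ccontr)
    assume "\<not> - n \<le> s"
    have "AE x in lborel. x \<in> A \<longrightarrow> x \<le> s" using that by (simp add: S_def)
    then have "AE x in lborel. x \<notin> A"
      by eventually_elim (use sub \<open>\<not> - n \<le> s\<close> in force)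
    then have "emeasure lborel A = 0" by (subst (asm) AE_iff_null_sets[symmetric]) auto
    then show False using pos by simp
  qed
  then have bdd: "bdd_below S" by (rule bdd_belowI)
  define \<alpha> where "\<alpha> = Inf S"
  have "\<forall>k::nat. \<exists>s\<in>S. s < \<alpha> + 1 / Suc k"
    using cInf_lessD[of S] nS unfolding \<alpha>_def by (metis empty_iff less_add_same_cancel1 of_nat_0_less_iff zero_less_Suc zero_less_divide_1_iff)
  then have "AE x in lborel. x \<in> A \<longrightarrow> x \<le> \<alpha> + 1 / Suc k" for k :: nat
  proof -
    obtain s where "s \<in> S" "s < \<alpha> + 1 / Suc k" using \<open>\<forall>k::nat. _\<close> by blast
    have "AE x in lborel. x \<in> A \<longrightarrow> x \<le> s" using \<open>s \<in> S\<close> by (simp add: S_def)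
    then show ?thesis by eventually_elim (use \<open>s < _\<close> in auto)
  qed
  then have "AE x in lborel. \<forall>k::nat. x \<in> A \<longrightarrow> x \<le> \<alpha> + 1 / Suc k"
    unfolding AE_all_countable by blast
  then have 1: "AE x in lborel. x \<in> A \<longrightarrow> x \<le> \<alpha>"
  proof (rule AE_mp, intro AE_I2 impI)
    fix x assume *: "\<forall>k::nat. x \<in> A \<longrightarrow> x \<le> \<alpha> + 1 / Suc k" "x \<in> A"
    have "(\<lambda>k. \<alpha> + 1 / Suc k) \<longlonglongrightarrow> \<alpha> + 0"
      by (intro tendsto_intros LIMSEQ_Suc[OF lim_1_over_n])
    then show "x \<le> \<alpha>" using * by (intro LIMSEQ_le_const[of _ \<alpha>]) auto
  qed
  have 2: "emeasure lborel {x \<in> A. \<alpha> - \<epsilon> \<le> x} > 0" if "\<epsilon> > 0" for \<epsilon>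
  proof (rule ccontr)
    assume "\<not> ?thesis"
    then have "emeasure lborel {x \<in> A. \<alpha> - \<epsilon> \<le> x} = 0" by simp
    then have "AE x in lborel. x \<notin> {x \<in> A. \<alpha> - \<epsilon> \<le> x}"
      by (subst AE_iff_null_sets[symmetric]) auto
    then have "AE x in lborel. x \<in> A \<longrightarrow> x \<le> \<alpha> - \<epsilon>" by eventually_elim auto
    then have "\<alpha> - \<epsilon> \<in> S" by (simp add: S_def)
    then have "\<alpha> \<le> \<alpha> - \<epsilon>" unfolding \<alpha>_def by (intro cInf_lower bdd)
    then show False using that by simp
  qed
  from 1 2 show thesis by (rule that)
qed

text \<open>Reflection at the origin preserves Lebesgue measure and turns the essential infimum of
  \<open>B\<close> into an essential supremum.\<close>

lemma essential_endpoint_below: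
  fixes B :: "real set"
  assumes B [measurable]: "B \<in> sets borel" and sub: "B \<subseteq> {-n..n}" and pos: "emeasure lborel B > 0"
  obtains \<beta> where "AE x in lborel. x \<in> B \<longrightarrow> \<beta> \<le> x"
    and "\<And>\<epsilon>. \<epsilon> > 0 \<Longrightarrow> emeasure lborel {x \<in> B. x \<le> \<beta> + \<epsilon>} > 0"
proof -
  define A where "A = {x. - x \<in> B}"
  have reflect: "emeasure lborel {x. - x \<in> D} = emeasure lborel D" if [measurable]: "D \<in> sets borel" for D :: "real set"
  proof -
    have "emeasure lborel D = (\<integral>\<^sup>+x. indicator D (- x) \<partial>lborel)"
      using nn_integral_real_affine[of "indicator D" "-1" 0] by simp
    also have "\<dots> = (\<integral>\<^sup>+x. indicator {x. - x \<in> D} x \<partial>lborel)"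
      by (intro nn_integral_cong) (simp add: indicator_def)
    finally show ?thesis by simp
  qed
  have [measurable]: "A \<in> sets borel" unfolding A_def by measurable
  have "emeasure lborel A > 0" using reflect[OF B] pos by (simp add: A_def)
  moreover have "A \<subseteq> {-n..n}" using sub by (force simp: A_def)
  ultimately obtain \<alpha> where 1: "AE x in lborel. x \<in> A \<longrightarrow> x \<le> \<alpha>"
    and 2: "\<And>\<epsilon>. \<epsilon> > 0 \<Longrightarrow> emeasure lborel {x \<in> A. \<alpha> - \<epsilon> \<le> x} > 0"
    using essential_endpoint[of A n] \<open>A \<in> sets borel\<close> by blast
  have "emeasure lborel {x. \<not> (x \<in> A \<longrightarrow> x \<le> \<alpha>)} = 0"
    using 1 by (subst (asm) AE_iff_null) auto
  then have "emeasure lborel {x. \<not> (x \<in> B \<longrightarrow> - \<alpha> \<le> x)} = 0"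
    using reflect[of "{x. \<not> (x \<in> B \<longrightarrow> - \<alpha> \<le> x)}"] by (simp add: A_def)
  then have "AE x in lborel. x \<in> B \<longrightarrow> - \<alpha> \<le> x"
    by (subst AE_iff_null) auto
  moreover have "emeasure lborel {x \<in> B. x \<le> - \<alpha> + \<epsilon>} > 0" if "\<epsilon> > 0" for \<epsilon>
  proof -
    have "{x \<in> A. \<alpha> - \<epsilon> \<le> x} = {x. - x \<in> {x \<in> B. x \<le> - \<alpha> + \<epsilon>}}" by (auto simp: A_def)
    then show ?thesis using 2[OF that] reflect[of "{x \<in> B. x \<le> - \<alpha> + \<epsilon>}"] by simp
  qed
  ultimately show thesis by (rule that)
qed

text \<open>
  Comparing \<open>|A| |B|\<close>, written as a double integral, with \<open>|C| |B| / s\<close> avoids density points: in the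
  essential Brunn-Minkowski inequality below, it is applied with one of the two sets cut down to a
  small neighbourhood of its essential endpoint.
\<close>

lemma essential_sumset_ge:
  fixes A B C :: "real set" and s u :: real
  assumes [measurable]: "A \<in> sets borel" "B \<in> sets borel" "C \<in> sets borel"
    and "s > 0" and B: "0 < emeasure lborel B" "emeasure lborel B < \<infinity>"
    and AE: "AE y in lborel. AE x in lborel. x \<in> A \<longrightarrow> y \<in> B \<longrightarrow> s * x + u * y \<in> C"
  shows "ennreal s * emeasure lborel A \<le> emeasure lborel C"
proof -
  have aff: "(\<integral>\<^sup>+x. indicator C (s * x + u * y) \<partial>lborel) = emeasure lborel C / ennreal s" for y
  proof -
    have "emeasure lborel C = (\<integral>\<^sup>+x. indicator C x \<partial>lborel)" by simp
    also have "\<dots> = ennreal s * (\<integral>\<^sup>+x. indicator C (u * y + s * x) \<partial>lborel)"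
      using nn_integral_real_affine[of "indicator C" s "u * y"] \<open>s > 0\<close> by simp
    finally show ?thesis using \<open>s > 0\<close>
      by (metis (no_types, lifting) add.commute ennreal_eq_0_iff ennreal_neq_top mult.commute
          mult_divide_eq_ennreal nn_integral_cong not_less)
  qed
  have "emeasure lborel A * emeasure lborel B = (\<integral>\<^sup>+y. (\<integral>\<^sup>+x. indicator A x * indicator B y \<partial>lborel) \<partial>lborel)"
    by (simp add: nn_integral_multc nn_integral_cmult)
  also have "\<dots> \<le> (\<integral>\<^sup>+y. (\<integral>\<^sup>+x. indicator C (s * x + u * y) * indicator B y \<partial>lborel) \<partial>lborel)"
  proof (rule nn_integral_mono_AE, use AE in eventually_elim)
    case (elim y)
    show ?case
      by (rule nn_integral_mono_AE, use elim in eventually_elim) (auto simp: indicator_def)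
  qed
  also have "\<dots> = (\<integral>\<^sup>+y. (emeasure lborel C / ennreal s) * indicator B y \<partial>lborel)"
    by (simp add: nn_integral_multc aff)
  also have "\<dots> = (emeasure lborel C / ennreal s) * emeasure lborel B"
    by (simp add: nn_integral_cmult)
  finally have "emeasure lborel B * emeasure lborel A \<le> emeasure lborel B * (emeasure lborel C / ennreal s)"
    by (simp add: mult.commute)
  then have "emeasure lborel A \<le> emeasure lborel C / ennreal s"
    using B by (subst (asm) ennreal_mult_le_mult_iff) auto
  then show ?thesis using \<open>s > 0\<close>
    by (metis divide_le_posI_ennreal ennreal_divide_self ennreal_eq_0_iff ennreal_less_zero_iff ennreal_neq_top ennreal_times_divide linorder_not_le mult.commute mult_left_mono mult_divide_eq_ennreal zero_le)
qed

text \<open>Classically the weighted sumset contains \<open>t A + (1 - t) inf B\<close> and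
  \<open>t sup A + (1 - t) B\<close>, which share at most one point, so their lengths add. Here the
  endpoints are essential ones, approached within \<epsilon> by subsets of positive measure, and the
  two pieces of \<open>C\<close> overlap in an interval of length \<epsilon>.\<close>

lemma essential_Brunn_Minkowski_bounded:
  fixes A B C :: "real set" and t n :: real
  assumes m [measurable]: "A \<in> sets borel" "B \<in> sets borel" "C \<in> sets borel"
    and t: "0 < t" "t < 1"
    and sub: "A \<subseteq> {-n..n}" "B \<subseteq> {-n..n}"
    and pos: "emeasure lborel A > 0" "emeasure lborel B > 0"
    and AE: "AE z in lborel \<Otimes>\<^sub>M lborel. fst z \<in> A \<longrightarrow> snd z \<in> B \<longrightarrow> t * fst z + (1 - t) * snd z \<in> C"
  shows "ennreal t * emeasure lborel A + ennreal (1 - t) * emeasure lborel B \<le> emeasure lborel C"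
proof -
  obtain \<alpha> where a1: "AE x in lborel. x \<in> A \<longrightarrow> x \<le> \<alpha>"
    and a2: "\<And>\<epsilon>. \<epsilon> > 0 \<Longrightarrow> emeasure lborel {x \<in> A. \<alpha> - \<epsilon> \<le> x} > 0"
    using essential_endpoint[OF m(1) sub(1) pos(1)] by blast
  obtain \<beta> where b1: "AE x in lborel. x \<in> B \<longrightarrow> \<beta> \<le> x"
    and b2: "\<And>\<epsilon>. \<epsilon> > 0 \<Longrightarrow> emeasure lborel {x \<in> B. x \<le> \<beta> + \<epsilon>} > 0"
    using essential_endpoint_below[OF m(2) sub(2) pos(2)] by blast
  \<comment> \<open>Both orders of the iterated statement are needed:
    \<open>essential_sumset_ge\<close> puts the variable of the cut-down set outermost, and each of
    the two sets is cut down once.\<close>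
  have "AE x in lborel. AE y in lborel. x \<in> A \<longrightarrow> y \<in> B \<longrightarrow> t * x + (1 - t) * y \<in> C"
    using lborel_pair.AE_pair[OF AE] by simp
  then have AE1: "AE x in lborel. AE y in lborel. x \<in> A \<longrightarrow> y \<in> B \<longrightarrow> (1 - t) * y + t * x \<in> C"
    by (simp add: add.commute)
  moreover have "{z \<in> space (lborel \<Otimes>\<^sub>M lborel). fst z \<in> A \<longrightarrow> snd z \<in> B \<longrightarrow> (1 - t) * snd z + t * fst z \<in> C}
      \<in> sets (lborel \<Otimes>\<^sub>M lborel)"
    by measurable
  ultimately have "AE y in lborel. AE x in lborel. x \<in> A \<longrightarrow> y \<in> B \<longrightarrow> (1 - t) * y + t * x \<in> C"
    using lborel_pair.AE_commute[of "\<lambda>x y. x \<in> A \<longrightarrow> y \<in> B \<longrightarrow> (1 - t) * y + t * x \<in> C"]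
    by blast
  then have AE2: "AE y in lborel. AE x in lborel. x \<in> A \<longrightarrow> y \<in> B \<longrightarrow> t * x + (1 - t) * y \<in> C"
    by (simp add: add.commute)
  have fin: "emeasure lborel D < top" if "D \<subseteq> {-n..n}" for D
  proof -
    have "emeasure lborel D \<le> emeasure lborel {-n..n}" by (rule emeasure_mono[OF that]) simp
    also have "\<dots> < top" unfolding emeasure_lborel_Icc_eq by simp
    finally show ?thesis .
  qed
  have "ennreal t * emeasure lborel A + ennreal (1 - t) * emeasure lborel B \<le> emeasure lborel C + ennreal \<epsilon>"
    if e: "\<epsilon> > 0" for \<epsilon>
  proof -
    \<comment> \<open>\<open>C1\<close> receives the combinations with \<open>y\<close> at most
      \<epsilon> above the essential infimum of \<open>B\<close>, \<open>C2\<close> those with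
      \<open>x\<close> at most \<epsilon> below the essential supremum of \<open>A\<close>.\<close>
    define C1 where "C1 = {z \<in> C. z \<le> t * \<alpha> + (1 - t) * (\<beta> + \<epsilon>)}"
    define C2 where "C2 = {z \<in> C. t * (\<alpha> - \<epsilon>) + (1 - t) * \<beta> \<le> z}"
    have [measurable]: "C1 \<in> sets borel" "C2 \<in> sets borel" unfolding C1_def C2_def by auto
    have 1: "ennreal t * emeasure lborel A \<le> emeasure lborel C1"
    proof (rule essential_sumset_ge[where B="{x \<in> B. x \<le> \<beta> + \<epsilon>}" and u="1 - t"])
      show "AE y in lborel. AE x in lborel. x \<in> A \<longrightarrow> y \<in> {x \<in> B. x \<le> \<beta> + \<epsilon>} \<longrightarrow> t * x + (1 - t) * y \<in> C1"
        using AE2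
      proof eventually_elim
        case (elim y)
        with a1 show ?case
          by eventually_elim (use t in \<open>auto simp: C1_def intro!: add_mono mult_left_mono\<close>)
      qed
    next
      show "emeasure lborel {x \<in> B. x \<le> \<beta> + \<epsilon>} < \<infinity>"
        using fin[of "{x \<in> B. x \<le> \<beta> + \<epsilon>}"] sub by (simp add: subset_iff)
    next
      show "0 < emeasure lborel {x \<in> B. x \<le> \<beta> + \<epsilon>}" by (rule b2[OF e])
    qed (measurable, rule t)
    have 2: "ennreal (1 - t) * emeasure lborel B \<le> emeasure lborel C2"
    proof (rule essential_sumset_ge[where B="{x \<in> A. \<alpha> - \<epsilon> \<le> x}" and u="t"])
      show "AE x in lborel. AE y in lborel. y \<in> B \<longrightarrow> x \<in> {x \<in> A. \<alpha> - \<epsilon> \<le> x} \<longrightarrow> (1 - t) * y + t * x \<in> C2"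
        using AE1
      proof eventually_elim
        case (elim x)
        with b1 show ?case
        proof eventually_elim
          case (elim y)
          then show ?case using t add_mono[of "(1 - t) * \<beta>" "(1 - t) * y" "t * (\<alpha> - \<epsilon>)" "t * x"]
            by (auto simp: C2_def add.commute)
        qed
      qed
    next
      show "emeasure lborel {x \<in> A. \<alpha> - \<epsilon> \<le> x} < \<infinity>"
        using fin[of "{x \<in> A. \<alpha> - \<epsilon> \<le> x}"] sub by (simp add: subset_iff)
    next
      show "0 < emeasure lborel {x \<in> A. \<alpha> - \<epsilon> \<le> x}" by (rule a2[OF e])
      show "0 < 1 - t" using t by simp
    qed measurable
    have "ennreal t * emeasure lborel A + ennreal (1 - t) * emeasure lborel B
        \<le> emeasure lborel C1 + emeasure lborel C2"
      using 1 2 by (rule add_mono)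
    also have "\<dots> = emeasure lborel (C1 \<union> C2) + emeasure lborel (C1 \<inter> C2)"
      by (rule emeasure_Un_Int) auto
    also have "\<dots> \<le> emeasure lborel C + emeasure lborel {t * (\<alpha> - \<epsilon>) + (1 - t) * \<beta> .. t * \<alpha> + (1 - t) * (\<beta> + \<epsilon>)}"
      by (rule add_mono; rule emeasure_mono) (auto simp: C1_def C2_def)
    also have "emeasure lborel {t * (\<alpha> - \<epsilon>) + (1 - t) * \<beta> .. t * \<alpha> + (1 - t) * (\<beta> + \<epsilon>)} = ennreal \<epsilon>"
    proof -
      \<comment> \<open>The overlap contributes \<open>t \<epsilon>\<close> from one side and
        \<open>(1 - t) \<epsilon>\<close> from the other.\<close>
      have *: "t * \<alpha> + (1 - t) * (\<beta> + \<epsilon>) - (t * (\<alpha> - \<epsilon>) + (1 - t) * \<beta>) = \<epsilon>" by (simp add: left_diff_distrib right_diff_distrib distrib_left)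
      then have "t * (\<alpha> - \<epsilon>) + (1 - t) * \<beta> \<le> t * \<alpha> + (1 - t) * (\<beta> + \<epsilon>)" using e by linarith
      from emeasure_lborel_Icc[OF this] show ?thesis unfolding * .
    qed
    finally show ?thesis .
  qed
  then show ?thesis by (rule ennreal_le_epsilon)
qed

text \<open>The endpoint argument needs bounded sets, so both sets are cut by
  \<open>[-n, n]\<close>, with \<open>n\<close> large enough for both pieces to keep positive
  measure. If one set were null, the hypothesis would be void and the inequality could fail.\<close>

lemma essential_Brunn_Minkowski:
  fixes A B C :: "real set" and t :: real
  assumes m [measurable]: "A \<in> sets borel" "B \<in> sets borel" "C \<in> sets borel"
    and t: "0 < t" "t < 1"
    and pos: "emeasure lborel A > 0" "emeasure lborel B > 0"
    and AE: "AE z in lborel \<Otimes>\<^sub>M lborel. fst z \<in> A \<longrightarrow> snd z \<in> B \<longrightarrow> t * fst z + (1 - t) * snd z \<in> C"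
  shows "ennreal t * emeasure lborel A + ennreal (1 - t) * emeasure lborel B \<le> emeasure lborel C"
proof -
  have lim: "(\<lambda>n. emeasure lborel (D \<inter> {- real n..real n})) \<longlonglongrightarrow> emeasure lborel D"
    if [measurable]: "D \<in> sets borel" for D :: "real set"
  proof -
    have "(\<Union>n. D \<inter> {- real n..real n}) = D"
    proof -
      have "\<exists>n::nat. x \<in> {- real n..real n}" for x :: real
        using real_arch_simple[of "\<bar>x\<bar>"] by (metis abs_le_iff atLeastAtMost_iff minus_le_iff)
      then show ?thesis by blast
    qed
    moreover have "(\<lambda>n. emeasure lborel (D \<inter> {- real n..real n})) \<longlonglongrightarrow> emeasure lborel (\<Union>n. D \<inter> {- real n..real n})"
      by (rule Lim_emeasure_incseq) (auto simp: incseq_def)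
    ultimately show ?thesis by simp
  qed
  have ev: "eventually (\<lambda>n. emeasure lborel (A \<inter> {- real n..real n}) > 0 \<and> emeasure lborel (B \<inter> {- real n..real n}) > 0) sequentially"
    using order_tendstoD(1)[OF lim[OF m(1)] pos(1)] order_tendstoD(1)[OF lim[OF m(2)] pos(2)]
    by eventually_elim simp
  have "(\<lambda>n. ennreal t * emeasure lborel (A \<inter> {- real n..real n}) + ennreal (1 - t) * emeasure lborel (B \<inter> {- real n..real n}))
     \<longlonglongrightarrow> ennreal t * emeasure lborel A + ennreal (1 - t) * emeasure lborel B"
    by (intro tendsto_add ennreal_tendsto_cmult lim) auto
  then show ?thesis
  proof (rule tendsto_upperbound)
    show "\<forall>\<^sub>F n in sequentially. ennreal t * emeasure lborel (A \<inter> {- real n..real n}) + ennreal (1 - t) * emeasure lborel (B \<inter> {- real n..real n}) \<le> emeasure lborel C"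
      using ev
    proof eventually_elim
      case (elim n)
      show ?case
        by (rule essential_Brunn_Minkowski_bounded[where n = "real n"])
          (use elim t in \<open>auto intro: eventually_mono[OF AE]\<close>)
    qed
  qed auto
qed


section \<open>From sets to functions: level sets and the Prekopa-Leindler inequality\<close>

lemma essential_sup_real:
  fixes q :: "real \<Rightarrow> real"
  assumes [measurable]: "q \<in> borel_measurable borel"
    and q: "\<And>x. 0 \<le> q x" "\<And>x. q x \<le> M" and pos: "(\<integral>\<^sup>+x. ennreal (q x) \<partial>lborel) \<noteq> 0"
  obtains m where "m > 0" "AE x in lborel. q x \<le> m"
    "\<And>l. l < m \<Longrightarrow> emeasure lborel {x. l < q x} > 0"
proof -
  define S where "S = {s. AE x in lborel. q x \<le> s}"
  have MS: "M \<in> S" using q by (simp add: S_def)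
  have lb: "0 \<le> s" if "s \<in> S" for s
  proof (rule ccontr)
    assume "\<not> 0 \<le> s"
    have "AE x in lborel. q x \<le> s" using that by (simp add: S_def)
    then have "AE x in (lborel::real measure). False"
      by eventually_elim (use q \<open>\<not> 0 \<le> s\<close> in \<open>meson dual_order.trans\<close>)
    then show False by (subst (asm) AE_iff_null) (auto)
  qed
  then have bdd: "bdd_below S" by (rule bdd_belowI)
  define m where "m = Inf S"
  have 2: "emeasure lborel {x. l < q x} > 0" if "l < m" for l
  proof (rule ccontr)
    assume "\<not> ?thesis"
    then have "emeasure lborel {x. l < q x} = 0" by simp
    then have "AE x in lborel. q x \<le> l"
      by (subst AE_iff_null) (auto simp: not_le)
    then have "l \<in> S" by (simp add: S_def)
    then have "m \<le> l" unfolding m_def by (intro cInf_lower bdd)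
    then show False using that by simp
  qed
  have "AE x in lborel. q x \<le> m + 1 / Suc k" for k :: nat
  proof -
    have "Inf S < m + 1 / Suc k" by (simp add: m_def)
    then obtain s where s: "s \<in> S" "s < m + 1 / Suc k"
      using cInf_lessD[of S] MS by blast
    have "AE x in lborel. q x \<le> s" using s by (simp add: S_def)
    then show ?thesis by eventually_elim (use s in auto)
  qed
  then have "AE x in lborel. \<forall>k::nat. q x \<le> m + 1 / Suc k"
    unfolding AE_all_countable by blast
  then have 1: "AE x in lborel. q x \<le> m"
  proof eventually_elim
    case (elim x)
    have "(\<lambda>k. m + 1 / Suc k) \<longlonglongrightarrow> m + 0"
      by (intro tendsto_intros LIMSEQ_Suc[OF lim_1_over_n])
    then show "q x \<le> m" using elim by (intro LIMSEQ_le_const[of _ m]) auto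
  qed
  \<comment> \<open>A nonzero integral prevents the essential supremum from vanishing, so that a
    function can later be divided by it.\<close>
  have "m > 0"
  proof (rule ccontr)
    assume "\<not> m > 0"
    from 1 have "AE x in lborel. ennreal (q x) = 0"
      by eventually_elim (use \<open>\<not> m > 0\<close> in \<open>simp add: ennreal_eq_0_iff\<close>)
    then have "(\<integral>\<^sup>+x. ennreal (q x) \<partial>lborel) = 0"
      by (subst nn_integral_0_iff_AE) auto
    then show False using pos by simp
  qed
  from this 1 2 show thesis by (rule that)
qed

lemma nn_integral_layer_cake:
  fixes f :: "'a \<Rightarrow> ennreal"
  assumes "sigma_finite_measure M" and [measurable]: "f \<in> borel_measurable M"
  shows "(\<integral>\<^sup>+x. f x \<partial>M) = (\<integral>\<^sup>+l. indicator {0<..} l * emeasure M {x \<in> space M. ennreal l < f x} \<partial>lborel)"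
proof -
  interpret M: sigma_finite_measure M by fact
  interpret pair_sigma_finite M lborel ..
  have f: "f x = (\<integral>\<^sup>+l. indicator {0<..} l * indicator {l. ennreal l < f x} l \<partial>lborel)" for x
  proof (cases "f x")
    case (real r)
    have "(\<integral>\<^sup>+l. indicator {0<..} l * indicator {l. ennreal l < f x} l \<partial>lborel) = (\<integral>\<^sup>+l. indicator {0<..<r} l \<partial>lborel)"
      by (intro nn_integral_cong) (use real in \<open>auto simp: indicator_def ennreal_less_iff\<close>)
    then show ?thesis using real by simp
  next
    case top
    have "(\<integral>\<^sup>+l. indicator {0<..} l * indicator {l. ennreal l < f x} l \<partial>lborel) = (\<integral>\<^sup>+l. indicator {0::real<..} l \<partial>lborel)"
      by (intro nn_integral_cong) (use top in \<open>auto simp: indicator_def\<close>)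
    also have "\<dots> = emeasure lborel {0::real<..}" by simp
    also have "\<dots> = \<infinity>" proof -
      have "of_nat n \<le> emeasure lborel {0::real<..}" for n
      proof -
        have "{0<..real n} \<subseteq> {0<..}" by auto
        from emeasure_mono[OF this, of lborel] show ?thesis by (simp add: ennreal_of_nat_eq_real_of_nat)
      qed
      note le = this
      show ?thesis
      proof (rule ccontr)
        assume "emeasure lborel {0::real<..} \<noteq> \<infinity>"
        then obtain n where "emeasure lborel {0::real<..} < of_nat n"
          using ennreal_Ex_less_of_nat[of "emeasure lborel {0::real<..}"] by (auto simp: less_top)
        with le[of n] show False by simp
      qed
    qed
    finally show ?thesis using top by simp
  qed
  have "(\<integral>\<^sup>+x. f x \<partial>M) = (\<integral>\<^sup>+x. (\<integral>\<^sup>+l. indicator {0<..} l * indicator {l. ennreal l < f x} l \<partial>lborel) \<partial>M)"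
    using f by simp
  also have "\<dots> = (\<integral>\<^sup>+l. (\<integral>\<^sup>+x. indicator {0<..} l * indicator {l. ennreal l < f x} l \<partial>M) \<partial>lborel)"
    by (rule Fubini'[symmetric]) measurable
  also have "\<dots> = (\<integral>\<^sup>+l. indicator {0<..} l * emeasure M {x \<in> space M. ennreal l < f x} \<partial>lborel)"
  proof (intro nn_integral_cong)
    fix l :: real
    have "(\<integral>\<^sup>+x. indicator {0<..} l * indicator {l. ennreal l < f x} l \<partial>M)
       = (\<integral>\<^sup>+x. indicator {0<..} l * indicator {x \<in> space M. ennreal l < f x} x \<partial>M)"
      by (intro nn_integral_cong) (auto simp: indicator_def)
    then show "(\<integral>\<^sup>+x. indicator {0<..} l * indicator {l. ennreal l < f x} l \<partial>M)
      = indicator {0<..} l * emeasure M {x \<in> space M. ennreal l < f x}"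
      by (simp add: nn_integral_cmult)
  qed
  finally show ?thesis .
qed

text \<open>Level sets reduce the claim to the Brunn-Minkowski inequality, which needs both sets to
  have positive mass. Dividing \<open>q\<close> and \<open>r\<close> by their essential suprema
  guarantees this for every level in (0,1) and makes all higher levels null, so one range of levels
  serves both functions. The outcome is a bound by the arithmetic mean of the normalised integrals,
  which dominates the geometric one.\<close>

lemma essential_Prekopa_Leindler:
  fixes q r :: "real \<Rightarrow> real" and p :: "real \<Rightarrow> ennreal" and t :: real
  assumes m [measurable]: "p \<in> borel_measurable borel" "q \<in> borel_measurable borel" "r \<in> borel_measurable borel"
    and t: "0 < t" "t < 1"
    and q: "\<And>x. 0 \<le> q x" "\<And>x. q x \<le> M" and r: "\<And>x. 0 \<le> r x" "\<And>x. r x \<le> M"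
    and fin: "(\<integral>\<^sup>+x. ennreal (q x) \<partial>lborel) < \<infinity>" "(\<integral>\<^sup>+x. ennreal (r x) \<partial>lborel) < \<infinity>"
    and AE: "AE z in lborel \<Otimes>\<^sub>M lborel. ennreal (q (fst z) powr t * r (snd z) powr (1 - t)) \<le> p (t * fst z + (1 - t) * snd z)"
  shows "ennreal (enn2real (\<integral>\<^sup>+x. ennreal (q x) \<partial>lborel) powr t * enn2real (\<integral>\<^sup>+x. ennreal (r x) \<partial>lborel) powr (1 - t))
    \<le> (\<integral>\<^sup>+x. p x \<partial>lborel)"
proof (cases "(\<integral>\<^sup>+x. ennreal (q x) \<partial>lborel) = 0 \<or> (\<integral>\<^sup>+x. ennreal (r x) \<partial>lborel) = 0")
  case True
  then show ?thesis using t by auto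
next
  case False
  obtain mq where mq: "mq > 0" "AE x in lborel. q x \<le> mq"
    "\<And>l. l < mq \<Longrightarrow> emeasure lborel {x. l < q x} > 0"
    using essential_sup_real[OF m(2) q] False by blast
  obtain mr where mr: "mr > 0" "AE x in lborel. r x \<le> mr"
    "\<And>l. l < mr \<Longrightarrow> emeasure lborel {x. l < r x} > 0"
    using essential_sup_real[OF m(3) r] False by blast
  \<comment> \<open>Replacing \<open>q\<close> and \<open>r\<close> by \<open>q / mq\<close> and
    \<open>r / mr\<close> in the hypothesis amounts to dividing \<open>p\<close> by this
    constant.\<close>
  define K where "K = mq powr t * mr powr (1 - t)"
  have K: "K > 0" using mq mr by (simp add: K_def)
  define Iq where "Iq = enn2real (\<integral>\<^sup>+x. ennreal (q x) \<partial>lborel)"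
  define Ir where "Ir = enn2real (\<integral>\<^sup>+x. ennreal (r x) \<partial>lborel)"
  have Iq: "(\<integral>\<^sup>+x. ennreal (q x) \<partial>lborel) = ennreal Iq" "Iq > 0"
    using False fin by (auto simp: Iq_def enn2real_positive_iff less_top zero_less_iff_neq_zero)
  have Ir: "(\<integral>\<^sup>+x. ennreal (r x) \<partial>lborel) = ennreal Ir" "Ir > 0"
    using False fin by (auto simp: Ir_def enn2real_positive_iff less_top zero_less_iff_neq_zero)
  have lay: "ennreal (I / mf) = (\<integral>\<^sup>+l. indicator {0<..<1} l * emeasure lborel {x. l * mf < f x} \<partial>lborel)"
    if [measurable]: "f \<in> borel_measurable borel" and f: "\<And>x. 0 \<le> f x" "mf > 0" "AE x in lborel. f x \<le> mf"
      and I: "(\<integral>\<^sup>+x. ennreal (f x) \<partial>lborel) = ennreal I" for f I and mf :: real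
  proof -
    have "ennreal (I / mf) = ennreal (1 / mf) * (\<integral>\<^sup>+x. ennreal (f x) \<partial>lborel)"
      unfolding I using f by (simp flip: ennreal_mult')
    also have "\<dots> = (\<integral>\<^sup>+x. ennreal (f x / mf) \<partial>lborel)"
      using f by (subst nn_integral_cmult[symmetric]) (auto simp flip: ennreal_mult')
    also have "\<dots> = (\<integral>\<^sup>+l. indicator {0<..} l * emeasure lborel {x. ennreal l < ennreal (f x / mf)} \<partial>lborel)"
      by (subst nn_integral_layer_cake) (auto simp: lborel.sigma_finite_measure_axioms)
    also have "\<dots> = (\<integral>\<^sup>+l. indicator {0<..<1} l * emeasure lborel {x. l * mf < f x} \<partial>lborel)"
    proof (intro nn_integral_cong)
      fix l :: real
      have eq: "{x. ennreal l < ennreal (f x / mf)} = {x. l * mf < f x}" if "l > 0"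
        using that f by (auto simp: ennreal_less_iff pos_less_divide_eq)
      have 0: "emeasure lborel {x. l * mf < f x} = 0" if "l \<ge> 1"
      proof -
        have "AE x in lborel. \<not> l * mf < f x"
          using f(3)
        proof eventually_elim
          case (elim x)
          have "mf \<le> l * mf" using that f(2) by simp
          with elim show ?case by simp
        qed
        then show ?thesis by (subst (asm) AE_iff_null) auto
      qed
      show "indicator {0<..} l * emeasure lborel {x. ennreal l < ennreal (f x / mf)}
        = indicator {0<..<1} l * emeasure lborel {x. l * mf < f x}"
        using eq 0 by (cases "l > 0"; cases "l < 1") (auto simp: indicator_def)
    qed
    finally show ?thesis .
  qed
  \<comment> \<open>Young's inequality supplies the passage to the arithmetic mean, the form in
    which the layer-cake integrals can be compared level by level.\<close>
  have "ennreal ((Iq / mq) powr t * (Ir / mr) powr (1 - t)) \<le> ennreal (t * (Iq / mq) + (1 - t) * (Ir / mr))"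
    using Youngs_inequality_0[of t "1 - t" "Iq / mq" "Ir / mr"] t Iq Ir mq mr by (intro ennreal_leI) auto
  also have "\<dots> = ennreal t * ennreal (Iq / mq) + ennreal (1 - t) * ennreal (Ir / mr)"
    using t Iq Ir mq mr by (subst (1 2) ennreal_mult[symmetric]) (auto intro!: ennreal_plus)
  also have "\<dots> = (\<integral>\<^sup>+l. indicator {0<..<1} l * (ennreal t * emeasure lborel {x. l * mq < q x}
      + ennreal (1 - t) * emeasure lborel {x. l * mr < r x}) \<partial>lborel)"
    unfolding lay[OF m(2) q(1) mq(1,2) Iq(1)] lay[OF m(3) r(1) mr(1,2) Ir(1)]
    by (simp add: nn_integral_add nn_integral_cmult distrib_left mult.left_commute)
  also have "\<dots> \<le> (\<integral>\<^sup>+l. indicator {0<..} l * emeasure lborel {x. ennreal l < ennreal (1 / K) * p x} \<partial>lborel)"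
  proof (intro nn_integral_mono)
    fix l :: real
    consider "0 < l" "l < 1" | "\<not> (0 < l \<and> l < 1)" by blast
    then show "indicator {0<..<1} l * (ennreal t * emeasure lborel {x. l * mq < q x}
      + ennreal (1 - t) * emeasure lborel {x. l * mr < r x})
      \<le> indicator {0<..} l * emeasure lborel {x. ennreal l < ennreal (1 / K) * p x}"
    proof cases
      case 1
      have "ennreal t * emeasure lborel {x. l * mq < q x} + ennreal (1 - t) * emeasure lborel {x. l * mr < r x}
        \<le> emeasure lborel {x. ennreal l < ennreal (1 / K) * p x}"
      proof (rule essential_Brunn_Minkowski[OF _ _ _ t])
        show "0 < emeasure lborel {x. l * mq < q x}" "0 < emeasure lborel {x. l * mr < r x}"
          using 1 mq mr by auto
        show "AE z in lborel \<Otimes>\<^sub>M lborel. fst z \<in> {x. l * mq < q x} \<longrightarrow> snd z \<in> {x. l * mr < r x} \<longrightarrow>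
            t * fst z + (1 - t) * snd z \<in> {x. ennreal l < ennreal (1 / K) * p x}"
          using AE
        proof eventually_elim
          case (elim z)
          show ?case
          proof (intro impI CollectI)
            assume "fst z \<in> {x. l * mq < q x}" "snd z \<in> {x. l * mr < r x}"
            then have *: "l * mq < q (fst z)" "l * mr < r (snd z)" by auto
            have "l * K = (l * mq) powr t * (l * mr) powr (1 - t)"
              using 1 mq mr by (simp add: K_def powr_mult) (simp add: powr_add[symmetric])
            also have "\<dots> < q (fst z) powr t * r (snd z) powr (1 - t)"
              using * 1 mq(1) mr(1) t mult_pos_pos[OF 1(1) mq(1)] mult_pos_pos[OF 1(1) mr(1)]
              by (intro mult_strict_mono powr_less_mono2) (auto simp: mult_less_0_iff)
            finally have "l < 1 / K * (q (fst z) powr t * r (snd z) powr (1 - t))"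
              using K by (simp add: field_simps)
            then have "ennreal l < ennreal (1 / K) * ennreal (q (fst z) powr t * r (snd z) powr (1 - t))"
              using K 1 by (simp flip: ennreal_mult add: ennreal_less_iff)
            also have "\<dots> \<le> ennreal (1 / K) * p (t * fst z + (1 - t) * snd z)"
              using elim by (rule mult_left_mono) simp
            finally show "ennreal l < ennreal (1 / K) * p (t * fst z + (1 - t) * snd z)" .
          qed
        qed
      qed auto
      then show ?thesis using 1 by simp
    qed (auto simp: indicator_def)
  qed
  also have "\<dots> = (\<integral>\<^sup>+x. ennreal (1 / K) * p x \<partial>lborel)"
    by (subst nn_integral_layer_cake) (auto simp: lborel.sigma_finite_measure_axioms)
  also have "\<dots> = ennreal (1 / K) * (\<integral>\<^sup>+x. p x \<partial>lborel)"
    by (simp add: nn_integral_cmult)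
  finally have "ennreal K * ennreal ((Iq / mq) powr t * (Ir / mr) powr (1 - t))
      \<le> ennreal K * (ennreal (1 / K) * (\<integral>\<^sup>+x. p x \<partial>lborel))"
    by (rule mult_left_mono) simp
  also have "\<dots> = (\<integral>\<^sup>+x. p x \<partial>lborel)"
    using K by (simp flip: mult.assoc ennreal_mult')
  also have "ennreal K * ennreal ((Iq / mq) powr t * (Ir / mr) powr (1 - t)) = ennreal (Iq powr t * Ir powr (1 - t))"
    using K mq mr Iq Ir by (simp flip: ennreal_mult add: K_def powr_divide)
  finally show ?thesis by (simp add: Iq_def Ir_def)
qed

text \<open>The Lebesgue version applied to \<open>g k q\<close>, \<open>g k r\<close> and
  \<open>g p\<close>, where \<open>g\<close> is the normal density; the penalty disappears into the
  Gaussian weights. The constant \<open>k\<close>, which will carry the penalty of all other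
  coordinates, enters both functions because \<open>k powr t * k powr (1 - t) = k\<close>.\<close>

lemma gaussian_Prekopa_Leindler:
  fixes q r :: "real \<Rightarrow> real" and p :: "real \<Rightarrow> ennreal" and t k :: real
  assumes m [measurable]: "p \<in> borel_measurable borel" "q \<in> borel_measurable borel" "r \<in> borel_measurable borel"
    and t: "0 < t" "t < 1" and k: "0 < k" "k \<le> 1"
    and q: "\<And>x. 0 \<le> q x" "\<And>x. q x \<le> M" and r: "\<And>x. 0 \<le> r x" "\<And>x. r x \<le> M"
    and AE: "AE z in lborel \<Otimes>\<^sub>M lborel. ennreal (q (fst z) powr t * r (snd z) powr (1 - t)
      * k * exp (- t * (1 - t) * (fst z - snd z)\<^sup>2 / 2)) \<le> p (t * fst z + (1 - t) * snd z)"
  shows "ennreal (k * (enn2real (\<integral>\<^sup>+x. std_normal_density x * q x \<partial>lborel) powr t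
      * enn2real (\<integral>\<^sup>+x. std_normal_density x * r x \<partial>lborel) powr (1 - t)))
    \<le> (\<integral>\<^sup>+x. std_normal_density x * p x \<partial>lborel)"
proof -
  let ?g = "std_normal_density"
  have g1: "?g x \<le> 1" for x
  proof -
    have "1 / sqrt (2 * pi) \<le> 1" using pi_ge_two by simp
    moreover have "exp (- x\<^sup>2 / 2) \<le> 1" by simp
    ultimately show ?thesis unfolding std_normal_density_def
      by (intro mult_le_one) auto
  qed
  have fin: "(\<integral>\<^sup>+x. ennreal (?g x * (k * f x)) \<partial>lborel) = ennreal k * (\<integral>\<^sup>+x. ennreal (?g x * f x) \<partial>lborel)"
    "(\<integral>\<^sup>+x. ennreal (?g x * f x) \<partial>lborel) < \<infinity>"
    if [measurable]: "f \<in> borel_measurable borel" and f: "\<And>x. 0 \<le> f x" "\<And>x. f x \<le> M" for f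
  proof -
    have "(\<integral>\<^sup>+x. ennreal (?g x * (k * f x)) \<partial>lborel) = (\<integral>\<^sup>+x. ennreal k * ennreal (?g x * f x) \<partial>lborel)"
      by (intro nn_integral_cong) (use f k in \<open>simp flip: ennreal_mult add: mult_ac\<close>)
    then show "(\<integral>\<^sup>+x. ennreal (?g x * (k * f x)) \<partial>lborel) = ennreal k * (\<integral>\<^sup>+x. ennreal (?g x * f x) \<partial>lborel)"
      by (simp add: nn_integral_cmult)
    have "0 \<le> M" using f[of 0] by linarith
    have "(\<integral>\<^sup>+x. ennreal (?g x * f x) \<partial>lborel) \<le> (\<integral>\<^sup>+x. ennreal M * ennreal (?g x) \<partial>lborel)"
      using f \<open>0 \<le> M\<close> by (intro nn_integral_mono) (auto simp flip: ennreal_mult simp: mult.commute intro!: ennreal_leI mult_right_mono)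
    also have "\<dots> = ennreal M * (\<integral>\<^sup>+x. ennreal (?g x) \<partial>lborel)"
      by (simp add: nn_integral_cmult)
    also have "(\<integral>\<^sup>+x. ennreal (?g x) \<partial>lborel) = 1"
      by (subst nn_integral_eq_integral) (auto simp: integrable_normal_density integral_normal_density)
    finally show "(\<integral>\<^sup>+x. ennreal (?g x * f x) \<partial>lborel) < \<infinity>" by (simp add: le_less_trans)
  qed
  \<comment> \<open>Since \<open>g\<close> and \<open>k\<close> are at most 1, the weighted
    functions keep the bound \<open>M\<close>.\<close>
  have b: "?g x * (k * f x) \<le> M" if "0 \<le> f x" "f x \<le> M" for f x
  proof -
    have "?g x * (k * f x) \<le> 1 * (1 * M)"
      using that g1[of x] k by (intro mult_mono) auto
    then show ?thesis by simp
  qed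
  have "ennreal (enn2real (\<integral>\<^sup>+x. ?g x * (k * q x) \<partial>lborel) powr t
      * enn2real (\<integral>\<^sup>+x. ?g x * (k * r x) \<partial>lborel) powr (1 - t))
    \<le> (\<integral>\<^sup>+x. ennreal (?g x) * p x \<partial>lborel)"
  proof (rule essential_Prekopa_Leindler[OF _ _ _ t, where M = M])
    show "AE z in lborel \<Otimes>\<^sub>M lborel. ennreal ((?g (fst z) * (k * q (fst z))) powr t * (?g (snd z) * (k * r (snd z))) powr (1 - t))
      \<le> ennreal (?g (t * fst z + (1 - t) * snd z)) * p (t * fst z + (1 - t) * snd z)"
      using AE
    proof eventually_elim
      case (elim z)
      obtain x y where z: "z = (x, y)" by (cases z)
      have g: "?g x powr t * ?g y powr (1 - t) = ?g (t * x + (1 - t) * y) * exp (- t * (1 - t) * (x - y)\<^sup>2 / 2)"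
      proof -
        let ?c = "1 / sqrt (2 * pi)"
        have c: "?c powr t * ?c powr (1 - t) = ?c" by (subst powr_add[symmetric]) simp
        have "?g x powr t * ?g y powr (1 - t) = (?c powr t * ?c powr (1 - t)) * (exp (t * (- x\<^sup>2 / 2)) * exp ((1 - t) * (- y\<^sup>2 / 2)))"
          unfolding std_normal_density_def by (subst (1 2) powr_mult) (auto simp: powr_def)
        also have "exp (t * (- x\<^sup>2 / 2)) * exp ((1 - t) * (- y\<^sup>2 / 2))
          = exp (- (t * x + (1 - t) * y)\<^sup>2 / 2) * exp (- t * (1 - t) * (x - y)\<^sup>2 / 2)"
          unfolding exp_add[symmetric] by (rule arg_cong[where f=exp]) (simp add: field_simps power2_eq_square)
        finally show ?thesis unfolding c by (simp add: std_normal_density_def)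
      qed
      have kk: "k powr t * k powr (1 - t) = k" using k by (subst powr_add[symmetric]) simp
      have "(?g x * (k * q x)) powr t * (?g y * (k * r y)) powr (1 - t)
          = (?g x powr t * ?g y powr (1 - t)) * (k powr t * k powr (1 - t)) * (q x powr t * r y powr (1 - t))"
        using k q r by (simp add: powr_mult)
      also have "\<dots> = ?g (t * x + (1 - t) * y) * (q x powr t * r y powr (1 - t) * k * exp (- t * (1 - t) * (x - y)\<^sup>2 / 2))"
        unfolding g kk by simp
      finally show ?case using mult_left_mono[OF elim, of "ennreal (?g (t * x + (1 - t) * y))"] k
        by (simp add: z flip: ennreal_mult)
    qed
    show "(\<integral>\<^sup>+x. ennreal (?g x * (k * q x)) \<partial>lborel) < \<infinity>" "(\<integral>\<^sup>+x. ennreal (?g x * (k * r x)) \<partial>lborel) < \<infinity>"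
      using fin[OF m(2) q] fin[OF m(3) r] by (auto simp: ennreal_mult_less_top)
  qed (use q r k b in auto)
  also have "enn2real (\<integral>\<^sup>+x. ?g x * (k * q x) \<partial>lborel) powr t
      * enn2real (\<integral>\<^sup>+x. ?g x * (k * r x) \<partial>lborel) powr (1 - t)
    = k * (enn2real (\<integral>\<^sup>+x. ?g x * q x \<partial>lborel) powr t * enn2real (\<integral>\<^sup>+x. ?g x * r x \<partial>lborel) powr (1 - t))"
  proof -
    have kk: "k powr t * k powr (1 - t) = k" using k by (subst powr_add[symmetric]) simp
    have "enn2real (\<integral>\<^sup>+x. ?g x * (k * q x) \<partial>lborel) powr t * enn2real (\<integral>\<^sup>+x. ?g x * (k * r x) \<partial>lborel) powr (1 - t)
      = (k powr t * k powr (1 - t)) * (enn2real (\<integral>\<^sup>+x. ?g x * q x \<partial>lborel) powr t * enn2real (\<integral>\<^sup>+x. ?g x * r x \<partial>lborel) powr (1 - t))"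
      unfolding fin(1)[OF m(2) q] fin(1)[OF m(3) r] using k by (simp add: enn2real_mult powr_mult)
    then show ?thesis unfolding kk .
  qed
  finally show ?thesis .
qed

subsection \<open>Resampling Gaussian coordinates\<close>

lemma space_path_space: "space path_space = paths"
  by (simp add: path_space_def space_measure_of_conv)

lemma measurable_path_eval [measurable]: "(\<lambda>w. w s) \<in> borel_measurable (path_space :: ('n::finite) path measure)"
proof (cases "s \<in> {0..1}")
  case True
  show ?thesis
  proof (rule measurableI)
    fix A :: "(real ^ 'n) set" assume A: "A \<in> sets borel"
    have "(\<lambda>w. w s) -` A \<inter> space path_space = {w \<in> paths. w s \<in> A}"
      by (auto simp: space_path_space)
    also have "\<dots> \<in> sets path_space"
      unfolding path_space_def using True A
      by (subst sets_measure_of) (auto intro!: sigma_sets.Basic)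
    finally show "(\<lambda>w. w s) -` A \<inter> space path_space \<in> sets path_space" .
  qed auto
next
  case False
  then have "w \<in> space path_space \<Longrightarrow> w s = 0" for w :: "'n path"
    by (auto simp: space_path_space paths_def)
  then show ?thesis by (subst measurable_cong[where g = "\<lambda>_. 0"]) auto
qed

lemma measurable_path_spaceI:
  fixes f :: "'a \<Rightarrow> ('n::finite) path"
  assumes "\<And>x. x \<in> space M \<Longrightarrow> f x \<in> paths"
    and m: "\<And>s. s \<in> {0..1} \<Longrightarrow> (\<lambda>x. f x s) \<in> borel_measurable M"
  shows "f \<in> measurable M path_space"
  unfolding path_space_def
proof (rule measurable_measure_of)
  fix y :: "'n path set" assume "y \<in> {{w \<in> paths. w t \<in> A} | t A. t \<in> {0..1} \<and> A \<in> sets borel}"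
  then obtain s A where y: "y = {w \<in> paths. w s \<in> A}" "s \<in> {0..1}" "A \<in> sets borel" by auto
  have "f -` y \<inter> space M = (\<lambda>x. f x s) -` A \<inter> space M" using assms(1) by (auto simp: y)
  also have "\<dots> \<in> sets M" using m[OF y(2)] y(3) by (rule measurable_sets)
  finally show "f -` y \<inter> space M \<in> sets M" .
qed (use assms(1) in auto)

lemma nn_integral_std_normal: "(\<integral>\<^sup>+z. ennreal (std_normal_density z) \<partial>lborel) = 1"
  by (subst nn_integral_eq_integral) (auto simp: integrable_normal_density integral_normal_density)

text \<open>Exchanging two almost-everywhere quantifiers requires the whole inequality to be a
  measurable event. The offsets \<open>a\<close> and \<open>b\<close> will be the fixed coefficients
  to which the variable shifts are added.\<close>

lemma PL_inequality_measurable: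
  fixes t k a b :: real
  assumes [measurable]: "p \<in> borel_measurable M" "q \<in> borel_measurable M" "r \<in> borel_measurable M"
    "u \<in> borel_measurable M" "v \<in> borel_measurable M"
  shows "{w \<in> space M. ennreal (enn2real (q w) powr t * enn2real (r w) powr (1 - t)
    * k * exp (- t * (1 - t) * (u w + a - (v w + b))\<^sup>2 / 2)) \<le> (p w :: ennreal)} \<in> sets M"
proof -
  have 1 [measurable]: "(\<lambda>w. enn2real (q w) powr t * enn2real (r w) powr (1 - t)) \<in> borel_measurable M"
    by measurable
  have 2 [measurable]: "(\<lambda>w. exp (- t * (1 - t) * (u w + a - (v w + b))\<^sup>2 / 2)) \<in> borel_measurable M"
    by measurable
  have "(\<lambda>w. ennreal (enn2real (q w) powr t * enn2real (r w) powr (1 - t)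
    * k * exp (- t * (1 - t) * (u w + a - (v w + b))\<^sup>2 / 2))) \<in> borel_measurable M"
    by (rule measurable_compose[OF borel_measurable_times[OF borel_measurable_times[OF 1 borel_measurable_const] 2] measurable_ennreal])
  from borel_measurable_le[OF this assms(1)] show ?thesis .
qed

text \<open>
  Coordinates \<open>\<xi> j\<close> along finitely many orthonormal Cameron-Martin directions \<open>e j\<close>, which
  determine a path starting at 0 on the set \<open>T\<close> of times.
\<close>

locale cm_coordinates = prob_space \<mu>
  for \<mu> :: "('n::finite) path measure" +
  fixes J :: "'j set" and e :: "'j \<Rightarrow> 'n path" and \<xi> :: "'j \<Rightarrow> 'n path \<Rightarrow> real" and T :: "real set"
  assumes sets_mu [measurable_cong]: "sets \<mu> = sets path_space"
    and finite_J: "finite J"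
    and e_paths: "j \<in> J \<Longrightarrow> e j \<in> paths"
    and xi_measurable: "j \<in> J \<Longrightarrow> \<xi> j \<in> borel_measurable path_space"
    and xi_shift: "\<lbrakk>i \<in> J; j \<in> J; x \<in> paths\<rbrakk> \<Longrightarrow> \<xi> j (\<lambda>s. x s + r *\<^sub>R e i s) = \<xi> j x + (if i = j then r else 0)"
    and cameron_martin: "\<lbrakk>j \<in> J; F \<in> borel_measurable path_space\<rbrakk> \<Longrightarrow>
      (\<integral>\<^sup>+x. F (\<lambda>s. x s + r *\<^sub>R e j s) * ennreal (exp (- r * \<xi> j x - r\<^sup>2 / 2)) \<partial>\<mu>) = (\<integral>\<^sup>+x. F x \<partial>\<mu>)"
    and xi_local: "\<lbrakk>j \<in> J; x \<in> paths; y \<in> paths; \<And>s. s \<in> T \<Longrightarrow> x s = y s\<rbrakk> \<Longrightarrow> \<xi> j x = \<xi> j y"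
    and xi_determines: "\<lbrakk>x \<in> paths; x 0 = 0; s \<in> T\<rbrakk> \<Longrightarrow> (\<Sum>j\<in>J. \<xi> j x *\<^sub>R e j s) = x s"
    and start_0: "AE x in \<mu>. x 0 = 0"
begin

section \<open>Translations along the coordinate directions and resampling of one coordinate\<close>

lemma space_mu: "space \<mu> = paths"
  using sets_eq_imp_space_eq[OF sets_mu] by (simp add: space_path_space)

definition shift :: "'j \<Rightarrow> real \<Rightarrow> 'n path \<Rightarrow> 'n path" where
  "shift j r x = (\<lambda>s. x s + r *\<^sub>R e j s)"

definition move :: "('j \<Rightarrow> real) \<Rightarrow> 'n path \<Rightarrow> 'n path" where
  "move c x = (\<lambda>s. x s + (\<Sum>j\<in>J. c j *\<^sub>R e j s))"

lemma shift_paths [simp, intro]: "j \<in> J \<Longrightarrow> x \<in> paths \<Longrightarrow> shift j r x \<in> paths"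
  using e_paths[of j] by (auto simp: paths_def shift_def intro!: continuous_intros)

lemma shift_0 [simp]: "shift j 0 x = x" by (simp add: shift_def)

lemma shift_shift: "shift j r (shift j s x) = shift j (r + s) x"
  by (simp add: shift_def algebra_simps)

lemma shift_commute: "shift j r (shift i s x) = shift i s (shift j r x)"
  by (simp add: shift_def algebra_simps)

lemma move_paths [simp, intro]: "x \<in> paths \<Longrightarrow> move c x \<in> paths"
  using e_paths by (auto simp: paths_def move_def intro!: continuous_intros sum.neutral)

lemma xi_shift': "\<lbrakk>i \<in> J; j \<in> J; x \<in> paths\<rbrakk> \<Longrightarrow> \<xi> j (shift i r x) = \<xi> j x + (if i = j then r else 0)"
  unfolding shift_def by (rule xi_shift)

text \<open>A further shift in direction \<open>j\<close> is absorbed by changing one coefficient;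
  this is how an assumption about all coefficient families yields one about all extra
  shifts.\<close>

lemma move_update: "j \<in> J \<Longrightarrow> move (c(j := c j + r)) x = shift j r (move c x)"
proof (rule ext)
  fix s assume j: "j \<in> J"
  have "(\<Sum>i\<in>J. (c(j := c j + r)) i *\<^sub>R e i s) = (\<Sum>i\<in>J. c i *\<^sub>R e i s + (if i = j then r *\<^sub>R e j s else 0))"
    by (intro sum.cong) (auto simp: algebra_simps)
  also have "\<dots> = (\<Sum>i\<in>J. c i *\<^sub>R e i s) + r *\<^sub>R e j s"
    using j finite_J by (simp add: sum.distrib sum.delta)
  finally show "move (c(j := c j + r)) x s = shift j r (move c x) s"
    by (simp add: move_def shift_def)
qed

lemma xi_move:
  assumes "j \<in> J" "x \<in> paths"
  shows "\<xi> j (move c x) = \<xi> j x + c j"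
proof -
  have "\<xi> j (\<lambda>s. x s + (\<Sum>i\<in>K. c i *\<^sub>R e i s)) = \<xi> j x + (if j \<in> K then c j else 0)"
    if "K \<subseteq> J" for K
    using finite_subset[OF that finite_J] that
  proof (induction K rule: finite_induct)
    case empty
    then show ?case by simp
  next
    case (insert i K)
    have "(\<lambda>s. x s + (\<Sum>i\<in>K. c i *\<^sub>R e i s)) \<in> paths"
      using insert.prems e_paths assms by (auto simp: paths_def subset_iff intro!: continuous_intros sum.neutral)
    then have "\<xi> j (\<lambda>s. (x s + (\<Sum>i\<in>K. c i *\<^sub>R e i s)) + c i *\<^sub>R e i s)
       = \<xi> j (\<lambda>s. x s + (\<Sum>i\<in>K. c i *\<^sub>R e i s)) + (if i = j then c i else 0)"
      using insert.prems assms by (intro xi_shift) auto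
    then show ?case using insert by (auto simp: algebra_simps)
  qed
  from this[of J] show ?thesis using assms by (simp add: move_def)
qed

lemma measurable_shift:
  assumes "j \<in> J" and a: "a \<in> borel_measurable M" and X [measurable]: "X \<in> measurable M path_space"
  shows "(\<lambda>w. shift j (a w) (X w)) \<in> measurable M path_space"
proof (rule measurable_path_spaceI)
  show "shift j (a w) (X w) \<in> paths" if "w \<in> space M" for w
    using measurable_space[OF X that] assms(1) by (auto simp: space_path_space)
  show "(\<lambda>w. shift j (a w) (X w) s) \<in> borel_measurable M" for s
    unfolding shift_def using a by measurable
qed

lemma measurable_move [measurable (raw)]:
  assumes X [measurable]: "X \<in> measurable M path_space"
  shows "(\<lambda>w. move c (X w)) \<in> measurable M path_space"
proof (rule measurable_path_spaceI)
  show "move c (X w) \<in> paths" if "w \<in> space M" for w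
    using measurable_space[OF X that] by (auto simp: space_path_space)
  show "(\<lambda>w. move c (X w) s) \<in> borel_measurable M" for s
    unfolding move_def by measurable
qed

text \<open>The conditional expectation that resamples the \<open>j\<close>-th coordinate.\<close>

definition Q :: "'j \<Rightarrow> ('n path \<Rightarrow> ennreal) \<Rightarrow> 'n path \<Rightarrow> ennreal" where
  "Q j f x = (\<integral>\<^sup>+z. ennreal (std_normal_density z) * f (shift j (z - \<xi> j x) x) \<partial>lborel)"

lemma Q_measurable [measurable]:
  assumes j: "j \<in> J" and [measurable]: "f \<in> borel_measurable path_space"
  shows "Q j f \<in> borel_measurable path_space"
proof -
  note [measurable] = xi_measurable[OF j] and [measurable (raw)] = measurable_shift[OF j]
  show ?thesis unfolding Q_def by measurable
qed

text \<open>Written in terms of the increment \<open>s = z - \<xi> j x\<close>, the Gaussian weight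
  splits into a density at \<open>\<xi> j x\<close> and the Cameron-Martin factor for the shift by
  \<open>s\<close>. After exchanging the integrals the shift can be undone for each fixed
  \<open>s\<close>, and only the total mass of a normal density in \<open>s\<close> remains.\<close>

lemma nn_integral_Q:
  assumes j: "j \<in> J" and f [measurable]: "f \<in> borel_measurable path_space"
  shows "(\<integral>\<^sup>+x. Q j f x \<partial>\<mu>) = (\<integral>\<^sup>+x. f x \<partial>\<mu>)"
proof -
  note [measurable] = xi_measurable[OF j] and [measurable (raw)] = measurable_shift[OF j]
  interpret pair_sigma_finite \<mu> "lborel :: real measure" ..
  let ?g = "\<lambda>z. ennreal (std_normal_density z)"
  \<comment> \<open>The second factor is exactly the weight in \<open>cameron_martin\<close>, with
    \<open>a\<close> in the place of \<open>\<xi> j x\<close>.\<close>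
  have g: "std_normal_density (s + a) = std_normal_density a * exp (- s * a - s\<^sup>2 / 2)" for s a
    unfolding std_normal_density_def by (simp add: mult_exp_exp power2_sum field_simps)
  have "Q j f x = (\<integral>\<^sup>+s. ?g (s + \<xi> j x) * f (shift j s x) \<partial>lborel)" if "x \<in> paths" for x
  proof -
    have [measurable]: "(\<lambda>s. f (shift j s x)) \<in> borel_measurable borel"
      by (rule measurable_compose[OF _ f], rule measurable_shift[OF j]) (auto simp: space_path_space that)
    have "Q j f x = (\<integral>\<^sup>+z. (\<lambda>z. ?g z * f (shift j (z - \<xi> j x) x)) z \<partial>lborel)" by (simp add: Q_def)
    also have "\<dots> = (\<integral>\<^sup>+s. ?g (s + \<xi> j x) * f (shift j s x) \<partial>lborel)"
      by (subst nn_integral_real_affine[where c = 1 and t = "\<xi> j x"]) (auto simp: add.commute)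
    finally show ?thesis .
  qed
  then have "(\<integral>\<^sup>+x. Q j f x \<partial>\<mu>) = (\<integral>\<^sup>+x. (\<integral>\<^sup>+s. ?g (s + \<xi> j x) * f (shift j s x) \<partial>lborel) \<partial>\<mu>)"
    by (intro nn_integral_cong) (simp add: space_mu)
  also have "\<dots> = (\<integral>\<^sup>+s. (\<integral>\<^sup>+x. ?g (s + \<xi> j x) * f (shift j s x) \<partial>\<mu>) \<partial>lborel)"
    by (rule Fubini'[symmetric]) measurable
  also have "\<dots> = (\<integral>\<^sup>+s. (\<integral>\<^sup>+x. ?g (\<xi> j x - s) * f x \<partial>\<mu>) \<partial>lborel)"
  proof (rule nn_integral_cong)
    fix s :: real
    have "(\<integral>\<^sup>+x. ?g (s + \<xi> j x) * f (shift j s x) \<partial>\<mu>)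
      = (\<integral>\<^sup>+x. (?g (\<xi> j (shift j s x) - s) * f (shift j s x)) * ennreal (exp (- s * \<xi> j x - s\<^sup>2 / 2)) \<partial>\<mu>)"
      by (intro nn_integral_cong) (simp add: g xi_shift' j space_mu ennreal_mult' mult_ac)
    also have "\<dots> = (\<integral>\<^sup>+x. ?g (\<xi> j x - s) * f x \<partial>\<mu>)"
      using cameron_martin[OF j, where F = "\<lambda>x. ?g (\<xi> j x - s) * f x" and r = s] by (simp add: shift_def)
    finally show "(\<integral>\<^sup>+x. ?g (s + \<xi> j x) * f (shift j s x) \<partial>\<mu>) = (\<integral>\<^sup>+x. ?g (\<xi> j x - s) * f x \<partial>\<mu>)" .
  qed
  also have "\<dots> = (\<integral>\<^sup>+x. (\<integral>\<^sup>+s. ?g (\<xi> j x - s) * f x \<partial>lborel) \<partial>\<mu>)"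
    by (rule Fubini') measurable
  also have "\<dots> = (\<integral>\<^sup>+x. f x \<partial>\<mu>)"
  proof (rule nn_integral_cong)
    fix x
    \<comment> \<open>As a function of \<open>s\<close> the weight is a normal density centred at
      \<open>\<xi> j x\<close>.\<close>
    have "(\<integral>\<^sup>+s. ?g (\<xi> j x - s) \<partial>lborel) = (\<integral>\<^sup>+z. ?g z \<partial>lborel)"
      by (subst nn_integral_real_affine[where c = "-1" and t = "\<xi> j x" and f = ?g]) auto
    then show "(\<integral>\<^sup>+s. ?g (\<xi> j x - s) * f x \<partial>lborel) = f x"
      by (simp add: nn_integral_multc nn_integral_std_normal)
  qed
  finally show ?thesis .
qed

lemma Q_mono:
  assumes "j \<in> J" "x \<in> paths" "\<And>x. x \<in> paths \<Longrightarrow> f x \<le> g x"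
  shows "Q j f x \<le> Q j g x"
  unfolding Q_def using assms by (intro nn_integral_mono mult_left_mono) auto

lemma Q_add:
  assumes j: "j \<in> J" and x: "x \<in> paths"
    and f: "f \<in> borel_measurable path_space" and g: "g \<in> borel_measurable path_space"
  shows "Q j (\<lambda>x. f x + g x) x = Q j f x + Q j g x"
proof -
  have "(\<lambda>z. shift j (z - \<xi> j x) x) \<in> measurable borel path_space"
    using x by (intro measurable_shift[OF j]) (auto simp: space_path_space)
  then have [measurable]: "(\<lambda>z. f (shift j (z - \<xi> j x) x)) \<in> borel_measurable borel"
    "(\<lambda>z. g (shift j (z - \<xi> j x) x)) \<in> borel_measurable borel"
    using measurable_compose f g by blast+
  show ?thesis unfolding Q_def by (simp add: distrib_left nn_integral_add)
qed

lemma Q_const: "Q j (\<lambda>_. c) x = c"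
  unfolding Q_def by (simp add: nn_integral_multc nn_integral_std_normal)

text \<open>The shift raises \<open>\<xi> j\<close> by the same amount, so the recentred path
  \<open>shift j (z - \<xi> j x) x\<close> does not change.\<close>

lemma Q_shift_self:
  assumes "j \<in> J" "x \<in> paths"
  shows "Q j f (shift j r x) = Q j f x"
  unfolding Q_def using assms by (simp add: xi_shift' shift_shift algebra_simps)

text \<open>Shifts commute and a shift in another direction leaves \<open>\<xi> j\<close> alone;
  hence an invariance gained by one averaging survives all later ones.\<close>

lemma Q_shift_other:
  assumes "i \<in> J" "j \<in> J" "x \<in> paths" and inv: "\<And>x r. x \<in> paths \<Longrightarrow> f (shift i r x) = f x"
  shows "Q j f (shift i r x) = Q j f x"
proof (cases "i = j")
  case False
  have "f (shift j (z - \<xi> j x) (shift i r x)) = f (shift j (z - \<xi> j x) x)" for z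
    using assms inv[of "shift j (z - \<xi> j x) x" r] by (simp add: shift_commute[of j])
  then show ?thesis unfolding Q_def using assms False by (simp add: xi_shift')
qed (use Q_shift_self assms in auto)

definition depends_on_T :: "('n path \<Rightarrow> ennreal) \<Rightarrow> bool" where
  "depends_on_T f \<longleftrightarrow> (\<forall>x\<in>paths. \<forall>y\<in>paths. (\<forall>s\<in>T. x s = y s) \<longrightarrow> f x = f y)"

lemma Q_depends:
  assumes j: "j \<in> J" and f: "depends_on_T f"
  shows "depends_on_T (Q j f)"
  unfolding depends_on_T_def
proof (intro ballI impI)
  fix x y :: "'n path" assume *: "x \<in> paths" "y \<in> paths" "\<forall>s\<in>T. x s = y s"
  have "\<xi> j x = \<xi> j y" using * j by (intro xi_local) auto
  moreover have "f (shift j a x) = f (shift j a y)" for a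
  proof -
    have "\<forall>s\<in>T. shift j a x s = shift j a y s" using * by (simp add: shift_def)
    then show ?thesis using f * j unfolding depends_on_T_def by blast
  qed
  ultimately show "Q j f x = Q j f y" by (simp add: Q_def)
qed

text \<open>
  The exponent is the defect \<open>t |c|\<^sup>2 + (1 - t) |c'|\<^sup>2 - |t c + (1 - t) c'|\<^sup>2 = t (1 - t) |c - c'|\<^sup>2\<close>, which does
  not change when all Gaussian weights are recentred.
\<close>

definition PL_hyp :: "real \<Rightarrow> ('n path \<Rightarrow> ennreal) \<Rightarrow> ('n path \<Rightarrow> ennreal) \<Rightarrow> ('n path \<Rightarrow> ennreal) \<Rightarrow> bool" where
  "PL_hyp t p q r \<longleftrightarrow> (\<forall>c c'. AE x in \<mu>.
     ennreal (enn2real (q (move c x)) powr t * enn2real (r (move c' x)) powr (1 - t)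
       * exp (- t * (1 - t) * (\<Sum>j\<in>J. (c j - c' j)\<^sup>2) / 2)) \<le> p (move (\<lambda>j. t * c j + (1 - t) * c' j) x))"

lemma Q_bounded:
  assumes "j \<in> J" "x \<in> paths" "\<And>x. x \<in> paths \<Longrightarrow> f x \<le> ennreal M"
  shows "Q j f x \<le> ennreal M"
  using Q_mono[OF assms(1,2), of f "\<lambda>_. ennreal M"] assms(3) by (simp add: Q_const)

text \<open>For fixed coefficients, additional shifts \<open>u\<close> and \<open>v\<close> in
  direction \<open>j\<close> are covered by the hypothesis. Fubini makes the inequality hold, for
  almost every path, at almost every pair \<open>(u, v)\<close>; along the line in direction
  \<open>j\<close> this is the assumption of the one-dimensional Gaussian inequality, whose
  integrals are the values of \<open>Q j\<close>.\<close>

lemma PL_hyp_Q: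
  assumes j: "j \<in> J" and t: "0 < t" "t < 1"
    and m [measurable]: "p \<in> borel_measurable path_space" "q \<in> borel_measurable path_space" "r \<in> borel_measurable path_space"
    and q: "\<And>x. x \<in> paths \<Longrightarrow> q x \<le> ennreal M" and r: "\<And>x. x \<in> paths \<Longrightarrow> r x \<le> ennreal M" and M: "M \<ge> 0"
    and hyp: "PL_hyp t p q r"
  shows "PL_hyp t (Q j p) (Q j q) (Q j r)"
  unfolding PL_hyp_def
proof (intro allI)
  fix c c' :: "'j \<Rightarrow> real"
  have sf: "sigma_finite_measure (lborel \<Otimes>\<^sub>M lborel :: (real \<times> real) measure)"
    unfolding lborel_prod by (rule lborel.sigma_finite_measure_axioms)
  interpret P: pair_sigma_finite \<mu> "lborel \<Otimes>\<^sub>M lborel :: (real \<times> real) measure"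
    by (rule pair_sigma_finite.intro[OF sigma_finite_measure_axioms sf])
  define d where "d = (\<lambda>j. t * c j + (1 - t) * c' j)"
  define S where "S = (\<Sum>i\<in>J - {j}. (c i - c' i)\<^sup>2)"
  \<comment> \<open>The penalty of the coordinates other than \<open>j\<close>: it stays fixed while
    the shifts in direction \<open>j\<close> vary, and becomes the constant of the Gaussian
    inequality.\<close>
  define k where "k = exp (- t * (1 - t) * S / 2)"
  have S: "S \<ge> 0" unfolding S_def by (rule sum_nonneg) (rule zero_le_power2)
  have "0 \<le> t * (1 - t) * S" using S t by (intro mult_nonneg_nonneg) simp_all
  then have "- t * (1 - t) * S / 2 \<le> 0" by linarith
  then have k: "0 < k" "k \<le> 1" by (simp_all only: k_def exp_gt_zero exp_le_one_iff)
  have sumS: "(\<Sum>i\<in>J. (b i - b' i)\<^sup>2) = S + (b j - b' j)\<^sup>2"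
    if "\<And>i. i \<noteq> j \<Longrightarrow> b i = c i" "\<And>i. i \<noteq> j \<Longrightarrow> b' i = c' i" for b b'
  proof -
    have "(\<Sum>i\<in>J. (b i - b' i)\<^sup>2) = (b j - b' j)\<^sup>2 + (\<Sum>i\<in>J - {j}. (b i - b' i)\<^sup>2)"
      by (rule sum.remove[OF finite_J j])
    also have "(\<Sum>i\<in>J - {j}. (b i - b' i)\<^sup>2) = S"
      unfolding S_def by (rule sum.cong) (simp_all add: that)
    finally show ?thesis by (simp only: add.commute)
  qed
  let ?R = "\<lambda>x z. ennreal (enn2real (q (shift j (fst z) (move c x))) powr t * enn2real (r (shift j (snd z) (move c' x))) powr (1 - t)
       * k * exp (- t * (1 - t) * (fst z + c j - (snd z + c' j))\<^sup>2 / 2)) \<le> p (shift j (t * fst z + (1 - t) * snd z) (move d x))"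
  have "AE x in \<mu>. ?R x z" for z
  proof -
    obtain u v where z: "z = (u, v)" by (cases z)
    have 1: "(\<lambda>i. t * (c(j := c j + u)) i + (1 - t) * (c'(j := c' j + v)) i) = d(j := d j + (t * u + (1 - t) * v))"
      by (auto simp: d_def algebra_simps)
    have 2: "(\<Sum>i\<in>J. ((c(j := c j + u)) i - (c'(j := c' j + v)) i)\<^sup>2) = S + (u + c j - (v + c' j))\<^sup>2"
    proof (subst sumS)
      have "c j + u - (c' j + v) = u + c j - (v + c' j)" by simp
      then show "S + ((c(j := c j + u)) j - (c'(j := c' j + v)) j)\<^sup>2 = S + (u + c j - (v + c' j))\<^sup>2"
        by (simp only: fun_upd_same)
    qed simp_all
    have 3: "exp (- t * (1 - t) * (S + w) / 2) = k * exp (- t * (1 - t) * w / 2)" for w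
      unfolding k_def mult_exp_exp add_divide_distrib[symmetric] distrib_left[symmetric] ..
    from hyp have "AE x in \<mu>. ennreal (enn2real (q (move (c(j := c j + u)) x)) powr t * enn2real (r (move (c'(j := c' j + v)) x)) powr (1 - t)
       * exp (- t * (1 - t) * (\<Sum>i\<in>J. ((c(j := c j + u)) i - (c'(j := c' j + v)) i)\<^sup>2) / 2))
       \<le> p (move (\<lambda>i. t * (c(j := c j + u)) i + (1 - t) * (c'(j := c' j + v)) i) x)"
      unfolding PL_hyp_def by blast
    then show ?thesis unfolding 1 2 3 move_update[OF j] unfolding z fst_conv snd_conv mult.assoc .
  qed
  then have "AE z in lborel \<Otimes>\<^sub>M lborel. AE x in \<mu>. ?R x z" by (rule AE_I2)
  moreover have "{w \<in> space (\<mu> \<Otimes>\<^sub>M (lborel \<Otimes>\<^sub>M lborel)). ?R (fst w) (snd w)} \<in> sets (\<mu> \<Otimes>\<^sub>M (lborel \<Otimes>\<^sub>M lborel))"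
  proof -
    have sh: "(\<lambda>w. shift j (f (snd w)) (move b (fst w))) \<in> measurable (\<mu> \<Otimes>\<^sub>M (lborel \<Otimes>\<^sub>M lborel)) path_space"
      if f: "f \<in> borel_measurable (lborel \<Otimes>\<^sub>M lborel)" for f :: "real \<times> real \<Rightarrow> real" and b
    proof (intro measurable_shift[OF j] measurable_move)
      show "(\<lambda>w. f (snd w)) \<in> borel_measurable (\<mu> \<Otimes>\<^sub>M (lborel \<Otimes>\<^sub>M lborel))"
        by (rule measurable_compose[OF measurable_snd f])
      show "fst \<in> measurable (\<mu> \<Otimes>\<^sub>M (lborel \<Otimes>\<^sub>M lborel)) path_space"
        by (rule measurable_cong_sets[OF refl sets_mu, THEN equalityD1, THEN subsetD, OF measurable_fst])
    qed
    have f: "fst \<in> borel_measurable (lborel \<Otimes>\<^sub>M lborel)" "snd \<in> borel_measurable (lborel \<Otimes>\<^sub>M lborel)"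
        "(\<lambda>z. t * fst z + (1 - t) * snd z) \<in> borel_measurable (lborel \<Otimes>\<^sub>M lborel)"
      by measurable
    show ?thesis
      by (rule PL_inequality_measurable[OF measurable_compose[OF sh[OF f(3)] m(1)] measurable_compose[OF sh[OF f(1)] m(2)]
          measurable_compose[OF sh[OF f(2)] m(3)] measurable_compose[OF measurable_snd f(1)] measurable_compose[OF measurable_snd f(2)]])
  qed
  \<comment> \<open>So far the null set of paths depended on the pair of shifts; from here on one
    null set serves almost every pair.\<close>
  ultimately have "AE x in \<mu>. AE z in lborel \<Otimes>\<^sub>M lborel. ?R x z"
    using P.AE_commute[of ?R] by blast
  then show "AE x in \<mu>. ennreal (enn2real (Q j q (move c x)) powr t * enn2real (Q j r (move c' x)) powr (1 - t)
       * exp (- t * (1 - t) * (\<Sum>j\<in>J. (c j - c' j)\<^sup>2) / 2)) \<le> Q j p (move (\<lambda>j. t * c j + (1 - t) * c' j) x)"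
    unfolding d_def[symmetric] using AE_space
  proof eventually_elim
    case (elim x)
    then have x: "x \<in> paths" by (simp add: space_mu)
    define a b where "a = \<xi> j x + c j" and "b = \<xi> j x + c' j"
    have xi: "\<xi> j (move c x) = a" "\<xi> j (move c' x) = b" "\<xi> j (move d x) = t * a + (1 - t) * b"
      using x j by (auto simp: xi_move a_def b_def d_def algebra_simps)
    define pl where "pl = (\<lambda>w. p (shift j (w - \<xi> j (move d x)) (move d x)))"
    define ql where "ql = (\<lambda>w. q (shift j (w - \<xi> j (move c x)) (move c x)))"
    define rl where "rl = (\<lambda>w. r (shift j (w - \<xi> j (move c' x)) (move c' x)))"
    have sm: "(\<lambda>w. shift j (w - \<xi> j y) y) \<in> measurable borel path_space" if "y \<in> paths" for y
      using that by (intro measurable_shift[OF j]) (auto simp: space_path_space)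
    have [measurable]: "pl \<in> borel_measurable borel" "ql \<in> borel_measurable borel" "rl \<in> borel_measurable borel"
      unfolding pl_def ql_def rl_def using x by (auto intro!: measurable_compose[OF sm] m)
    have qr: "ql w \<le> ennreal M" "rl w \<le> ennreal M" for w
      unfolding ql_def rl_def using q r x j by auto
    have "AE z in lborel. ?R x z" using elim(1) unfolding lborel_prod .
    \<comment> \<open>The inequality speaks of increments, the Gaussian lemma of coordinate values.
      Translating the plane by \<open>(- a, - b)\<close> passes between them, and since
      \<open>a - c j = b - c' j\<close> the penalty then depends on \<open>fst z - snd z\<close>
      alone.\<close>
    then have "AE z in distr lborel borel ((+) (- a, - b)). ?R x z"
      unfolding lborel_distr_plus .
    then have "AE z in lborel. ?R x ((- a, - b) + z)"
      by (rule AE_distrD[rotated]) simp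
    then have AE: "AE z in lborel \<Otimes>\<^sub>M lborel. ennreal (enn2real (ql (fst z)) powr t * enn2real (rl (snd z)) powr (1 - t)
        * k * exp (- t * (1 - t) * (fst z - snd z)\<^sup>2 / 2)) \<le> pl (t * fst z + (1 - t) * snd z)"
      unfolding lborel_prod
      by eventually_elim (simp add: ql_def rl_def pl_def xi a_def b_def algebra_simps)
    have Qq: "(\<integral>\<^sup>+z. ennreal (std_normal_density z * enn2real (f z)) \<partial>lborel) = (\<integral>\<^sup>+z. ennreal (std_normal_density z) * f z \<partial>lborel)"
      if "\<And>w. f w \<le> ennreal M" for f
      by (intro nn_integral_cong) (use that in \<open>auto simp: ennreal_mult' intro!: arg_cong2[where f = times] ennreal_enn2real le_less_trans[OF that]\<close>)
    \<comment> \<open>After averaging, the inequality holds even without the \<open>j\<close>-th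
      square in the penalty. Restoring that square only weakens it and gives back the shape of
      \<open>PL_hyp\<close>.\<close>
    have "ennreal (enn2real (Q j q (move c x)) powr t * enn2real (Q j r (move c' x)) powr (1 - t)
       * exp (- t * (1 - t) * (\<Sum>j\<in>J. (c j - c' j)\<^sup>2) / 2))
      \<le> ennreal (k * (enn2real (Q j q (move c x)) powr t * enn2real (Q j r (move c' x)) powr (1 - t)))"
    proof (rule ennreal_leI)
      have "exp (- t * (1 - t) * (\<Sum>j\<in>J. (c j - c' j)\<^sup>2) / 2) \<le> k"
        unfolding k_def using sumS[of c c'] t by (auto intro!: divide_right_mono mult_left_mono_neg mult_left_mono)
      then show "enn2real (Q j q (move c x)) powr t * enn2real (Q j r (move c' x)) powr (1 - t)
          * exp (- t * (1 - t) * (\<Sum>j\<in>J. (c j - c' j)\<^sup>2) / 2)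
        \<le> k * (enn2real (Q j q (move c x)) powr t * enn2real (Q j r (move c' x)) powr (1 - t))"
        by (subst mult.commute, intro mult_right_mono) auto
    qed
    also have "\<dots> \<le> Q j p (move d x)"
    proof -
      have Qd: "Q j q (move c x) = (\<integral>\<^sup>+z. ennreal (std_normal_density z) * ql z \<partial>lborel)"
        "Q j r (move c' x) = (\<integral>\<^sup>+z. ennreal (std_normal_density z) * rl z \<partial>lborel)"
        "Q j p (move d x) = (\<integral>\<^sup>+z. ennreal (std_normal_density z) * pl z \<partial>lborel)"
        by (simp_all add: Q_def ql_def rl_def pl_def)
      show ?thesis
        using gaussian_Prekopa_Leindler[OF _ _ _ t k _ _ _ _ AE, of M] qr M
        unfolding Qq[OF qr(1)] Qq[OF qr(2)] Qd by (simp add: enn2real_leI)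
    qed
    finally show ?case .
  qed
qed

section \<open>Resampling every coordinate\<close>

definition QQ :: "'j list \<Rightarrow> ('n path \<Rightarrow> ennreal) \<Rightarrow> 'n path \<Rightarrow> ennreal" where
  "QQ js f = foldr Q js f"

lemma QQ_simps [simp]: "QQ [] f = f" "QQ (j # js) f = Q j (QQ js f)"
  by (simp_all add: QQ_def)

lemma QQ_measurable:
  "set js \<subseteq> J \<Longrightarrow> f \<in> borel_measurable path_space \<Longrightarrow> QQ js f \<in> borel_measurable path_space"
  by (induction js) (auto intro: Q_measurable)

lemma nn_integral_QQ:
  "set js \<subseteq> J \<Longrightarrow> f \<in> borel_measurable path_space \<Longrightarrow> (\<integral>\<^sup>+x. QQ js f x \<partial>\<mu>) = (\<integral>\<^sup>+x. f x \<partial>\<mu>)"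
  by (induction js) (auto simp: nn_integral_Q QQ_measurable)

lemma QQ_mono:
  assumes "set js \<subseteq> J" "x \<in> paths" "\<And>x. x \<in> paths \<Longrightarrow> f x \<le> g x"
  shows "QQ js f x \<le> QQ js g x"
  using assms(1,2) by (induction js arbitrary: x) (simp_all add: Q_mono assms(3))

lemma QQ_add:
  assumes "set js \<subseteq> J" "x \<in> paths" "f \<in> borel_measurable path_space" "g \<in> borel_measurable path_space"
  shows "QQ js (\<lambda>x. f x + g x) x = QQ js f x + QQ js g x"
  using assms(1,2)
proof (induction js arbitrary: x)
  case (Cons j js)
  have "Q j (QQ js (\<lambda>x. f x + g x)) x = Q j (\<lambda>x. QQ js f x + QQ js g x) x"
    unfolding Q_def
  proof (rule nn_integral_cong)
    fix z
    have "shift j (z - \<xi> j x) x \<in> paths" using Cons.prems by auto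
    then show "ennreal (std_normal_density z) * QQ js (\<lambda>x. f x + g x) (shift j (z - \<xi> j x) x)
      = ennreal (std_normal_density z) * (QQ js f (shift j (z - \<xi> j x) x) + QQ js g (shift j (z - \<xi> j x) x))"
      using Cons.IH Cons.prems by simp
  qed
  then show ?case using Cons.prems assms by (simp add: Q_add QQ_measurable)
qed simp

lemma QQ_bounded:
  assumes "set js \<subseteq> J" "x \<in> paths" "\<And>x. x \<in> paths \<Longrightarrow> f x \<le> ennreal M"
  shows "QQ js f x \<le> ennreal M"
  using assms(1,2) by (induction js arbitrary: x) (simp_all add: Q_bounded assms(3))

lemma QQ_depends: "set js \<subseteq> J \<Longrightarrow> depends_on_T f \<Longrightarrow> depends_on_T (QQ js f)"
  by (induction js) (auto intro: Q_depends)

lemma QQ_shift: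
  "\<lbrakk>set js \<subseteq> J; i \<in> set js; x \<in> paths\<rbrakk> \<Longrightarrow> QQ js f (shift i r x) = QQ js f x"
proof (induction js arbitrary: x r)
  case (Cons j js)
  show ?case
  proof (cases "i = j")
    case True
    then show ?thesis using Cons.prems by (simp add: Q_shift_self)
  next
    case False
    then have "i \<in> set js" using Cons.prems by simp
    then have "\<And>x r. x \<in> paths \<Longrightarrow> QQ js f (shift i r x) = QQ js f x" using Cons by simp
    moreover have "i \<in> J" "j \<in> J" using Cons.prems by auto
    ultimately show ?thesis using Cons.prems(3) unfolding QQ_simps by (intro Q_shift_other)
  qed
qed simp

lemma PL_hyp_QQ:
  assumes "0 < t" "t < 1"
    and "p \<in> borel_measurable path_space" "q \<in> borel_measurable path_space" "r \<in> borel_measurable path_space"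
    and "\<And>x. x \<in> paths \<Longrightarrow> q x \<le> ennreal M" "\<And>x. x \<in> paths \<Longrightarrow> r x \<le> ennreal M" "M \<ge> 0"
    and "PL_hyp t p q r" and "set js \<subseteq> J"
  shows "PL_hyp t (QQ js p) (QQ js q) (QQ js r)"
  using assms(10)
proof (induction js)
  case (Cons j js)
  then have js: "j \<in> J" "set js \<subseteq> J" by auto
  show ?case unfolding QQ_simps
    by (rule PL_hyp_Q[OF js(1) assms(1,2) QQ_measurable[OF js(2) assms(3)] QQ_measurable[OF js(2) assms(4)]
        QQ_measurable[OF js(2) assms(5)] QQ_bounded[OF js(2) _ assms(6)] QQ_bounded[OF js(2) _ assms(7)] assms(8) Cons.IH[OF js(2)]])
qed (use assms in simp)

lemma move_invariant:
  assumes inv: "\<And>i r x. i \<in> J \<Longrightarrow> x \<in> paths \<Longrightarrow> f (shift i r x) = f x" and x: "x \<in> paths"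
  shows "f (move c x) = f x"
proof -
  have "f (\<lambda>s. x s + (\<Sum>i\<in>K. c i *\<^sub>R e i s)) = f x" if "K \<subseteq> J" for K
    using finite_subset[OF that finite_J] that
  proof (induction K rule: finite_induct)
    case (insert i K)
    have "(\<lambda>s. x s + (\<Sum>i\<in>K. c i *\<^sub>R e i s)) \<in> paths"
      using insert.prems e_paths x by (auto simp: paths_def subset_iff intro!: continuous_intros sum.neutral)
    then have "i \<in> J" "(\<lambda>s. x s + (\<Sum>i\<in>K. c i *\<^sub>R e i s)) \<in> paths" using insert.prems by auto
    then have "f (shift i (c i) (\<lambda>s. x s + (\<Sum>i\<in>K. c i *\<^sub>R e i s))) = f (\<lambda>s. x s + (\<Sum>i\<in>K. c i *\<^sub>R e i s))"
      by (rule inv)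
    also have "shift i (c i) (\<lambda>s. x s + (\<Sum>i\<in>K. c i *\<^sub>R e i s)) = (\<lambda>s. x s + (\<Sum>i\<in>insert i K. c i *\<^sub>R e i s))"
      using insert.hyps by (simp add: shift_def add_ac)
    finally show ?case using insert.IH insert.prems by simp
  qed simp
  from this[of J] show ?thesis by (simp add: move_def)
qed

text \<open>Once every coordinate has been resampled, the function is invariant under all shifts.
  Shifting by the negatives of its own coordinates brings \<open>x\<close> to a path that vanishes
  on \<open>T\<close>, and by dependence on \<open>T\<close> alone this is as good as the zero
  path.\<close>

lemma QQ_constant:
  assumes js: "set js = J" and f: "depends_on_T f" and x: "x \<in> paths" "x 0 = 0"
  shows "QQ js f x = QQ js f (\<lambda>_. 0)"
proof -
  have z: "(\<lambda>_. 0) \<in> paths" by (auto simp: paths_def)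
  have "QQ js f x = QQ js f (move (\<lambda>j. - \<xi> j x) x)"
    using js x by (intro move_invariant[symmetric] QQ_shift) simp_all
  also have "\<dots> = QQ js f (\<lambda>_. 0)"
  proof -
    have "\<forall>s\<in>T. move (\<lambda>j. - \<xi> j x) x s = 0"
      using xi_determines[OF x] by (simp add: move_def sum_negf)
    moreover have "depends_on_T (QQ js f)" using js f by (intro QQ_depends) simp_all
    note this[unfolded depends_on_T_def, rule_format, OF move_paths[OF x(1)] z]
    ultimately show ?thesis by blast
  qed
  finally show ?thesis .
qed

lemma borel_measurable_mu: "f \<in> borel_measurable path_space \<Longrightarrow> f \<in> borel_measurable \<mu>"
  using measurable_cong_sets[OF sets_mu refl] by (rule subst[OF sym])

text \<open>\<open>QQ\<close> is monotone and additive and sends the cylinder function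
  \<open>g\<close> to its expectation, so it sends \<open>f\<close> close to its own expectation.
  The error \<open>QQ js h\<close> is controlled only in mean, which is why it stays in the
  conclusion.\<close>

lemma QQ_approx:
  assumes js: "set js = J" and m: "f \<in> borel_measurable path_space" "g \<in> borel_measurable path_space" "h \<in> borel_measurable path_space"
    and g: "depends_on_T g" and fg: "\<And>x. x \<in> paths \<Longrightarrow> f x \<le> g x + h x" and gf: "\<And>x. x \<in> paths \<Longrightarrow> g x \<le> f x + h x"
    and eps: "(\<integral>\<^sup>+x. h x \<partial>\<mu>) \<le> \<epsilon>"
  shows "AE x in \<mu>. QQ js f x \<le> (\<integral>\<^sup>+x. f x \<partial>\<mu>) + \<epsilon> + QQ js h x \<and> (\<integral>\<^sup>+x. f x \<partial>\<mu>) \<le> QQ js f x + QQ js h x + \<epsilon>"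
proof -
  have j: "set js \<subseteq> J" using js by simp
  have const: "AE x in \<mu>. QQ js g x = QQ js g (\<lambda>_. 0)"
    using start_0 AE_space by eventually_elim (simp add: space_mu QQ_constant[OF js g])
  have "(\<integral>\<^sup>+x. QQ js g x \<partial>\<mu>) = (\<integral>\<^sup>+x. QQ js g (\<lambda>_. 0) \<partial>\<mu>)"
    by (rule nn_integral_cong_AE[OF const])
  then have ig: "(\<integral>\<^sup>+x. g x \<partial>\<mu>) = QQ js g (\<lambda>_. 0)"
    by (simp add: nn_integral_QQ[OF j m(2)] emeasure_space_1)
  have "(\<integral>\<^sup>+x. g x \<partial>\<mu>) \<le> (\<integral>\<^sup>+x. f x + h x \<partial>\<mu>)"
    using gf by (intro nn_integral_mono) (simp add: space_mu)
  also have "\<dots> \<le> (\<integral>\<^sup>+x. f x \<partial>\<mu>) + \<epsilon>" unfolding nn_integral_add[OF borel_measurable_mu[OF m(1)] borel_measurable_mu[OF m(3)]]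
    using eps by (rule add_left_mono)
  finally have 1: "(\<integral>\<^sup>+x. g x \<partial>\<mu>) \<le> (\<integral>\<^sup>+x. f x \<partial>\<mu>) + \<epsilon>" .
  have "(\<integral>\<^sup>+x. f x \<partial>\<mu>) \<le> (\<integral>\<^sup>+x. g x + h x \<partial>\<mu>)"
    using fg by (intro nn_integral_mono) (simp add: space_mu)
  also have "\<dots> \<le> (\<integral>\<^sup>+x. g x \<partial>\<mu>) + \<epsilon>" unfolding nn_integral_add[OF borel_measurable_mu[OF m(2)] borel_measurable_mu[OF m(3)]]
    using eps by (rule add_left_mono)
  finally have 2: "(\<integral>\<^sup>+x. f x \<partial>\<mu>) \<le> (\<integral>\<^sup>+x. g x \<partial>\<mu>) + \<epsilon>" .
  show ?thesis using const AE_space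
  proof eventually_elim
    case (elim x)
    then have x: "x \<in> paths" by (simp add: space_mu)
    have "QQ js f x \<le> QQ js (\<lambda>x. g x + h x) x" by (rule QQ_mono[OF j x fg])
    then have a: "QQ js f x \<le> (\<integral>\<^sup>+x. g x \<partial>\<mu>) + QQ js h x" unfolding QQ_add[OF j x m(2,3)] elim(1) ig .
    have "QQ js g x \<le> QQ js (\<lambda>x. f x + h x) x" by (rule QQ_mono[OF j x gf])
    then have b: "(\<integral>\<^sup>+x. g x \<partial>\<mu>) \<le> QQ js f x + QQ js h x" unfolding QQ_add[OF j x m(1,3)] elim(1) ig .
    show ?case
      using order_trans[OF a add_right_mono[OF 1]] order_trans[OF 2 add_right_mono[OF b]] by blast
  qed
qed

text \<open>One well-chosen path suffices: there the three resampled functions are near their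
  expectations and the pointwise inequality holds. One \<delta> comes from comparing expectations,
  the other from the value of \<open>QQ js h\<close> at that path.\<close>

lemma Prekopa_Leindler_approx:
  assumes t: "0 < t" "t < 1"
    and m [measurable]: "p \<in> borel_measurable path_space" "q \<in> borel_measurable path_space" "r \<in> borel_measurable path_space"
    and q: "\<And>x. x \<in> paths \<Longrightarrow> q x \<le> ennreal M" and r: "\<And>x. x \<in> paths \<Longrightarrow> r x \<le> ennreal M" and M: "M \<ge> 0"
    and hyp: "PL_hyp t p q r"
    and h [measurable]: "h \<in> borel_measurable path_space" and eps: "(\<integral>\<^sup>+x. h x \<partial>\<mu>) < \<delta>" and fin: "\<delta> < top"
    and approx: "\<And>f. f \<in> {p, q, r} \<Longrightarrow> \<exists>g. g \<in> borel_measurable path_space \<and> depends_on_T g \<and>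
      (\<forall>x\<in>paths. f x \<le> g x + h x \<and> g x \<le> f x + h x)"
  shows "ennreal (enn2real ((\<integral>\<^sup>+x. q x \<partial>\<mu>) - (\<delta> + \<delta>)) powr t * enn2real ((\<integral>\<^sup>+x. r x \<partial>\<mu>) - (\<delta> + \<delta>)) powr (1 - t))
    \<le> (\<integral>\<^sup>+x. p x \<partial>\<mu>) + \<delta> + \<delta>"
proof -
  obtain js where js: "set js = J" using finite_list[OF finite_J] by blast
  then have j: "set js \<subseteq> J" by simp
  have bnd: "AE x in \<mu>. QQ js f x \<le> (\<integral>\<^sup>+x. f x \<partial>\<mu>) + \<delta> + QQ js h x \<and> (\<integral>\<^sup>+x. f x \<partial>\<mu>) \<le> QQ js f x + QQ js h x + \<delta>"
    if f: "f \<in> {p, q, r}" for f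
  proof -
    obtain g where g: "g \<in> borel_measurable path_space" "depends_on_T g" "\<And>x. x \<in> paths \<Longrightarrow> f x \<le> g x + h x"
        "\<And>x. x \<in> paths \<Longrightarrow> g x \<le> f x + h x"
      using approx[OF f] by blast
    have "f \<in> borel_measurable path_space" using f m by blast
    from QQ_approx[OF js this g(1) h g(2,3,4) less_imp_le[OF eps]] show ?thesis .
  qed
  have "PL_hyp t (QQ js p) (QQ js q) (QQ js r)"
    by (rule PL_hyp_QQ[OF t m q r M hyp j])
  \<comment> \<open>With both shifts zero the penalty is 1 and every \<open>move\<close> is the
    identity.\<close>
  then have "AE x in \<mu>. ennreal (enn2real (QQ js q (move (\<lambda>_. 0) x)) powr t * enn2real (QQ js r (move (\<lambda>_. 0) x)) powr (1 - t)
       * exp (- t * (1 - t) * (\<Sum>j\<in>J. ((\<lambda>_. 0) j - (\<lambda>_. 0) j)\<^sup>2) / 2)) \<le> QQ js p (move (\<lambda>j. t * (\<lambda>_. 0) j + (1 - t) * (\<lambda>_. 0) j) x)"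
    unfolding PL_hyp_def by blast
  then have PL: "AE x in \<mu>. ennreal (enn2real (QQ js q x) powr t * enn2real (QQ js r x) powr (1 - t)) \<le> QQ js p x"
    by (simp add: move_def)
  \<comment> \<open>The estimates hold almost surely, while \<open>QQ js h < \<delta>\<close> holds
    with positive probability because its expectation is below \<delta>; so some path satisfies
    everything.\<close>
  have "\<exists>x\<in>paths. QQ js h x < \<delta> \<and> ennreal (enn2real (QQ js q x) powr t * enn2real (QQ js r x) powr (1 - t)) \<le> QQ js p x
     \<and> QQ js p x \<le> (\<integral>\<^sup>+x. p x \<partial>\<mu>) + \<delta> + QQ js h x
     \<and> (\<integral>\<^sup>+x. q x \<partial>\<mu>) \<le> QQ js q x + QQ js h x + \<delta> \<and> (\<integral>\<^sup>+x. r x \<partial>\<mu>) \<le> QQ js r x + QQ js h x + \<delta>"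
  proof (rule ccontr)
    assume neg: "\<not> ?thesis"
    have bnd': "AE x in \<mu>. QQ js p x \<le> (\<integral>\<^sup>+x. p x \<partial>\<mu>) + \<delta> + QQ js h x"
      "AE x in \<mu>. (\<integral>\<^sup>+x. q x \<partial>\<mu>) \<le> QQ js q x + QQ js h x + \<delta>"
      "AE x in \<mu>. (\<integral>\<^sup>+x. r x \<partial>\<mu>) \<le> QQ js r x + QQ js h x + \<delta>"
      using bnd[of p] bnd[of q] bnd[of r] by (simp_all add: AE_conj_iff)
    have "AE x in \<mu>. \<delta> \<le> QQ js h x"
      using PL bnd' AE_space
    proof eventually_elim
      case (elim x)
      then have "x \<in> paths" by (simp add: space_mu)
      then show ?case using neg elim(1-4) unfolding not_less[symmetric] by blast
    qed
    then have "(\<integral>\<^sup>+x. \<delta> \<partial>\<mu>) \<le> (\<integral>\<^sup>+x. QQ js h x \<partial>\<mu>)" by (rule nn_integral_mono_AE)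
    then show False using eps by (simp add: nn_integral_QQ[OF j] emeasure_space_1)
  qed
  then obtain x where x: "x \<in> paths" "QQ js h x < \<delta>"
    and 1: "ennreal (enn2real (QQ js q x) powr t * enn2real (QQ js r x) powr (1 - t)) \<le> QQ js p x"
    and 2: "QQ js p x \<le> (\<integral>\<^sup>+x. p x \<partial>\<mu>) + \<delta> + QQ js h x"
    and 3: "(\<integral>\<^sup>+x. q x \<partial>\<mu>) \<le> QQ js q x + QQ js h x + \<delta>" "(\<integral>\<^sup>+x. r x \<partial>\<mu>) \<le> QQ js r x + QQ js h x + \<delta>"
    by blast
  have sub: "enn2real (A - (\<delta> + \<delta>)) \<le> enn2real B" if "A \<le> B + QQ js h x + \<delta>" "B \<le> ennreal M" for A B
  proof -
    have "A \<le> B + \<delta> + \<delta>"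
      using that(1) by (rule order_trans) (intro add_mono order_refl less_imp_le[OF x(2)])
    then have "A - (\<delta> + \<delta>) \<le> B"
      using fin by (subst ennreal_minus_le_iff) (simp add: add_ac less_le)
    moreover have "B < top" using that(2) by (rule le_less_trans) simp
    ultimately show ?thesis by (rule enn2real_mono)
  qed
  have "ennreal (enn2real ((\<integral>\<^sup>+x. q x \<partial>\<mu>) - (\<delta> + \<delta>)) powr t * enn2real ((\<integral>\<^sup>+x. r x \<partial>\<mu>) - (\<delta> + \<delta>)) powr (1 - t))
    \<le> ennreal (enn2real (QQ js q x) powr t * enn2real (QQ js r x) powr (1 - t))"
  proof (rule ennreal_leI, rule mult_mono)
    show "enn2real ((\<integral>\<^sup>+x. q x \<partial>\<mu>) - (\<delta> + \<delta>)) powr t \<le> enn2real (QQ js q x) powr t"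
      using t by (intro powr_mono2 sub[OF 3(1) QQ_bounded[OF j x(1) q]]) simp_all
    show "enn2real ((\<integral>\<^sup>+x. r x \<partial>\<mu>) - (\<delta> + \<delta>)) powr (1 - t) \<le> enn2real (QQ js r x) powr (1 - t)"
      using t by (intro powr_mono2 sub[OF 3(2) QQ_bounded[OF j x(1) r]]) simp_all
  qed simp_all
  also have "\<dots> \<le> (\<integral>\<^sup>+x. p x \<partial>\<mu>) + \<delta> + QQ js h x" using 1 2 by (rule order_trans)
  also have "\<dots> \<le> (\<integral>\<^sup>+x. p x \<partial>\<mu>) + \<delta> + \<delta>" using x(2) by (intro add_left_mono) simp
  finally show ?thesis .
qed

end

subsection \<open>Step paths in the Cameron-Martin space\<close>

lemma sets_unit_time: "sets unit_time = sets (restrict_space borel {0..1})"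
  unfolding unit_time_def by (rule sets_restrict_space_cong) simp

lemma measurable_unit_time: "f \<in> borel_measurable borel \<Longrightarrow> f \<in> borel_measurable unit_time"
  unfolding measurable_cong_sets[OF sets_unit_time refl] by (rule measurable_restrict_space1)

lemma finite_measure_unit_time: "finite_measure unit_time"
  by (rule finite_measureI) (simp add: unit_time_def emeasure_restrict_space space_restrict_space)

lemma integral_unit_time:
  fixes f :: "real \<Rightarrow> 'a::{banach, second_countable_topology}"
  shows "(LINT s|unit_time. f s) = (LINT s|lborel. indicator {0..1} s *\<^sub>R f s)"
  unfolding unit_time_def by (subst integral_restrict_space) auto

lemma integrable_unit_time:
  fixes f :: "real \<Rightarrow> 'a::{banach, second_countable_topology}"
  shows "integrable unit_time f \<longleftrightarrow> integrable lborel (\<lambda>s. indicator {0..1} s *\<^sub>R f s)"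
  unfolding unit_time_def by (subst integrable_restrict_space) auto

lemma integrable_square_imp_integrable:
  fixes g :: "real \<Rightarrow> real ^ 'n"
  assumes "g \<in> borel_measurable unit_time" "integrable unit_time (\<lambda>s. (norm (g s))\<^sup>2)"
  shows "integrable unit_time g"
proof (rule Bochner_Integration.integrable_bound)
  interpret finite_measure unit_time by (rule finite_measure_unit_time)
  show "integrable unit_time (\<lambda>s. 1 + (norm (g s))\<^sup>2)" using assms(2) by simp
  have "x \<le> 1 + x\<^sup>2" if "x \<ge> 0" for x :: real
  proof -
    have "0 \<le> (x - 1/2)\<^sup>2" by simp
    then have "x \<le> x\<^sup>2 + (1/2)\<^sup>2" by (simp add: power2_diff)
    moreover have "(1/2 :: real)\<^sup>2 \<le> 1" by (simp add: power2_eq_square)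
    ultimately show ?thesis by linarith
  qed
  then show "AE x in unit_time. norm (g x) \<le> norm (1 + (norm (g x))\<^sup>2)"
    by (intro AE_I2) simp
qed (rule assms)

text \<open>The positive and negative parts of \<open>f\<close> define finite measures that agree on
  all half-lines, hence coincide; so do their densities almost everywhere.\<close>

lemma AE_zero_if_primitive_zero:
  fixes f :: "real \<Rightarrow> real"
  assumes f: "integrable lborel f" and z: "\<And>x. (LINT s:{x<..}|lborel. f s) = 0"
  shows "AE s in lborel. f s = 0"
proof -
  have [measurable]: "f \<in> borel_measurable borel" using f by auto
  \<comment> \<open>The embedding \<open>ennreal\<close> sends negative reals to 0, so
    \<open>M\<close> and \<open>N\<close> have the positive and the negative part of
    \<open>f\<close> as densities.\<close>
  define M where "M = density lborel (\<lambda>s. ennreal (f s))"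
  define N where "N = density lborel (\<lambda>s. ennreal (- f s))"
  have int: "integrable lborel (\<lambda>s. indicator A s * max 0 (h s))"
    if "A \<in> sets borel" "integrable lborel h" for A and h :: "real \<Rightarrow> real"
    using that by (intro integrable_real_mult_indicator[of A lborel "\<lambda>s. max 0 (h s)", unfolded mult.commute[of _ "indicator _ _"]]) auto
  have em: "emeasure (density lborel (\<lambda>s. ennreal (h s))) A = ennreal (LINT s|lborel. indicator A s * max 0 (h s))"
    if A [measurable]: "A \<in> sets borel" and h: "integrable lborel h" for A and h :: "real \<Rightarrow> real"
  proof -
    have [measurable]: "h \<in> borel_measurable borel" using h by auto
    have "emeasure (density lborel (\<lambda>s. ennreal (h s))) A = (\<integral>\<^sup>+s. ennreal (h s) * indicator A s \<partial>lborel)"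
      by (rule emeasure_density) simp_all
    also have "\<dots> = (\<integral>\<^sup>+s. ennreal (indicator A s * max 0 (h s)) \<partial>lborel)"
      by (intro nn_integral_cong) (auto simp: indicator_def max_def ennreal_neg)
    also have "\<dots> = ennreal (LINT s|lborel. indicator A s * max 0 (h s))"
      by (intro nn_integral_eq_integral int A h) simp
    finally show ?thesis .
  qed
  have mf: "integrable lborel (\<lambda>s. - f s)" using f by simp
  have "M = N"
  proof (rule measure_eqI_lessThan)
    show "sets M = sets borel" "sets N = sets borel" by (simp_all add: M_def N_def)
    fix x :: real
    show "emeasure M {x<..} < \<infinity>" unfolding M_def by (subst em[OF _ f]) auto
    have "(LINT s|lborel. indicator {x<..} s * max 0 (f s)) - (LINT s|lborel. indicator {x<..} s * max 0 (- f s))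
       = (LINT s|lborel. indicator {x<..} s * max 0 (f s) - indicator {x<..} s * max 0 (- f s))"
      by (intro Bochner_Integration.integral_diff[symmetric] int f mf) simp_all
    also have "\<dots> = (LINT s:{x<..}|lborel. f s)"
      unfolding set_lebesgue_integral_def by (intro Bochner_Integration.integral_cong) (auto simp: indicator_def max_def)
    finally show "emeasure M {x<..} = emeasure N {x<..}"
      unfolding M_def N_def using z by (subst (1 2) em) (auto intro: f mf)
  qed
  then have "AE s in lborel. ennreal (f s) = ennreal (- f s)"
    unfolding M_def N_def by (intro sigma_finite_measure.density_unique[OF lborel.sigma_finite_measure_axioms]) simp_all
  then show ?thesis
  proof eventually_elim
    case (elim s)
    then show ?case by (cases "f s \<ge> 0") (auto simp: ennreal_neg ennreal_eq_0_iff dest: sym)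
  qed
qed

text \<open>\<open>CM_normsq\<close> picks a density by \<open>SOME\<close>; uniqueness makes it
  computable from any explicit density. The difference of two densities has a vanishing primitive,
  and this is used component by component.\<close>

lemma is_density_unique:
  fixes h :: "('n::finite) path"
  assumes g: "is_density h g" and g': "is_density h g'"
  shows "AE s in unit_time. g s = g' s"
proof -
  have i: "integrable unit_time g" "integrable unit_time g'"
    by (rule integrable_square_imp_integrable; use g g' in \<open>simp add: is_density_def\<close>)+
  \<comment> \<open>The difference is extended by 0 to the whole line, so that half-lines starting
    before 0 or after 1 fall under the same lemma.\<close>
  define f where "f = (\<lambda>k s. indicator {0..1} s * (g s $ k - g' s $ k))"
  have il: "integrable lborel (\<lambda>s. indicator {0..1} s *\<^sub>R (g s - g' s))"
    using i by (simp flip: integrable_unit_time)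
  have fk: "f k = (\<lambda>s. (indicator {0..1} s *\<^sub>R (g s - g' s)) $ k)" for k
    by (simp add: f_def fun_eq_iff)
  have fi: "integrable lborel (f k)" for k
    unfolding fk by (rule integrable_bounded_linear[OF bounded_linear_vec_nth il])
  have prim: "(LINT s|lborel. indicator {0..t} s *\<^sub>R (indicator {0..1} s *\<^sub>R (g s - g' s))) = 0" if "t \<in> {0..1}" for t
  proof -
    have ii: "integrable unit_time (\<lambda>s. indicator {0..t} s *\<^sub>R u s)" if "integrable unit_time u" for u :: "real \<Rightarrow> real ^ 'n"
      using that \<open>t \<in> {0..1}\<close> by (intro integrable_mult_indicator) (auto simp: sets_unit_time sets_restrict_space)
    have "h t = (LINT s:{0..t}|unit_time. g s)" "h t = (LINT s:{0..t}|unit_time. g' s)"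
    proof -
      have "h t = (if t \<in> {0..1} then (LINT s:{0..t}|unit_time. g s) else 0)"
        by (rule g[unfolded is_density_def, THEN conjunct2, THEN conjunct2, THEN fun_cong])
      moreover have "h t = (if t \<in> {0..1} then (LINT s:{0..t}|unit_time. g' s) else 0)"
        by (rule g'[unfolded is_density_def, THEN conjunct2, THEN conjunct2, THEN fun_cong])
      ultimately show "h t = (LINT s:{0..t}|unit_time. g s)" "h t = (LINT s:{0..t}|unit_time. g' s)"
        using that by simp_all
    qed
    then have "(LINT s|unit_time. indicator {0..t} s *\<^sub>R g s - indicator {0..t} s *\<^sub>R g' s) = 0"
      unfolding set_lebesgue_integral_def
      by (subst Bochner_Integration.integral_diff[OF ii[OF i(1)] ii[OF i(2)]]) simp
    then show ?thesis
      unfolding integral_unit_time by (simp add: scaleR_diff_right mult.commute)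
  qed
  have primk: "(LINT s|lborel. indicator {0..t} s * f k s) = 0" if "t \<in> {0..1}" for t k
  proof -
    have "integrable lborel (\<lambda>s. indicator {0..t} s *\<^sub>R (indicator {0..1} s *\<^sub>R (g s - g' s)))"
      by (intro integrable_mult_indicator il) simp
    from integral_bounded_linear[OF bounded_linear_vec_nth[of k] this] show ?thesis
      unfolding prim[OF that] by (simp add: f_def mult.assoc)
  qed
  have "AE s in lborel. f k s = 0" for k
  proof (rule AE_zero_if_primitive_zero[OF fi])
    fix x :: real
    have one: "(LINT s|lborel. f k s) = 0"
    proof -
      have "(LINT s|lborel. f k s) = (LINT s|lborel. indicator {0..1} s * f k s)"
        by (intro Bochner_Integration.integral_cong) (auto simp: f_def indicator_def)
      then show ?thesis using primk[of 1 k] by simp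
    qed
    consider "x < 0" | "x \<in> {0..1}" | "x > 1" by (cases "x < 0"; cases "x > 1") auto
    then show "(LINT s:{x<..}|lborel. f k s) = 0"
    proof cases
      case 1
      have "(LINT s:{x<..}|lborel. f k s) = (LINT s|lborel. f k s)"
        unfolding set_lebesgue_integral_def using 1
        by (intro Bochner_Integration.integral_cong) (auto simp: f_def indicator_def)
      then show ?thesis using one by simp
    next
      case 2
      have "(LINT s:{x<..}|lborel. f k s) = (LINT s|lborel. f k s - indicator {0..x} s * f k s)"
        unfolding set_lebesgue_integral_def using 2
        by (intro Bochner_Integration.integral_cong) (auto simp: f_def indicator_def)
      also have "\<dots> = (LINT s|lborel. f k s) - (LINT s|lborel. indicator {0..x} s * f k s)"
      proof (rule Bochner_Integration.integral_diff[OF fi])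
        show "integrable lborel (\<lambda>s. indicator {0..x} s * f k s)"
          using integrable_mult_indicator[OF _ fi[of k], of "{0..x}"] by simp
      qed
      finally show ?thesis using one primk[OF 2] by simp
    next
      case 3
      have "(LINT s:{x<..}|lborel. f k s) = (LINT s|(lborel :: real measure). 0)"
        unfolding set_lebesgue_integral_def using 3
        by (intro Bochner_Integration.integral_cong) (auto simp: f_def indicator_def)
      then show ?thesis by simp
    qed
  qed
  then have "AE s in lborel. \<forall>k\<in>(UNIV :: 'n set). f k s = 0"
    by (rule AE_finite_allI[OF finite])
  then have "AE s in lborel. s \<in> {0..1} \<longrightarrow> g s = g' s"
  proof eventually_elim
    case (elim s)
    show ?case
    proof
      assume "s \<in> {0..1}"
      then show "g s = g' s" using elim by (simp add: f_def vec_eq_iff)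
    qed
  qed
  then show ?thesis unfolding unit_time_def by (rule AE_restrict_space_iff[THEN iffD2, rotated]) simp
qed

lemma is_density_measurable: "is_density h g \<Longrightarrow> g \<in> borel_measurable unit_time"
  by (simp add: is_density_def)

lemma CM_normsq_eq:
  assumes g: "is_density h g"
  shows "CM_normsq h = (LINT s|unit_time. (norm (g s))\<^sup>2)"
proof -
  have *: "is_density h (SOME g. is_density h g)" using someI[of "is_density h", OF g] .
  have [measurable]: "g \<in> borel_measurable unit_time" "(SOME g. is_density h g) \<in> borel_measurable unit_time"
    by (rule is_density_measurable[OF g], rule is_density_measurable[OF *])
  show ?thesis unfolding CM_normsq_def
  proof (rule integral_cong_AE)
    show "AE s in unit_time. (norm ((SOME g. is_density h g) s))\<^sup>2 = (norm (g s))\<^sup>2"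
      using is_density_unique[OF * g] by eventually_elim simp
  qed measurable
qed

section \<open>Orthonormal step directions of a time grid\<close>

locale time_grid =
  fixes m :: nat and \<tau> :: "nat \<Rightarrow> real"
  assumes tau_0: "\<tau> 0 = 0" and tau_step: "i < m \<Longrightarrow> \<tau> i < \<tau> (Suc i)" and tau_m: "\<tau> m \<le> 1"
begin

lemma tau_mono: "i \<le> l \<Longrightarrow> l \<le> m \<Longrightarrow> \<tau> i \<le> \<tau> l"
proof (induction l)
  case (Suc l)
  show ?case
  proof (cases "i = Suc l")
    case False
    then have "\<tau> i \<le> \<tau> l" using Suc by simp
    also have "\<tau> l < \<tau> (Suc l)" using Suc.prems by (intro tau_step) simp
    finally show ?thesis by simp
  qed simp
qed simp

lemma tau_range: "l \<le> m \<Longrightarrow> \<tau> l \<in> {0..1}"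
  using tau_mono[of 0 l] tau_mono[of l m] tau_0 tau_m by auto

abbreviation \<Delta> :: "nat \<Rightarrow> real" where "\<Delta> i \<equiv> \<tau> (Suc i) - \<tau> i"

text \<open>The factor \<open>1 / sqrt (\<Delta> i)\<close> gives unit norm in \<open>L^2\<close>.
  The intervals are open on the left like those of \<open>simple_process\<close>, so that linear
  combinations are literally simple processes.\<close>

definition dens :: "nat \<times> 'n::finite \<Rightarrow> real \<Rightarrow> real ^ 'n" where
  "dens j s = (indicator {\<tau> (fst j)<..\<tau> (Suc (fst j))} s / sqrt (\<Delta> (fst j))) *\<^sub>R axis (snd j) 1"

text \<open>The primitive of \<open>dens j\<close> in closed form: clamping \<open>s\<close> to the
  interval measures the part of it already passed.\<close>

definition dir :: "nat \<times> 'n::finite \<Rightarrow> 'n path" where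
  "dir j s = (if s \<in> {0..1} then ((min (max s (\<tau> (fst j))) (\<tau> (Suc (fst j))) - \<tau> (fst j)) / sqrt (\<Delta> (fst j))) *\<^sub>R axis (snd j) 1 else 0)"

text \<open>The Wiener integral of \<open>dens j\<close> along the path, which for a step function
  is a normalised increment.\<close>

definition coord :: "nat \<times> 'n::finite \<Rightarrow> 'n path \<Rightarrow> real" where
  "coord j x = (x (\<tau> (Suc (fst j))) $ snd j - x (\<tau> (fst j)) $ snd j) / sqrt (\<Delta> (fst j))"

definition idx :: "(nat \<times> 'n::finite) set" where
  "idx = {..<m} \<times> UNIV"

lemma finite_idx: "finite idx" by (simp add: idx_def)

lemma idx_less: "j \<in> idx \<Longrightarrow> fst j < m" by (auto simp: idx_def)

definition step_path :: "(nat \<times> 'n::finite \<Rightarrow> real) \<Rightarrow> 'n path" where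
  "step_path c = (\<lambda>s. \<Sum>j\<in>idx. c j *\<^sub>R dir j s)"

definition step_dens :: "(nat \<times> 'n::finite \<Rightarrow> real) \<Rightarrow> real \<Rightarrow> real ^ 'n" where
  "step_dens c = (\<lambda>s. \<Sum>j\<in>idx. c j *\<^sub>R dens j s)"

lemma dir_paths: "j \<in> idx \<Longrightarrow> dir j \<in> paths"
proof -
  assume j: "j \<in> idx"
  have "continuous_on {0..1} (\<lambda>s. ((min (max s (\<tau> (fst j))) (\<tau> (Suc (fst j))) - \<tau> (fst j)) / sqrt (\<Delta> (fst j))) *\<^sub>R (axis (snd j) 1 :: real ^ 'a))"
    using tau_step[OF idx_less[OF j]] by (intro continuous_intros) auto
  then have "continuous_on {0..1} (dir j)"
    by (rule continuous_on_cong[THEN iffD1, rotated -1]) (auto simp: dir_def)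
  then show ?thesis by (auto simp: paths_def dir_def)
qed

lemma step_path_paths: "step_path c \<in> paths"
  using dir_paths unfolding paths_def step_path_def
  by (auto intro!: continuous_intros sum.neutral)

lemma dir_at_tau:
  assumes j: "j \<in> idx" and l: "l \<le> m"
  shows "dir j (\<tau> l) = (if fst j < l then sqrt (\<Delta> (fst j)) else 0) *\<^sub>R axis (snd j) 1"
proof -
  have i: "fst j < m" using j by (rule idx_less)
  have d: "\<Delta> (fst j) > 0" using tau_step[OF i] by simp
  show ?thesis
  proof (cases "fst j < l")
    case True
    then have "\<tau> (Suc (fst j)) \<le> \<tau> l" using l by (intro tau_mono) auto
    then have "min (max (\<tau> l) (\<tau> (fst j))) (\<tau> (Suc (fst j))) = \<tau> (Suc (fst j))" by simp
    then show ?thesis using True tau_range[OF l] d by (simp add: dir_def real_div_sqrt)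
  next
    case False
    then have "\<tau> l \<le> \<tau> (fst j)" using i by (intro tau_mono) auto
    then show ?thesis using False d by (simp add: dir_def)
  qed
qed

text \<open>Biorthogonality of directions and coordinates: between consecutive grid times
  \<open>dir i\<close> changes only across its own interval, by
  \<open>sqrt (\<Delta> (fst i))\<close> along its own axis.\<close>

lemma coord_shift:
  assumes i: "i \<in> idx" and j: "j \<in> idx"
  shows "coord j (\<lambda>s. x s + r *\<^sub>R dir i s) = coord j x + (if i = j then r else 0)"
proof -
  have jm: "fst j < m" using j by (rule idx_less)
  have d: "\<Delta> (fst j) > 0" using tau_step[OF jm] by simp
  have "dir i (\<tau> (Suc (fst j))) $ snd j - dir i (\<tau> (fst j)) $ snd j = (if i = j then sqrt (\<Delta> (fst j)) else 0)"
    using jm by (auto simp: dir_at_tau[OF i] axis_def prod_eq_iff less_Suc_eq)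
  then have *: "r * dir i (\<tau> (Suc (fst j))) $ snd j - r * dir i (\<tau> (fst j)) $ snd j = (if i = j then r * sqrt (\<Delta> (fst j)) else 0)"
    unfolding right_diff_distrib[symmetric] by simp
  have "coord j (\<lambda>s. x s + r *\<^sub>R dir i s) = coord j x
      + (r * dir i (\<tau> (Suc (fst j))) $ snd j - r * dir i (\<tau> (fst j)) $ snd j) / sqrt (\<Delta> (fst j))"
    by (simp add: coord_def add_divide_distrib[symmetric])
  then show ?thesis unfolding * using d by simp
qed

lemma coord_local:
  assumes "j \<in> idx" "\<And>s. s \<in> \<tau> ` {..m} \<Longrightarrow> x s = y s"
  shows "coord j x = coord j y"
  using assms idx_less[OF assms(1)] by (simp add: coord_def)

lemma axis_sum: "(\<Sum>k\<in>UNIV. (v $ k) *\<^sub>R axis k 1) = (v :: real ^ 'n::finite)"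
  using basis_expansion[of v] by (simp add: scalar_mult_eq_scaleR)

text \<open>The normalising factors cancel and the increments up to \<open>s\<close> telescope; the
  start at 0 fixes the remaining constant.\<close>

lemma coord_determines:
  fixes x :: "'n::finite path"
  assumes x0: "x 0 = 0" and s: "s \<in> \<tau> ` {..m}"
  shows "(\<Sum>j\<in>idx. coord j x *\<^sub>R dir j s) = x s"
proof -
  obtain l where l: "l \<le> m" "s = \<tau> l" using s by auto
  have "(\<Sum>j\<in>idx. coord j x *\<^sub>R dir j s) = (\<Sum>j\<in>idx. (if fst j < l then (x (\<tau> (Suc (fst j))) - x (\<tau> (fst j))) $ snd j else 0) *\<^sub>R axis (snd j) 1)"
  proof (rule sum.cong)
    fix j :: "nat \<times> 'n" assume j: "j \<in> idx"
    have "\<Delta> (fst j) > 0" using tau_step[OF idx_less[OF j]] by simp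
    then show "coord j x *\<^sub>R dir j s = (if fst j < l then (x (\<tau> (Suc (fst j))) - x (\<tau> (fst j))) $ snd j else 0) *\<^sub>R axis (snd j) 1"
      unfolding l(2) dir_at_tau[OF j l(1)] by (simp add: coord_def)
  qed simp
  also have "\<dots> = (\<Sum>i<m. \<Sum>k\<in>UNIV. (if i < l then (x (\<tau> (Suc i)) - x (\<tau> i)) $ k else 0) *\<^sub>R axis k 1)"
    unfolding idx_def by (simp add: sum.cartesian_product split_def)
  also have "\<dots> = (\<Sum>i<m. if i < l then x (\<tau> (Suc i)) - x (\<tau> i) else 0)"
  proof (rule sum.cong)
    fix i
    show "(\<Sum>k\<in>UNIV. (if i < l then (x (\<tau> (Suc i)) - x (\<tau> i)) $ k else 0) *\<^sub>R axis k 1)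
      = (if i < l then x (\<tau> (Suc i)) - x (\<tau> i) else 0)"
      using axis_sum[of "x (\<tau> (Suc i)) - x (\<tau> i)"] by (cases "i < l") auto
  qed simp
  also have "\<dots> = (\<Sum>i<l. x (\<tau> (Suc i)) - x (\<tau> i))"
    using l by (intro sum.mono_neutral_cong_right) auto
  also have "\<dots> = x (\<tau> l) - x (\<tau> 0)" by (rule sum_lessThan_telescope)
  finally show ?thesis using x0 by (simp add: tau_0 l)
qed

lemma dens_measurable [measurable]: "dens j \<in> borel_measurable borel"
  unfolding dens_def by measurable

lemma step_dens_measurable [measurable]: "step_dens c \<in> borel_measurable borel"
  unfolding step_dens_def by measurable

lemma dens_bound: "norm (dens j s) \<le> 1 / sqrt (\<Delta> (fst j))" if "j \<in> idx"
  using tau_step[OF idx_less[OF that]] by (auto simp: dens_def indicator_def)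

lemma step_dens_bound: "norm (step_dens c s) \<le> (\<Sum>j\<in>idx. \<bar>c j\<bar> / sqrt (\<Delta> (fst j)))"
proof -
  have "norm (step_dens c s) \<le> (\<Sum>j\<in>idx. norm (c j *\<^sub>R dens j s))"
    unfolding step_dens_def by (rule norm_sum)
  also have "\<dots> \<le> (\<Sum>j\<in>idx. \<bar>c j\<bar> / sqrt (\<Delta> (fst j)))"
    using mult_left_mono[OF dens_bound, of _ "\<bar>c _\<bar>"] by (intro sum_mono) simp
  finally show ?thesis .
qed

lemma dens_integral:
  assumes j: "j \<in> idx" and t: "t \<in> {0..1}"
  shows "integrable unit_time (\<lambda>s. indicator {0..t} s *\<^sub>R dens j s)"
    and "(LINT s:{0..t}|unit_time. dens j s) = dir j t"
proof -
  have i: "fst j < m" using j by (rule idx_less)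
  have d: "\<Delta> (fst j) > 0" using tau_step[OF i] by simp
  define R where "R = {\<tau> (fst j)<..min t (\<tau> (Suc (fst j)))}"
  have r: "\<tau> (fst j) \<ge> 0" "\<tau> (Suc (fst j)) \<le> 1" using tau_range[of "fst j"] tau_range[of "Suc (fst j)"] i by auto
  have eq: "indicator {0..1} s *\<^sub>R indicator {0..t} s *\<^sub>R dens j s = (indicator R s / sqrt (\<Delta> (fst j))) *\<^sub>R axis (snd j) 1" for s
    using r t by (auto simp: dens_def R_def indicator_def)
  have I: "has_bochner_integral lborel (indicator R) (measure lborel R)"
  proof (rule has_bochner_integral_real_indicator)
    have "R \<subseteq> {0..1}" using r t by (auto simp: R_def)
    from emeasure_mono[OF this, of lborel] show "emeasure lborel R < \<infinity>" by (simp add: le_less_trans)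
  qed (simp add: R_def)
  have mR: "measure lborel R = min (max t (\<tau> (fst j))) (\<tau> (Suc (fst j))) - \<tau> (fst j)"
  proof (cases "t \<le> \<tau> (fst j)")
    case True
    then have "R = {}" by (auto simp: R_def)
    then show ?thesis using True d by simp
  next
    case False
    then have "\<tau> (fst j) \<le> min t (\<tau> (Suc (fst j)))" using d by simp
    then show ?thesis using False unfolding R_def by simp
  qed
  have B: "has_bochner_integral lborel (\<lambda>s. (indicator R s / sqrt (\<Delta> (fst j))) *\<^sub>R axis (snd j) 1)
    ((measure lborel R / sqrt (\<Delta> (fst j))) *\<^sub>R (axis (snd j) 1 :: real ^ 'a))"
    by (intro has_bochner_integral_scaleR_left has_bochner_integral_divide I)
  show "integrable unit_time (\<lambda>s. indicator {0..t} s *\<^sub>R dens j s)"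
    unfolding integrable_unit_time eq using B by (rule integrable.intros)
  show "(LINT s:{0..t}|unit_time. dens j s) = dir j t"
    unfolding set_lebesgue_integral_def integral_unit_time eq has_bochner_integral_integral_eq[OF B] mR
    using t by (simp add: dir_def)
qed

lemma dens_inner:
  assumes "i \<in> idx" "j \<in> idx"
  shows "dens i s \<bullet> dens j s = (if i = j then indicator {\<tau> (fst j)<..\<tau> (Suc (fst j))} s / \<Delta> (fst j) else 0)"
proof (cases "i = j")
  case True
  have "\<Delta> (fst j) > 0" using tau_step[OF idx_less[OF assms(2)]] by simp
  then show ?thesis using True by (simp add: dens_def inner_axis_axis indicator_def)
next
  case False
  show ?thesis
  proof (cases "fst i = fst j")
    case True
    then have "snd i \<noteq> snd j" using False by (simp add: prod_eq_iff)
    then show ?thesis using False by (simp add: dens_def inner_axis_axis)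
  next
    case ne: False
    have "\<tau> (Suc (fst i)) \<le> \<tau> (fst j) \<or> \<tau> (Suc (fst j)) \<le> \<tau> (fst i)"
      using ne idx_less[OF assms(1)] idx_less[OF assms(2)]
      by (cases "fst i < fst j") (auto intro!: tau_mono)
    then have "\<not> (s \<in> {\<tau> (fst i)<..\<tau> (Suc (fst i))} \<and> s \<in> {\<tau> (fst j)<..\<tau> (Suc (fst j))})" by auto
    then show ?thesis using False by (auto simp: dens_def indicator_def)
  qed
qed

text \<open>Cross terms vanish because two different densities either live on disjoint intervals or
  point along orthogonal axes.\<close>

lemma step_dens_normsq: "(norm (step_dens c s))\<^sup>2 = (\<Sum>j\<in>idx. (c j)\<^sup>2 * (indicator {\<tau> (fst j)<..\<tau> (Suc (fst j))} s / \<Delta> (fst j)))"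
proof -
  have "(norm (step_dens c s))\<^sup>2 = (\<Sum>i\<in>idx. \<Sum>j\<in>idx. c i * (c j * (dens j s \<bullet> dens i s)))"
    by (simp add: power2_norm_eq_inner step_dens_def inner_sum_left inner_sum_right sum_distrib_left)
  also have "\<dots> = (\<Sum>i\<in>idx. \<Sum>j\<in>idx. if j = i then c i * (c i * (indicator {\<tau> (fst i)<..\<tau> (Suc (fst i))} s / \<Delta> (fst i))) else 0)"
    by (intro sum.cong refl) (simp add: dens_inner)
  also have "\<dots> = (\<Sum>j\<in>idx. (c j)\<^sup>2 * (indicator {\<tau> (fst j)<..\<tau> (Suc (fst j))} s / \<Delta> (fst j)))"
    by (simp add: sum.delta finite_idx power2_eq_square mult.assoc)
  finally show ?thesis .
qed

lemma step_dens_normsq_integral: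
  "has_bochner_integral unit_time (\<lambda>s. (norm (step_dens c s))\<^sup>2) (\<Sum>j\<in>idx. (c j)\<^sup>2)"
  unfolding step_dens_normsq
proof (rule has_bochner_integral_sum)
  fix j :: "nat \<times> 'a" assume j: "j \<in> idx"
  have i: "fst j < m" using j by (rule idx_less)
  have d: "\<Delta> (fst j) > 0" using tau_step[OF i] by simp
  define R where "R = {\<tau> (fst j)<..\<tau> (Suc (fst j))}"
  have r: "\<tau> (fst j) \<ge> 0" "\<tau> (Suc (fst j)) \<le> 1" using tau_range[of "fst j"] tau_range[of "Suc (fst j)"] i by auto
  have I: "has_bochner_integral lborel (indicator R) (measure lborel R)"
  proof (rule has_bochner_integral_real_indicator)
    have "R \<subseteq> {0..1}" using r by (auto simp: R_def)
    from emeasure_mono[OF this, of lborel] show "emeasure lborel R < \<infinity>" by (simp add: le_less_trans)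
  qed (simp add: R_def)
  have mR: "measure lborel R = \<Delta> (fst j)" using d by (simp add: R_def)
  have B: "has_bochner_integral lborel (\<lambda>s. (c j)\<^sup>2 * (indicator R s / \<Delta> (fst j))) ((c j)\<^sup>2 * (measure lborel R / \<Delta> (fst j)))"
    by (intro has_bochner_integral_mult_right has_bochner_integral_divide I)
  have eq: "indicator {0..1} s *\<^sub>R ((c j)\<^sup>2 * (indicator {\<tau> (fst j)<..\<tau> (Suc (fst j))} s / \<Delta> (fst j))) = (c j)\<^sup>2 * (indicator R s / \<Delta> (fst j))" for s
    using r by (auto simp: R_def indicator_def)
  show "has_bochner_integral unit_time (\<lambda>s. (c j)\<^sup>2 * (indicator {\<tau> (fst j)<..\<tau> (Suc (fst j))} s / \<Delta> (fst j))) ((c j)\<^sup>2)"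
    unfolding has_bochner_integral_iff integrable_unit_time integral_unit_time eq
    using B d by (auto simp: has_bochner_integral_iff mR)
qed

lemma is_density_step: "is_density (step_path c) (step_dens c)"
  unfolding is_density_def
proof (intro conjI)
  show "step_dens c \<in> borel_measurable unit_time" by (rule measurable_unit_time) simp
  show "integrable unit_time (\<lambda>s. (norm (step_dens c s))\<^sup>2)"
    using step_dens_normsq_integral by (rule integrable.intros)
  show "step_path c = (\<lambda>t. if t \<in> {0..1} then (LINT s:{0..t}|unit_time. step_dens c s) else 0)"
  proof
    fix t
    show "step_path c t = (if t \<in> {0..1} then (LINT s:{0..t}|unit_time. step_dens c s) else 0)"
    proof (cases "t \<in> {0..1}")
      case True
      have "(LINT s:{0..t}|unit_time. step_dens c s) = (LINT s|unit_time. (\<Sum>j\<in>idx. c j *\<^sub>R (indicator {0..t} s *\<^sub>R dens j s)))"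
        unfolding set_lebesgue_integral_def step_dens_def
        by (intro Bochner_Integration.integral_cong) (simp_all add: scaleR_sum_right mult.commute)
      also have "\<dots> = (\<Sum>j\<in>idx. (LINT s|unit_time. c j *\<^sub>R (indicator {0..t} s *\<^sub>R dens j s)))"
        by (intro Bochner_Integration.integral_sum integrable_scaleR_right dens_integral(1)[OF _ True])
      also have "\<dots> = step_path c t"
        unfolding step_path_def
      proof (rule sum.cong)
        fix j :: "nat \<times> 'a" assume "j \<in> idx"
        from dens_integral(2)[OF this True]
        show "(LINT s|unit_time. c j *\<^sub>R (indicator {0..t} s *\<^sub>R dens j s)) = c j *\<^sub>R dir j t"
          unfolding set_lebesgue_integral_def by (simp only: integral_scaleR_right)
      qed simp
      finally show ?thesis using True by simp
    next
      case False
      then show ?thesis by (auto simp: step_path_def dir_def)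
    qed
  qed
qed

lemma CM_normsq_step: "CM_normsq (step_path c) = (\<Sum>j\<in>idx. (c j)\<^sup>2)"
  unfolding CM_normsq_eq[OF is_density_step] by (rule has_bochner_integral_integral_eq[OF step_dens_normsq_integral])

lemma step_path_bounded: "step_path c \<in> CM_bounded"
  unfolding CM_bounded_def mem_Collect_eq
  by (intro exI conjI, rule is_density_step, rule AE_I2, rule step_dens_bound)

lemma path_comb_step: "path_comb t (step_path c) (step_path c') = step_path (\<lambda>j. t * c j + (1 - t) * c' j)"
  by (rule ext) (simp add: path_comb_def step_path_def scaleR_sum_right scaleR_add_left sum.distrib)

text \<open>A step density is already a simple process with deterministic coefficients, so its Ito
  integral needs no limit: a constant approximating sequence does.\<close>

lemma simple_process_step:
  "simple_process m \<tau> (\<lambda>i _. \<Sum>k\<in>UNIV. (c (i, k) / sqrt (\<Delta> i)) *\<^sub>R axis k 1) w s = step_dens c s"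
proof -
  have "step_dens c s = (\<Sum>i<m. \<Sum>k\<in>UNIV. c (i, k) *\<^sub>R dens (i, k) s)"
    unfolding step_dens_def idx_def by (simp add: sum.cartesian_product split_def)
  then show ?thesis
    unfolding simple_process_def by (simp add: dens_def scaleR_sum_right divide_inverse mult_ac)
qed

lemma simple_integral_step:
  "simple_integral \<beta> m \<tau> (\<lambda>i _. \<Sum>k\<in>UNIV. (c (i, k) / sqrt (\<Delta> i)) *\<^sub>R axis k 1) w = (\<Sum>j\<in>idx. c j * coord j (\<beta> w))"
proof -
  have "(\<Sum>j\<in>idx. c j * coord j (\<beta> w)) = (\<Sum>i<m. \<Sum>k\<in>UNIV. c (i, k) * coord (i, k) (\<beta> w))"
    unfolding idx_def by (simp add: sum.cartesian_product split_def)
  then show ?thesis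
    unfolding simple_integral_def by (simp add: coord_def inner_sum_left inner_axis' divide_inverse mult_ac)
qed

end

subsection \<open>Transfer to the law of the Brownian motion\<close>

locale perturbed_wiener =
  fixes \<nu> :: "('n::finite) path measure"
    and \<beta> :: "'n path \<Rightarrow> 'n path"
    and W :: "('n path \<Rightarrow> 'n path) \<Rightarrow> 'n path \<Rightarrow> 'n path"
  assumes prob_nu: "prob_space \<nu>" and sets_nu: "sets \<nu> = sets path_space"
    and family: "perturbation_family \<nu> \<beta> W"
begin

lemma space_nu: "space \<nu> = paths"
  using sets_eq_imp_space_eq[OF sets_nu] by (simp add: space_path_space)

lemma beta_measurable: "\<beta> \<in> measurable (completion \<nu>) path_space"
  using family by (simp add: perturbation_family_def brownian_motion_def)

lemma W_measurable: "u \<in> drifts \<nu> \<Longrightarrow> W u \<in> measurable (completion \<nu>) path_space"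
  using family by (simp add: perturbation_family_def)

lemma const_drift: "h \<in> CM_bounded \<Longrightarrow> (\<lambda>_. h) \<in> drifts \<nu>"
  by (rule constant_drift[OF prob_nu])

lemma beta_W: "h \<in> CM_bounded \<Longrightarrow> AE w in \<nu>. \<beta> (W (\<lambda>_. h) w) = (\<lambda>s. \<beta> w s + h s)"
proof -
  assume "h \<in> CM_bounded"
  have "\<forall>u\<in>drifts \<nu>. AE w in \<nu>. \<beta> (W u w) = (\<lambda>s. \<beta> w s + u w s)"
    using family by (simp add: perturbation_family_def)
  from bspec[OF this const_drift[OF \<open>h \<in> CM_bounded\<close>]] show ?thesis .
qed

lemma W_zero: "AE w in \<nu>. W (\<lambda>_ _. 0) w = w"
  using family by (simp add: perturbation_family_def)

definition \<mu> :: "'n path measure" where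
  "\<mu> = distr (completion \<nu>) path_space \<beta>"

lemma prob_mu: "prob_space \<mu>"
  unfolding \<mu>_def using prob_space.prob_space_completion[OF prob_nu] beta_measurable
  by (rule prob_space.prob_space_distr)

lemma sets_mu: "sets \<mu> = sets path_space" by (simp add: \<mu>_def)

lemma beta_start: "AE x in \<mu>. x 0 = 0"
proof -
  have "AE w in completion \<nu>. \<beta> w 0 = 0"
    using family by (simp add: perturbation_family_def brownian_motion_def AE_completion_iff)
  moreover have "{x \<in> space path_space. x 0 = 0} \<in> sets (path_space :: 'n path measure)" by measurable
  ultimately show ?thesis unfolding \<mu>_def by (subst AE_distr_iff[OF beta_measurable])
qed

text \<open>At time 1 the coordinates generate all of \<open>path_space\<close>, and the added null
  sets supply the completion. Equality of the filtrations at this time therefore concerns every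
  event.\<close>

lemma completed_coordinate_sets:
  assumes A: "A \<in> sets (completion \<nu>)"
  shows "A \<in> sets (filtration \<nu> (\<lambda>w. w) 1)"
proof -
  let ?G = "{{w \<in> space \<nu>. w s \<in> A} | s A. s \<in> {0..1} \<and> A \<in> sets borel} \<union> null_sets (completion \<nu>)"
  have sub: "?G \<subseteq> Pow (space \<nu>)"
    using sets.sets_into_space[of _ "completion \<nu>"] by auto
  have F: "sets (filtration \<nu> (\<lambda>w. w) 1) = sigma_sets (space \<nu>) ?G"
    unfolding filtration_def by (rule sets_measure_of[OF sub])
  obtain S N N' where A': "A = S \<union> N" "N \<subseteq> N'" "N' \<in> null_sets \<nu>" "S \<in> sets \<nu>"
    using A by (rule sets_completionE)
  have "N \<in> null_sets (completion \<nu>)"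
    using A'(2,3) null_sets_completion_subset null_sets_completionI by blast
  then have N: "N \<in> sigma_sets (space \<nu>) ?G" by (intro sigma_sets.Basic) simp
  have "S \<in> sigma_sets paths {{w \<in> paths. w t \<in> A} | t A. t \<in> {0..1} \<and> A \<in> sets borel}"
    using A'(4) unfolding sets_nu path_space_def by (subst (asm) sets_measure_of) auto
  then have "S \<in> sigma_sets (space \<nu>) ?G"
    unfolding space_nu by (rule subsetD[OF sigma_sets_mono', rotated]) blast
  then have "S \<union> N \<in> sigma_sets (space \<nu>) ?G" using N by (rule sigma_sets_Un)
  then show ?thesis unfolding F A'(1) .
qed

text \<open>The Doob-Dynkin factorisation modulo null sets. The events that agree almost surely with
  a condition on \<beta> form a sigma-algebra, which contains the generators of the completed
  filtration of \<beta>.\<close>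

lemma sets_via_beta:
  assumes A: "A \<in> sets (completion \<nu>)"
  shows "\<exists>B\<in>sets path_space. AE w in \<nu>. w \<in> A \<longleftrightarrow> \<beta> w \<in> B"
proof -
  let ?G = "{{w \<in> space \<nu>. \<beta> w s \<in> A} | s A. s \<in> {0..1} \<and> A \<in> sets borel} \<union> null_sets (completion \<nu>)"
  have sub: "?G \<subseteq> Pow (space \<nu>)"
    using sets.sets_into_space[of _ "completion \<nu>"] by auto
  have "sets (filtration \<nu> \<beta> 1) = sets (filtration \<nu> (\<lambda>w. w) 1)"
    using family by (simp add: perturbation_family_def)
  moreover have "sets (filtration \<nu> \<beta> 1) = sigma_sets (space \<nu>) ?G"
    unfolding filtration_def by (rule sets_measure_of[OF sub])
  ultimately have "A \<in> sigma_sets (space \<nu>) ?G" using completed_coordinate_sets[OF A] by (simp only:)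
  then show ?thesis
  proof (induction rule: sigma_sets.induct)
    case (Basic a)
    then show ?case
    proof (rule UnE)
      assume "a \<in> {{w \<in> space \<nu>. \<beta> w s \<in> A} | s A. s \<in> {0..1} \<and> A \<in> sets borel}"
      then obtain s A where a: "a = {w \<in> space \<nu>. \<beta> w s \<in> A}" and A: "A \<in> sets borel"
        unfolding mem_Collect_eq by (elim exE conjE) (rule that)
      have "AE w in \<nu>. w \<in> a \<longleftrightarrow> \<beta> w \<in> (\<lambda>x. x s) -` A \<inter> space path_space"
      proof (rule AE_I2)
        fix w assume w: "w \<in> space \<nu>"
        then have "\<beta> w \<in> space path_space" using measurable_space[OF beta_measurable, of w] by simp
        then show "w \<in> a \<longleftrightarrow> \<beta> w \<in> (\<lambda>x. x s) -` A \<inter> space path_space" using w by (simp add: a)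
      qed
      then show ?thesis by (rule bexI) (rule measurable_sets[OF measurable_path_eval A])
    next
      assume "a \<in> null_sets (completion \<nu>)"
      \<comment> \<open>For the second kind of generator, the null sets, the empty set of Brownian
        paths serves as \<open>B\<close>.\<close>
      then have "AE w in \<nu>. w \<notin> a"
        by (rule AE_completion_iff[THEN iffD1, OF AE_not_in])
      then have "AE w in \<nu>. w \<in> a \<longleftrightarrow> \<beta> w \<in> {}" by eventually_elim simp
      then show ?thesis by (rule bexI) (rule sets.empty_sets)
    qed
  next
    case Empty
    have "AE w in \<nu>. w \<in> {} \<longleftrightarrow> \<beta> w \<in> {}" by simp
    then show ?case by (rule bexI) (rule sets.empty_sets)
  next
    case (Compl a)
    from Compl.IH obtain B where B: "B \<in> sets path_space" "AE w in \<nu>. w \<in> a \<longleftrightarrow> \<beta> w \<in> B" ..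
    from B(2) AE_space have "AE w in \<nu>. w \<in> space \<nu> - a \<longleftrightarrow> \<beta> w \<in> space path_space - B"
    proof eventually_elim
      case (elim w)
      then have "\<beta> w \<in> space path_space" using measurable_space[OF beta_measurable, of w] by simp
      then show ?case using elim by simp
    qed
    then show ?case by (rule bexI) (rule sets.compl_sets[OF B(1)])
  next
    case (Union a)
    have "\<forall>i. \<exists>B. B \<in> sets path_space \<and> (AE w in \<nu>. w \<in> a i \<longleftrightarrow> \<beta> w \<in> B)"
      using Union.IH unfolding Bex_def by (rule allI)
    from choice[OF this] obtain B where B': "\<forall>i. B i \<in> sets path_space \<and> (AE w in \<nu>. w \<in> a i \<longleftrightarrow> \<beta> w \<in> B i)" ..
    note B = B'[THEN spec, THEN conjunct1] B'[THEN spec, THEN conjunct2]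
    have "AE w in \<nu>. \<forall>i. w \<in> a i \<longleftrightarrow> \<beta> w \<in> B i" unfolding AE_all_countable by (intro allI B(2))
    then have "AE w in \<nu>. w \<in> (\<Union>i. a i) \<longleftrightarrow> \<beta> w \<in> (\<Union>i. B i)" by eventually_elim simp
    then show ?case by (rule bexI) (intro sets.countable_UN image_subsetI B(1))
  qed
qed

lemma function_via_beta:
  fixes f :: "'n path \<Rightarrow> ennreal"
  assumes "f \<in> borel_measurable (completion \<nu>)"
  shows "\<exists>F\<in>borel_measurable path_space. AE w in \<nu>. f w = F (\<beta> w)"
  using assms
proof (induction rule: borel_measurable_induct)
  case (cong f g)
  from cong.IH obtain F where F: "F \<in> borel_measurable path_space" "AE w in \<nu>. g w = F (\<beta> w)" ..
  from F(2) AE_space have "AE w in \<nu>. f w = F (\<beta> w)"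
  proof eventually_elim
    case (elim w)
    then show ?case using cong.hyps(3)[of w] by simp
  qed
  then show ?case using F(1) by (rule bexI)
next
  case (set A)
  from sets_via_beta[OF this] obtain B where B: "B \<in> sets path_space" "AE w in \<nu>. w \<in> A \<longleftrightarrow> \<beta> w \<in> B" ..
  from B(2) have "AE w in \<nu>. indicator A w = (indicator B (\<beta> w) :: ennreal)"
    by eventually_elim (simp add: indicator_def)
  then show ?case using borel_measurable_indicator[OF B(1)] by (rule bexI)
next
  case (mult u c)
  from mult.IH obtain F where F: "F \<in> borel_measurable path_space" "AE w in \<nu>. u w = F (\<beta> w)" ..
  from F(2) have "AE w in \<nu>. c * u w = c * F (\<beta> w)" by eventually_elim simp
  then show ?case
    by (rule bexI[where x = "\<lambda>x. c * F x"]) (intro borel_measurable_times_ennreal borel_measurable_const F(1))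
next
  case (add u v)
  from add.IH(1) obtain F where F: "F \<in> borel_measurable path_space" "AE w in \<nu>. u w = F (\<beta> w)" ..
  from add.IH(2) obtain G where G: "G \<in> borel_measurable path_space" "AE w in \<nu>. v w = G (\<beta> w)" ..
  from F(2) G(2) have "AE w in \<nu>. v w + u w = G (\<beta> w) + F (\<beta> w)" by eventually_elim simp
  then show ?case
    by (rule bexI[where x = "\<lambda>x. G x + F x"]) (intro borel_measurable_add F(1) G(1))
next
  case (seq U)
  have "\<forall>i. \<exists>F. F \<in> borel_measurable path_space \<and> (AE w in \<nu>. U i w = F (\<beta> w))"
    using seq.IH unfolding Bex_def by (rule allI)
  from choice[OF this] obtain F where F': "\<forall>i. F i \<in> borel_measurable path_space \<and> (AE w in \<nu>. U i w = F i (\<beta> w))" ..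
  note F = F'[THEN spec, THEN conjunct1] F'[THEN spec, THEN conjunct2]
  have "AE w in \<nu>. \<forall>i. U i w = F i (\<beta> w)" unfolding AE_all_countable by (intro allI F(2))
  then have "AE w in \<nu>. (SUP i. U i) w = (SUP i. F i (\<beta> w))" by eventually_elim (simp add: image_image)
  then show ?case
    by (rule bexI[where x = "\<lambda>x. SUP i. F i x"]) (intro borel_measurable_SUP F(1) countableI_type)
qed

end

section \<open>Deterministic step drifts: Girsanov weight and translation\<close>

locale wiener_grid = perturbed_wiener \<nu> \<beta> W + time_grid m \<tau>
  for \<nu> :: "('n::finite) path measure" and \<beta> W m \<tau>
begin

lemma coord_measurable: "coord j \<in> borel_measurable (path_space :: 'n path measure)"
proof -
  have "(\<lambda>v :: real ^ 'n. v $ k) \<in> borel_measurable borel" for k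
    by (intro borel_measurable_continuous_onI continuous_intros)
  from measurable_compose[OF measurable_path_eval this]
  have "(\<lambda>x. x s $ k) \<in> borel_measurable (path_space :: 'n path measure)" for s k .
  then show ?thesis
    unfolding coord_def by (intro borel_measurable_divide borel_measurable_diff borel_measurable_const)
qed

lemma coord_beta_measurable: "(\<lambda>w. \<Sum>j\<in>idx. c j * coord j (\<beta> w)) \<in> borel_measurable (completion \<nu>)"
  by (intro borel_measurable_sum borel_measurable_times borel_measurable_const
      measurable_compose[OF beta_measurable coord_measurable])

lemma ito_step: "has_ito_integral \<nu> \<beta> (\<lambda>_. step_path c) (\<lambda>w. \<Sum>j\<in>idx. c j * coord j (\<beta> w))"
proof -
  define \<xi> :: "nat \<Rightarrow> 'n path \<Rightarrow> real ^ 'n" where "\<xi> = (\<lambda>i _. \<Sum>k\<in>UNIV. (c (i, k) / sqrt (\<Delta> i)) *\<^sub>R axis k 1)"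
  have 1: "adapted_density \<nu> (\<lambda>_. step_path c) (\<lambda>_. step_dens c)"
    unfolding adapted_density_def
  proof (intro conjI ballI)
    have "(\<lambda>x. step_dens c (snd x)) \<in> borel_measurable (completion \<nu> \<Otimes>\<^sub>M unit_time)"
      by (rule measurable_compose[OF measurable_snd measurable_unit_time[OF step_dens_measurable]])
    then show "case_prod (\<lambda>_. step_dens c) \<in> borel_measurable (completion \<nu> \<Otimes>\<^sub>M unit_time)"
      by (simp add: case_prod_unfold)
    show "(\<lambda>w. step_dens c s) \<in> borel_measurable (filtration \<nu> (\<lambda>w. w) s)" for s by simp
    show "AE w in \<nu>. is_density (step_path c) (step_dens c)" by (intro AE_I2 is_density_step)
  qed
  have "\<forall>i<m. \<tau> i \<le> \<tau> (Suc i)" using tau_step less_imp_le by blast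
  moreover have "\<xi> i \<in> borel_measurable (filtration \<nu> (\<lambda>w. w) (\<tau> i)) \<and> (\<exists>C. \<forall>w\<in>space \<nu>. norm (\<xi> i w) \<le> C)" for i
    unfolding \<xi>_def by (intro conjI borel_measurable_const ballI order_refl
        exI[where x = "norm (\<Sum>k\<in>UNIV. (c (i, k) / sqrt (\<Delta> i)) *\<^sub>R (axis k 1 :: real ^ 'n))"])
  ultimately have 2: "simple_integrand \<nu> m \<tau> \<xi>"
    unfolding simple_integrand_def using tau_0 tau_m by simp
  have "(\<integral>\<^sup>+x. ennreal ((norm (case_prod (\<lambda>_. step_dens c) x - case_prod (simple_process m \<tau> \<xi>) x))\<^sup>2)
      \<partial>(completion \<nu> \<Otimes>\<^sub>M unit_time)) = (\<integral>\<^sup>+x. 0 \<partial>(completion \<nu> \<Otimes>\<^sub>M unit_time))"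
    by (rule nn_integral_cong) (simp add: case_prod_unfold \<xi>_def simple_process_step)
  then have 3: "(\<integral>\<^sup>+x. ennreal ((norm (case_prod (\<lambda>_. step_dens c) x - case_prod (simple_process m \<tau> \<xi>) x))\<^sup>2)
      \<partial>(completion \<nu> \<Otimes>\<^sub>M unit_time)) = 0" by simp
  have 4: "(\<integral>\<^sup>+w. ennreal (((\<Sum>j\<in>idx. c j * coord j (\<beta> w)) - simple_integral \<beta> m \<tau> \<xi> w)\<^sup>2) \<partial>completion \<nu>) = 0"
    unfolding \<xi>_def simple_integral_step by simp
  show ?thesis unfolding has_ito_integral_def
  proof (intro conjI exI allI)
    show "adapted_density \<nu> (\<lambda>_. step_path c) (\<lambda>_. step_dens c)" by (rule 1)
    show "simple_integrand \<nu> ((\<lambda>_. m) k) ((\<lambda>_. \<tau>) k) ((\<lambda>_. \<xi>) k)" for k :: nat using 2 .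
    show "(\<lambda>k. \<integral>\<^sup>+x. ennreal ((norm (case_prod (\<lambda>_. step_dens c) x - case_prod (simple_process ((\<lambda>_. m) k) ((\<lambda>_. \<tau>) k) ((\<lambda>_. \<xi>) k)) x))\<^sup>2)
           \<partial>(completion \<nu> \<Otimes>\<^sub>M unit_time)) \<longlonglongrightarrow> 0" unfolding 3 by (rule tendsto_const)
    show "(\<lambda>k. \<integral>\<^sup>+w. ennreal (((\<Sum>j\<in>idx. c j * coord j (\<beta> w)) - simple_integral \<beta> ((\<lambda>_. m) k) ((\<lambda>_. \<tau>) k) ((\<lambda>_. \<xi>) k) w)\<^sup>2)
           \<partial>completion \<nu>) \<longlonglongrightarrow> 0" unfolding 4 by (rule tendsto_const)
  qed (rule coord_beta_measurable)
qed

text \<open>The Girsanov density of the step drift as a function of the Brownian path; by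
  orthonormality the squared Cameron-Martin norm is the sum of the squared coefficients.\<close>

definition shift_weight :: "(nat \<times> 'n \<Rightarrow> real) \<Rightarrow> 'n path \<Rightarrow> ennreal" where
  "shift_weight c x = ennreal (exp (- (\<Sum>j\<in>idx. c j * coord j x) - (\<Sum>j\<in>idx. (c j)\<^sup>2) / 2))"

lemma shift_weight_measurable: "shift_weight c \<in> borel_measurable path_space"
proof -
  have "(\<lambda>x. \<Sum>j\<in>idx. c j * coord j x) \<in> borel_measurable (path_space :: 'n path measure)"
    by (intro borel_measurable_sum borel_measurable_times borel_measurable_const coord_measurable)
  then show ?thesis unfolding shift_weight_def by measurable
qed

lemma shift_weight_beta_measurable: "(\<lambda>w. shift_weight c (\<beta> w)) \<in> borel_measurable (completion \<nu>)"
  by (rule measurable_compose[OF beta_measurable shift_weight_measurable])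

lemma W_step_measurable: "W (\<lambda>_. step_path c) \<in> measurable (completion \<nu>) path_space"
  by (rule W_measurable[OF const_drift[OF step_path_bounded]])

lemma W_step_law:
  "distr (density (completion \<nu>) (\<lambda>w. shift_weight c (\<beta> w))) path_space (W (\<lambda>_. step_path c)) = \<nu>"
proof -
  have "\<forall>u\<in>drifts \<nu>. \<forall>X. has_ito_integral \<nu> \<beta> u X \<longrightarrow>
        distr (density (completion \<nu>) (\<lambda>w. ennreal (exp (- X w - CM_normsq (u w) / 2)))) path_space (W u) = \<nu>"
    using family by (simp add: perturbation_family_def)
  from this[THEN bspec, OF const_drift[OF step_path_bounded], THEN spec, THEN mp, OF ito_step]
  show ?thesis unfolding CM_normsq_step shift_weight_def .
qed

text \<open>Under the tilted measure the perturbed process has law \<nu>, and the tilting density is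
  strictly positive; so a \<nu>-null event stays null after composition with
  \<open>W\<close>.\<close>

lemma AE_W_step:
  assumes "AE w in \<nu>. P w"
  shows "AE w in \<nu>. P (W (\<lambda>_. step_path c) w)"
proof -
  let ?D = "density (completion \<nu>) (\<lambda>w. shift_weight c (\<beta> w))"
  have m: "W (\<lambda>_. step_path c) \<in> measurable ?D path_space"
    using W_step_measurable by simp
  have "AE w in distr ?D path_space (W (\<lambda>_. step_path c)). P w"
    using assms by (simp only: W_step_law)
  from AE_distrD[OF m this] have "AE w in ?D. P (W (\<lambda>_. step_path c) w)" .
  then have "AE w in completion \<nu>. 0 < shift_weight c (\<beta> w) \<longrightarrow> P (W (\<lambda>_. step_path c) w)"
    by (simp only: AE_density[OF shift_weight_beta_measurable])
  then have "AE w in completion \<nu>. P (W (\<lambda>_. step_path c) w)"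
    by eventually_elim (simp add: shift_weight_def)
  then show ?thesis by (rule AE_completion_iff[THEN iffD1])
qed

text \<open>Here the abstract perturbation becomes a translation: the identity
  \<open>f = F \<circ> \<beta>\<close> may be evaluated along the perturbed path, where \<beta> has
  gained the step path.\<close>

lemma function_W_step:
  assumes "AE w in \<nu>. f w = F (\<beta> w)"
  shows "AE w in \<nu>. f (W (\<lambda>_. step_path c) w) = F (\<lambda>s. \<beta> w s + step_path c s)"
  using AE_W_step[OF assms, of c] beta_W[OF step_path_bounded, of c]
  by eventually_elim simp

text \<open>A change of variables: the translated path is \<beta> evaluated along \<open>W\<close>,
  the weight is the tilting density, and under the tilted measure \<open>W\<close> has law
  \<nu>.\<close>

lemma cameron_martin_step:
  assumes F: "F \<in> borel_measurable path_space"
  shows "(\<integral>\<^sup>+x. F (\<lambda>s. x s + step_path c s) * shift_weight c x \<partial>\<mu>) = (\<integral>\<^sup>+x. F x \<partial>\<mu>)"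
proof -
  have add_m: "(\<lambda>x s. x s + step_path c s) \<in> measurable path_space path_space"
  proof (rule measurable_path_spaceI)
    show "(\<lambda>s. x s + step_path c s) \<in> paths" if "x \<in> space path_space" for x
      using that step_path_paths[of c] by (auto simp: space_path_space paths_def intro!: continuous_intros)
    show "(\<lambda>x. x s + step_path c s) \<in> borel_measurable path_space" for s
      by (intro borel_measurable_add measurable_path_eval borel_measurable_const)
  qed
  have Fb: "(\<lambda>w. F (\<beta> w)) \<in> borel_measurable (completion \<nu>)"
    by (rule measurable_compose[OF beta_measurable F])
  \<comment> \<open>\<open>F \<circ> \<beta>\<close> is measurable only for the completion, whereas
    the law of \<open>W\<close> is a measure on \<open>path_space\<close>; hence a version
    \<open>G\<close> measurable without completion is carried through the change of
    variables.\<close>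
  obtain G where G: "G \<in> borel_measurable \<nu>" "AE w in \<nu>. F (\<beta> w) = G w"
    using completion_ex_borel_measurable[OF Fb] by (rule bexE)
  have Gp: "G \<in> borel_measurable path_space"
    using G(1) measurable_cong_sets[OF sets_nu refl] by (rule subst[rotated])
  have AE: "AE w in completion \<nu>. F (\<lambda>s. \<beta> w s + step_path c s) = G (W (\<lambda>_. step_path c) w)"
  proof (rule AE_completion)
    show "AE w in \<nu>. F (\<lambda>s. \<beta> w s + step_path c s) = G (W (\<lambda>_. step_path c) w)"
      using AE_W_step[OF G(2), of c] beta_W[OF step_path_bounded, of c]
      by eventually_elim simp
  qed
  let ?D = "density (completion \<nu>) (\<lambda>w. shift_weight c (\<beta> w))"
  have m: "W (\<lambda>_. step_path c) \<in> measurable ?D path_space"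
    using W_step_measurable by simp
  have "(\<integral>\<^sup>+x. F (\<lambda>s. x s + step_path c s) * shift_weight c x \<partial>\<mu>)
      = (\<integral>\<^sup>+w. F (\<lambda>s. \<beta> w s + step_path c s) * shift_weight c (\<beta> w) \<partial>completion \<nu>)"
    unfolding \<mu>_def by (rule nn_integral_distr[OF beta_measurable])
      (simp only: measurable_distr_eq1, intro borel_measurable_times_ennreal measurable_compose[OF add_m F] shift_weight_measurable)
  also have "\<dots> = (\<integral>\<^sup>+w. shift_weight c (\<beta> w) * G (W (\<lambda>_. step_path c) w) \<partial>completion \<nu>)"
  proof (rule nn_integral_cong_AE)
    show "AE w in completion \<nu>. F (\<lambda>s. \<beta> w s + step_path c s) * shift_weight c (\<beta> w)
      = shift_weight c (\<beta> w) * G (W (\<lambda>_. step_path c) w)"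
      using AE by eventually_elim (simp add: mult.commute)
  qed
  also have "\<dots> = (\<integral>\<^sup>+w. G (W (\<lambda>_. step_path c) w) \<partial>?D)"
    by (rule nn_integral_density[symmetric, OF shift_weight_beta_measurable measurable_compose[OF W_step_measurable Gp]])
  also have "\<dots> = (\<integral>\<^sup>+w. G w \<partial>distr ?D path_space (W (\<lambda>_. step_path c)))"
    by (rule nn_integral_distr[symmetric, OF m]) (simp only: measurable_distr_eq1 Gp)
  also have "\<dots> = (\<integral>\<^sup>+w. G w \<partial>\<nu>)" unfolding W_step_law ..
  also have "\<dots> = (\<integral>\<^sup>+w. F (\<beta> w) \<partial>\<nu>)"
    by (rule nn_integral_cong_AE) (use G(2) in eventually_elim, simp)
  also have "\<dots> = (\<integral>\<^sup>+w. F (\<beta> w) \<partial>completion \<nu>)" by (simp only: nn_integral_completion)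
  also have "\<dots> = (\<integral>\<^sup>+x. F x \<partial>\<mu>)"
    unfolding \<mu>_def by (rule nn_integral_distr[symmetric, OF beta_measurable]) (simp only: measurable_distr_eq1 F)
  finally show ?thesis .
qed

lemma single_direction:
  fixes r :: real
  assumes j: "j \<in> idx"
  defines "c \<equiv> \<lambda>i. if i = j then r else 0"
  shows "step_path c = (\<lambda>s. r *\<^sub>R dir j s)"
    and "shift_weight c x = ennreal (exp (- r * coord j x - r\<^sup>2 / 2))"
proof -
  have *: "(\<Sum>i\<in>idx. f i (c i)) = f j r" if "\<And>i. f i 0 = 0" for f :: "nat \<times> 'n \<Rightarrow> real \<Rightarrow> 'b::real_normed_vector"
  proof -
    have "(\<Sum>i\<in>idx. f i (c i)) = (\<Sum>i\<in>idx. if i = j then f j r else 0)"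
      by (rule sum.cong) (simp_all add: c_def that)
    then show ?thesis using j by (simp add: sum.delta finite_idx)
  qed
  show "step_path c = (\<lambda>s. r *\<^sub>R dir j s)"
    unfolding step_path_def using *[of "\<lambda>i y. y *\<^sub>R dir i _"] by (intro ext) simp
  show "shift_weight c x = ennreal (exp (- r * coord j x - r\<^sup>2 / 2))"
    unfolding shift_weight_def using *[of "\<lambda>i y. y * coord i x"] *[of "\<lambda>i y. y\<^sup>2"] by simp
qed

lemma cm_coordinates: "cm_coordinates \<mu> idx dir coord (\<tau> ` {..m})"
proof (intro cm_coordinates.intro cm_coordinates_axioms.intro)
  show "prob_space \<mu>" by (rule prob_mu)
  show "sets \<mu> = sets path_space" by (rule sets_mu)
  show "finite idx" by (rule finite_idx)
  show "dir j \<in> paths" if "j \<in> idx" for j :: "nat \<times> 'n" using that by (rule dir_paths)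
  show "coord j \<in> borel_measurable path_space" if "j \<in> idx" for j :: "nat \<times> 'n" by (rule coord_measurable)
  show "coord j (\<lambda>s. x s + r *\<^sub>R dir i s) = coord j x + (if i = j then r else 0)"
    if "i \<in> idx" "j \<in> idx" "x \<in> paths" for i j :: "nat \<times> 'n" and x r
    using that(1,2) by (rule coord_shift)
  show "(\<integral>\<^sup>+x. F (\<lambda>s. x s + r *\<^sub>R dir j s) * ennreal (exp (- r * coord j x - r\<^sup>2 / 2)) \<partial>\<mu>) = (\<integral>\<^sup>+x. F x \<partial>\<mu>)"
    if "j \<in> idx" "F \<in> borel_measurable path_space" for j :: "nat \<times> 'n" and F r
    using cameron_martin_step[OF that(2), of "\<lambda>i. if i = j then r else 0"]
    unfolding single_direction[OF that(1)] .
  show "coord j x = coord j y" if "j \<in> idx" "x \<in> paths" "y \<in> paths" "\<And>s. s \<in> \<tau> ` {..m} \<Longrightarrow> x s = y s"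
    for j :: "nat \<times> 'n" and x y using that(1,4) by (rule coord_local)
  show "(\<Sum>j\<in>idx. coord j x *\<^sub>R dir j s) = x s" if "x \<in> paths" "x 0 = 0" "s \<in> \<tau> ` {..m}" for x :: "'n path" and s
    using that(2,3) by (rule coord_determines)
  show "AE x in \<mu>. x 0 = 0" by (rule beta_start)
qed

sublocale cm: cm_coordinates \<mu> idx dir coord "\<tau> ` {..m}"
  by (rule cm_coordinates)

text \<open>Moves the hypothesis from the perturbed processes under \<nu> to translations under the
  law of \<beta>, where resampling takes place.\<close>

lemma PL_hyp_transfer:
  assumes m: "P \<in> borel_measurable path_space" "Q \<in> borel_measurable path_space" "R \<in> borel_measurable path_space"
    and rep: "AE w in \<nu>. p w = P (\<beta> w)" "AE w in \<nu>. q w = Q (\<beta> w)" "AE w in \<nu>. r w = R (\<beta> w)"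
    and hyp: "\<And>c c'. AE w in \<nu>. ennreal (enn2real (q (W (\<lambda>_. step_path c) w)) powr t * enn2real (r (W (\<lambda>_. step_path c') w)) powr (1 - t)
       * exp (- t * (1 - t) * (\<Sum>j\<in>idx. (c j - c' j)\<^sup>2) / 2)) \<le> p (W (\<lambda>_. step_path (\<lambda>j. t * c j + (1 - t) * c' j)) w)"
  shows "cm.PL_hyp t P Q R"
  unfolding cm.PL_hyp_def
proof (intro allI)
  fix c c' :: "nat \<times> 'n \<Rightarrow> real"
  define E where "E = exp (- t * (1 - t) * (\<Sum>j\<in>idx. (c j - c' j)\<^sup>2) / 2)"
  define d where "d = (\<lambda>j. t * c j + (1 - t) * c' j)"
  have mv: "cm.move b x = (\<lambda>s. x s + step_path b s)" for b x
    by (simp add: cm.move_def step_path_def)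
  have mm: "(\<lambda>x. H (cm.move b x)) \<in> borel_measurable path_space" if "H \<in> borel_measurable path_space" for H :: "'n path \<Rightarrow> ennreal" and b
    by (rule measurable_compose[OF cm.measurable_move[OF measurable_ident_sets[OF refl]] that])
  \<comment> \<open>Passing from \<nu> to the law of \<beta> requires the event itself to be
    measurable in \<open>path_space\<close>.\<close>
  have "(\<lambda>x. ennreal (enn2real (Q (cm.move c x)) powr t * enn2real (R (cm.move c' x)) powr (1 - t) * E)) \<in> borel_measurable path_space"
    by (rule measurable_compose[OF borel_measurable_times[OF borel_measurable_times[OF
          powr_real_measurable[OF measurable_compose[OF mm[OF m(2)] borel_measurable_enn2real[OF measurable_ident_sets[OF refl]]] borel_measurable_const]
          powr_real_measurable[OF measurable_compose[OF mm[OF m(3)] borel_measurable_enn2real[OF measurable_ident_sets[OF refl]]] borel_measurable_const]]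
          borel_measurable_const] measurable_ennreal])
  from borel_measurable_le[OF this mm[OF m(1)]]
  have sets: "{x \<in> space path_space. ennreal (enn2real (Q (cm.move c x)) powr t * enn2real (R (cm.move c' x)) powr (1 - t) * E) \<le> P (cm.move d x)} \<in> sets path_space" .
  have "AE w in \<nu>. ennreal (enn2real (Q (cm.move c (\<beta> w))) powr t * enn2real (R (cm.move c' (\<beta> w))) powr (1 - t) * E) \<le> P (cm.move d (\<beta> w))"
    using hyp[of c c', folded E_def d_def] function_W_step[OF rep(1), of d] function_W_step[OF rep(2), of c] function_W_step[OF rep(3), of c']
    unfolding mv
  proof eventually_elim
    case (elim w)
    show ?case using elim(1) unfolding elim(2-4) .
  qed
  then have "AE w in completion \<nu>. ennreal (enn2real (Q (cm.move c (\<beta> w))) powr t * enn2real (R (cm.move c' (\<beta> w))) powr (1 - t) * E) \<le> P (cm.move d (\<beta> w))"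
    by (rule AE_completion)
  then show "AE x in \<mu>. ennreal (enn2real (Q (cm.move c x)) powr t * enn2real (R (cm.move c' x)) powr (1 - t)
      * exp (- t * (1 - t) * (\<Sum>j\<in>idx. (c j - c' j)\<^sup>2) / 2)) \<le> P (cm.move (\<lambda>j. t * c j + (1 - t) * c' j) x)"
    unfolding E_def[symmetric] d_def[symmetric] \<mu>_def AE_distr_iff[OF beta_measurable sets] .
qed

end

subsection \<open>Approximation by cylinder functions\<close>

definition cylinder :: "real set \<Rightarrow> ('n::finite) path set \<Rightarrow> bool" where
  "cylinder T B \<longleftrightarrow> (\<forall>x\<in>paths. \<forall>y\<in>paths. (\<forall>s\<in>T. x s = y s) \<longrightarrow> (x \<in> B \<longleftrightarrow> y \<in> B))"

definition depends_on :: "real set \<Rightarrow> (('n::finite) path \<Rightarrow> ennreal) \<Rightarrow> bool" where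
  "depends_on T f \<longleftrightarrow> (\<forall>x\<in>paths. \<forall>y\<in>paths. (\<forall>s\<in>T. x s = y s) \<longrightarrow> f x = f y)"

lemma cylinderD:
  assumes "cylinder T B" and "x \<in> paths" "y \<in> paths" "\<forall>s\<in>T. x s = y s"
  shows "x \<in> B \<longleftrightarrow> y \<in> B"
  using assms(1)[unfolded cylinder_def, THEN bspec, OF assms(2), THEN bspec, OF assms(3), THEN mp, OF assms(4)] .

lemma cylinder_Int:
  fixes B C :: "('n::finite) path set"
  assumes "cylinder T B" "cylinder T C"
  shows "cylinder T (B \<inter> C)"
  unfolding cylinder_def Int_iff
proof (intro ballI impI)
  fix x y :: "'n path" assume *: "x \<in> paths" "y \<in> paths" "\<forall>s\<in>T. x s = y s"
  show "(x \<in> B \<and> x \<in> C) = (y \<in> B \<and> y \<in> C)"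
    by (simp only: cylinderD[OF assms(1) *] cylinderD[OF assms(2) *])
qed

lemma cylinder_compl:
  fixes B :: "('n::finite) path set"
  assumes "cylinder T B"
  shows "cylinder T (paths - B)"
  unfolding cylinder_def Diff_iff
proof (intro ballI impI)
  fix x y :: "'n path" assume *: "x \<in> paths" "y \<in> paths" "\<forall>s\<in>T. x s = y s"
  show "(x \<in> paths \<and> x \<notin> B) = (y \<in> paths \<and> y \<notin> B)"
    by (simp only: cylinderD[OF assms *] *(1,2))
qed

lemma depends_on_mono: "depends_on T f \<Longrightarrow> T \<subseteq> T' \<Longrightarrow> depends_on T' f"
  unfolding depends_on_def by (meson subsetD)

lemma cylinder_mono: "cylinder T B \<Longrightarrow> T \<subseteq> T' \<Longrightarrow> cylinder T' B"
  unfolding cylinder_def by (meson subsetD)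

lemma sets_path_space_cylinders:
  "sets (path_space :: ('n::finite) path measure)
   = sigma_sets paths {B \<in> sets path_space. \<exists>T. finite T \<and> T \<subseteq> {0..1} \<and> cylinder T B}"
proof (rule equalityI)
  let ?G = "{{w \<in> paths. w t \<in> A} | t A. t \<in> {0..1} \<and> A \<in> sets borel} :: 'n path set set"
  have e: "sets path_space = sigma_sets paths ?G"
    unfolding path_space_def by (rule sets_measure_of) blast
  have "?G \<subseteq> {B \<in> sets path_space. \<exists>T. finite T \<and> T \<subseteq> {0..1} \<and> cylinder T B}"
  proof
    fix B assume B: "B \<in> ?G"
    then obtain t A where tA: "B = {w \<in> paths. w t \<in> A}" "t \<in> {0..1}"
      unfolding mem_Collect_eq by (elim exE conjE) (rule that)
    have "cylinder {t} B" unfolding cylinder_def tA(1) by simp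
    moreover have "B \<in> sets path_space" unfolding e using B by (rule sigma_sets.Basic)
    ultimately show "B \<in> {B \<in> sets path_space. \<exists>T. finite T \<and> T \<subseteq> {0..1} \<and> cylinder T B}"
      using tA(2) by (intro CollectI conjI exI[where x = "{t}"]) simp_all
  qed
  from sigma_sets_mono'[OF this, of paths]
  show "sets path_space \<subseteq> sigma_sets paths {B \<in> sets (path_space :: 'n path measure). \<exists>T. finite T \<and> T \<subseteq> {0..1} \<and> cylinder T B}"
    unfolding e[symmetric] .
  show "sigma_sets paths {B \<in> sets path_space. \<exists>T. finite T \<and> T \<subseteq> {0..1} \<and> cylinder T B} \<subseteq> sets (path_space :: 'n path measure)"
    using sets.sigma_sets_subset[of "{B \<in> sets path_space. \<exists>T. finite T \<and> T \<subseteq> {0..1} \<and> cylinder T B}" "path_space :: 'n path measure"]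
    by (simp only: space_path_space, blast)
qed

text \<open>The events that cylinder events approximate to any accuracy are closed under complements
  and countable unions, and the cylinder events generate \<open>path_space\<close>.\<close>

lemma cylinder_dense:
  fixes A :: "('n::finite) path set"
  assumes prob: "prob_space \<mu>" and sets: "sets \<mu> = sets path_space" and A: "A \<in> sets path_space" and \<epsilon>: "\<epsilon> > 0"
  shows "\<exists>T B. finite T \<and> T \<subseteq> {0..1} \<and> B \<in> sets path_space \<and> cylinder T B \<and> measure \<mu> ((A - B) \<union> (B - A)) < \<epsilon>"
proof -
  interpret mu: prob_space \<mu> by (rule prob)
  let ?G = "{B \<in> sets path_space. \<exists>T. finite T \<and> T \<subseteq> {0..1} \<and> cylinder T B} :: 'n path set set"
  let ?P = "\<lambda>A. \<forall>\<epsilon>>0. \<exists>T B. finite T \<and> T \<subseteq> {0..1} \<and> B \<in> sets path_space \<and> cylinder T B \<and> measure \<mu> ((A - B) \<union> (B - A)) < \<epsilon>"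
  have "?P A"
  proof (rule sigma_sets_induct_disjoint[where G = ?G and \<Omega> = paths and A = A and P = ?P])
    show "Int_stable ?G"
    proof (rule Int_stableI)
      fix B C :: "'n path set" assume B: "B \<in> ?G" and C: "C \<in> ?G"
      from B obtain T where T: "finite T" "T \<subseteq> {0..1}" "cylinder T B"
        unfolding mem_Collect_eq by (elim exE conjE) (rule that)
      from C obtain U where U: "finite U" "U \<subseteq> {0..1}" "cylinder U C"
        unfolding mem_Collect_eq by (elim exE conjE) (rule that)
      have "cylinder (T \<union> U) B" "cylinder (T \<union> U) C" by (rule cylinder_mono[OF T(3)], simp) (rule cylinder_mono[OF U(3)], simp)
      then have "cylinder (T \<union> U) (B \<inter> C)" by (rule cylinder_Int)
      moreover have "B \<inter> C \<in> sets path_space" using B C by (intro sets.Int) simp_all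
      ultimately show "B \<inter> C \<in> ?G" using T U by (intro CollectI conjI exI[where x = "T \<union> U"]) simp_all
    qed
    show "?G \<subseteq> Pow paths" using sets.space_closed[of "path_space :: 'n path measure"] unfolding space_path_space by blast
    show "A \<in> sigma_sets paths ?G" using A unfolding sets_path_space_cylinders[symmetric] .
    show "?P B" if "B \<in> ?G" for B
    proof (intro allI impI)
      fix \<epsilon> :: real assume "\<epsilon> > 0"
      from that obtain T where "finite T" "T \<subseteq> {0..1}" "cylinder T B" "B \<in> sets path_space"
        unfolding mem_Collect_eq by (elim exE conjE) (rule that)
      then show "\<exists>T B'. finite T \<and> T \<subseteq> {0..1} \<and> B' \<in> sets path_space \<and> cylinder T B' \<and> measure \<mu> ((B - B') \<union> (B' - B)) < \<epsilon>"
        using \<open>\<epsilon> > 0\<close> by (intro exI[where x = T] exI[where x = B] conjI) simp_all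
    qed
    show "?P {}"
    proof (intro allI impI)
      fix \<epsilon> :: real assume "\<epsilon> > 0"
      then show "\<exists>T B. finite T \<and> T \<subseteq> {0..1} \<and> B \<in> sets path_space \<and> cylinder T B \<and> measure \<mu> (({} - B) \<union> (B - {})) < \<epsilon>"
        by (intro exI[where x = "{} :: real set"] exI[where x = "{} :: 'n path set"] conjI)
          (simp_all add: cylinder_def)
    qed
    show "?P (paths - B)" if B: "B \<in> sigma_sets paths ?G" "?P B" for B
    proof (intro allI impI)
      fix \<epsilon> :: real assume "\<epsilon> > 0"
      from B(2)[THEN spec, THEN mp, OF this] obtain T C where C: "finite T" "T \<subseteq> {0..1}" "C \<in> sets path_space" "cylinder T C" "measure \<mu> ((B - C) \<union> (C - B)) < \<epsilon>"
        by (elim exE conjE) (rule that)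
      have "B \<subseteq> paths" "C \<subseteq> paths"
        using B(1)[folded sets_path_space_cylinders, THEN sets.sets_into_space] C(3)[THEN sets.sets_into_space] by (simp_all add: space_path_space)
      then have "((paths - B) - (paths - C)) \<union> ((paths - C) - (paths - B)) = (B - C) \<union> (C - B)" by blast
      then have 1: "measure \<mu> (((paths - B) - (paths - C)) \<union> ((paths - C) - (paths - B))) < \<epsilon>"
        using C(5) by (simp only:)
      have 2: "cylinder T (paths - C)" using C(4) by (rule cylinder_compl)
      have 3: "paths - C \<in> sets path_space" using sets.compl_sets[OF C(3)] by (simp only: space_path_space)
      show "\<exists>T C. finite T \<and> T \<subseteq> {0..1} \<and> C \<in> sets path_space \<and> cylinder T C \<and> measure \<mu> (((paths - B) - C) \<union> (C - (paths - B))) < \<epsilon>"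
        by (intro exI[where x = T] exI[where x = "paths - C"] conjI C(1,2) 1 2 3)
    qed
    show "?P (\<Union>i. A i)" if A: "range A \<subseteq> sigma_sets paths ?G" "\<And>i. ?P (A i)" for A :: "nat \<Rightarrow> 'n path set"
    proof (intro allI impI)
      fix \<epsilon> :: real assume e: "\<epsilon> > 0"
      have Am: "A i \<in> sets \<mu>" for i using A(1) unfolding sets_path_space_cylinders[symmetric] sets by blast
      define U where "U = (\<lambda>n. \<Union>i<n. A i)"
      have Um: "U n \<in> sets \<mu>" for n unfolding U_def using Am by (intro sets.finite_UN) simp_all
      have UU: "(\<Union>n. U n) = (\<Union>i. A i)"
        unfolding U_def by auto
      have "(\<lambda>n. measure \<mu> (U n)) \<longlonglongrightarrow> measure \<mu> (\<Union>n. U n)"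
      proof (rule mu.finite_Lim_measure_incseq)
        show "range U \<subseteq> sets \<mu>" using Um by blast
        show "incseq U" unfolding incseq_def U_def by (intro allI impI UN_mono) auto
      qed
      \<comment> \<open>Half of the error pays for cutting the union to its first \<open>n\<close>
        members; only finitely many times may enter the approximating cylinder.\<close>
      then have "\<forall>\<^sub>F n in sequentially. measure \<mu> (\<Union>i. A i) - \<epsilon> / 2 < measure \<mu> (U n)"
        unfolding UU by (rule order_tendstoD) (use e in simp)
      then obtain n where n: "measure \<mu> (\<Union>i. A i) - \<epsilon> / 2 < measure \<mu> (U n)"
        by (auto simp: eventually_sequentially)
      \<comment> \<open>The other half is shared among \<open>n\<close> members; dividing by
        \<open>n + 1\<close> keeps the quotient meaningful for \<open>n = 0\<close>.\<close>
      have "\<epsilon> / (2 * (n + 1)) > 0" using e by simp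
      note pos = this
      have "\<forall>i. \<exists>TB. finite (fst TB) \<and> fst TB \<subseteq> {0..1} \<and> snd TB \<in> sets path_space \<and> cylinder (fst TB) (snd TB)
          \<and> measure \<mu> ((A i - snd TB) \<union> (snd TB - A i)) < \<epsilon> / (2 * (n + 1))"
      proof
        fix i
        from A(2)[of i, THEN spec, THEN mp, OF pos] obtain T B where
          "finite T \<and> T \<subseteq> {0..1} \<and> B \<in> sets path_space \<and> cylinder T B \<and> measure \<mu> ((A i - B) \<union> (B - A i)) < \<epsilon> / (2 * (n + 1))"
          by (elim exE) (rule that)
        then show "\<exists>TB. finite (fst TB) \<and> fst TB \<subseteq> {0..1} \<and> snd TB \<in> sets path_space \<and> cylinder (fst TB) (snd TB)
          \<and> measure \<mu> ((A i - snd TB) \<union> (snd TB - A i)) < \<epsilon> / (2 * (n + 1))"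
          by (intro exI[where x = "(T, B)"]) (simp only: fst_conv snd_conv)
      qed
      from choice[OF this] obtain TB where TB: "\<forall>i. finite (fst (TB i)) \<and> fst (TB i) \<subseteq> {0..1} \<and> snd (TB i) \<in> sets path_space \<and> cylinder (fst (TB i)) (snd (TB i))
          \<and> measure \<mu> ((A i - snd (TB i)) \<union> (snd (TB i) - A i)) < \<epsilon> / (2 * (n + 1))" ..
      define T where "T = (\<Union>i<n. fst (TB i))"
      define B where "B = (\<Union>i<n. snd (TB i))"
      define D where "D = (\<lambda>i. (A i - snd (TB i)) \<union> (snd (TB i) - A i))"
      have T: "finite T" "T \<subseteq> {0..1}" unfolding T_def using TB by auto
      have "cylinder T (snd (TB i))" if "i < n" for i
        
      proof (rule cylinder_mono)
        show "cylinder (fst (TB i)) (snd (TB i))" using TB by simp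
        show "fst (TB i) \<subseteq> T" using that by (auto simp: T_def)
      qed
      note ci = this
      have c: "cylinder T B" unfolding cylinder_def
      proof (intro ballI impI)
        fix x y :: "'n path" assume xy: "x \<in> paths" "y \<in> paths" "\<forall>s\<in>T. x s = y s"
        have "x \<in> snd (TB i) \<longleftrightarrow> y \<in> snd (TB i)" if "i < n" for i
          by (rule cylinderD[OF ci[OF that] xy])
        then show "x \<in> B \<longleftrightarrow> y \<in> B" unfolding B_def UN_iff by (rule bex_cong[OF refl]) (simp only: lessThan_iff)
      qed
      have B: "B \<in> sets path_space" unfolding B_def using TB by (intro sets.finite_UN) simp_all
      have Dm: "D i \<in> sets \<mu>" for i unfolding D_def using Am[of i] TB by (intro sets.Un sets.Diff) (simp_all add: sets)
      have UAm: "(\<Union>i. A i) \<in> sets \<mu>" using Am by (intro sets.countable_UN) auto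
      have "((\<Union>i. A i) - B) \<union> (B - (\<Union>i. A i)) \<subseteq> ((\<Union>i. A i) - U n) \<union> (\<Union>i<n. D i)"
        unfolding U_def B_def D_def by auto
      then have "measure \<mu> (((\<Union>i. A i) - B) \<union> (B - (\<Union>i. A i))) \<le> measure \<mu> (((\<Union>i. A i) - U n) \<union> (\<Union>i<n. D i))"
        by (rule mu.finite_measure_mono) (intro sets.Un sets.Diff UAm Um sets.finite_UN Dm finite_lessThan)
      also have "\<dots> \<le> measure \<mu> ((\<Union>i. A i) - U n) + measure \<mu> (\<Union>i<n. D i)"
        by (intro measure_Un_le sets.Diff UAm Um sets.finite_UN Dm finite_lessThan)
      also have "measure \<mu> ((\<Union>i. A i) - U n) = measure \<mu> (\<Union>i. A i) - measure \<mu> (U n)"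
        by (rule mu.finite_measure_Diff[OF UAm Um]) (auto simp: U_def)
      also have "measure \<mu> (\<Union>i<n. D i) \<le> (\<Sum>i<n. measure \<mu> (D i))"
        using Dm by (intro mu.finite_measure_subadditive_finite) auto
      also have "(\<Sum>i<n. measure \<mu> (D i)) \<le> (\<Sum>i<n. \<epsilon> / (2 * (n + 1)))"
        using TB by (intro sum_mono less_imp_le) (simp add: D_def)
      also have "\<dots> \<le> \<epsilon> / 2"
        using e by (simp add: field_simps)
      finally have "measure \<mu> (((\<Union>i. A i) - B) \<union> (B - (\<Union>i. A i))) < \<epsilon>" using n by simp
      then show "\<exists>T B. finite T \<and> T \<subseteq> {0..1} \<and> B \<in> sets path_space \<and> cylinder T B \<and> measure \<mu> (((\<Union>i. A i) - B) \<union> (B - (\<Union>i. A i))) < \<epsilon>"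
        using T B c by (intro exI[where x = T] exI[where x = B] conjI)
    qed
  qed
  from this[THEN spec, THEN mp, OF \<epsilon>] show ?thesis .
qed

text \<open>Approximation in \<open>L^1\<close> expressed by two one-sided inequalities with an
  explicit error function: this avoids differences of possibly infinite values, and a positive
  additive operator such as \<open>QQ\<close> can be applied to each inequality directly.\<close>

definition cylinder_approximable :: "('n::finite) path measure \<Rightarrow> ('n path \<Rightarrow> ennreal) \<Rightarrow> bool" where
  "cylinder_approximable \<mu> f \<longleftrightarrow> (\<forall>\<epsilon>>0. \<exists>T g h. finite T \<and> T \<subseteq> {0..1} \<and> g \<in> borel_measurable path_space \<and> h \<in> borel_measurable path_space
     \<and> depends_on T g \<and> (\<forall>x\<in>paths. f x \<le> g x + h x \<and> g x \<le> f x + h x) \<and> (\<integral>\<^sup>+x. h x \<partial>\<mu>) \<le> ennreal \<epsilon>)"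

lemma cylinder_approximableE:
  assumes "cylinder_approximable \<mu> f" "\<epsilon> > 0"
  obtains T g h where "finite T" "T \<subseteq> {0..1}" "g \<in> borel_measurable path_space" "h \<in> borel_measurable path_space"
    "depends_on T g" "\<forall>x\<in>paths. f x \<le> g x + h x" "\<forall>x\<in>paths. g x \<le> f x + h x"
    "(\<integral>\<^sup>+x. h x \<partial>\<mu>) \<le> ennreal \<epsilon>"
proof -
  from assms(1)[unfolded cylinder_approximable_def, THEN spec, THEN mp, OF assms(2)]
  obtain T g h where *: "finite T \<and> T \<subseteq> {0..1} \<and> g \<in> borel_measurable path_space \<and> h \<in> borel_measurable path_space
     \<and> depends_on T g \<and> (\<forall>x\<in>paths. f x \<le> g x + h x \<and> g x \<le> f x + h x) \<and> (\<integral>\<^sup>+x. h x \<partial>\<mu>) \<le> ennreal \<epsilon>"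
    by (elim exE) (rule that)
  show thesis by (rule that[of T g h]) (use * in simp_all)
qed

lemma cylinder_approximableI:
  assumes "\<And>\<epsilon>. \<epsilon> > 0 \<Longrightarrow> \<exists>T g h. finite T \<and> T \<subseteq> {0..1} \<and> g \<in> borel_measurable path_space \<and> h \<in> borel_measurable path_space
     \<and> depends_on T g \<and> (\<forall>x\<in>paths. f x \<le> g x + h x \<and> g x \<le> f x + h x) \<and> (\<integral>\<^sup>+x. h x \<partial>\<mu>) \<le> ennreal \<epsilon>"
  shows "cylinder_approximable \<mu> f"
  unfolding cylinder_approximable_def using assms by (intro allI impI)

lemma cylinder_approximation_witness:
  assumes "finite T" "T \<subseteq> {0..1}" "g \<in> borel_measurable path_space" "h \<in> borel_measurable path_space"
    "depends_on T g" "\<And>x. x \<in> paths \<Longrightarrow> f x \<le> g x + h x \<and> g x \<le> f x + h x" "(\<integral>\<^sup>+x. h x \<partial>\<mu>) \<le> ennreal \<epsilon>"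
  shows "\<exists>T g h. finite T \<and> T \<subseteq> {0..1} \<and> g \<in> borel_measurable path_space \<and> h \<in> borel_measurable path_space
     \<and> depends_on T g \<and> (\<forall>x\<in>paths. f x \<le> g x + h x \<and> g x \<le> f x + h x) \<and> (\<integral>\<^sup>+x. h x \<partial>\<mu>) \<le> ennreal \<epsilon>"
  by (rule exI[where x = T], rule exI[where x = g], rule exI[where x = h], intro conjI ballI assms(1-5,7), rule assms(6)[THEN conjunct1], assumption, rule assms(6)[THEN conjunct2], assumption)

lemma depends_on_apply2:
  fixes f g :: "('n::finite) path \<Rightarrow> ennreal"
  assumes "depends_on T f" "depends_on T g"
  shows "depends_on T (\<lambda>x. F (f x) (g x))"
  unfolding depends_on_def
proof (intro ballI impI)
  fix x y :: "'n path" assume *: "x \<in> paths" "y \<in> paths" "\<forall>s\<in>T. x s = y s"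
  have "f x = f y" "g x = g y"
    by (rule assms[unfolded depends_on_def, THEN bspec, OF *(1), THEN bspec, OF *(2), THEN mp, OF *(3)])+
  then show "F (f x) (g x) = F (f y) (g y)" by (simp only:)
qed

text \<open>The induction runs over all nonnegative measurable functions, so finiteness of the
  integral is carried as a premise of the claim; each constituent inherits it, except in a product
  with the constant 0, which is approximated by 0.\<close>

lemma integrable_cylinder_approximable:
  fixes \<mu> :: "('n::finite) path measure"
  assumes prob: "prob_space \<mu>" and sets: "sets \<mu> = sets path_space"
    and f: "f \<in> borel_measurable path_space"
  shows "(\<integral>\<^sup>+x. f x \<partial>\<mu>) < top \<longrightarrow> cylinder_approximable \<mu> f"
proof -
  interpret mu: prob_space \<mu> by (rule prob)
  have mm: "f \<in> borel_measurable path_space \<Longrightarrow> f \<in> borel_measurable \<mu>" for f :: "'n path \<Rightarrow> ennreal"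
    using measurable_cong_sets[OF sets refl] by (rule subst[OF sym])
  have sp: "space \<mu> = paths" using sets_eq_imp_space_eq[OF sets] by (simp add: space_path_space)
  from f show ?thesis
  proof (induction rule: borel_measurable_induct)
    case (cong f g)
    show ?case
    proof
      assume "(\<integral>\<^sup>+x. f x \<partial>\<mu>) < top"
      moreover have "(\<integral>\<^sup>+x. f x \<partial>\<mu>) = (\<integral>\<^sup>+x. g x \<partial>\<mu>)"
        by (rule nn_integral_cong) (use cong.hyps(3) in \<open>simp add: sp space_path_space\<close>)
      ultimately have "cylinder_approximable \<mu> g" using cong.IH by (simp only:)
      moreover have "f x = g x" if "x \<in> paths" for x using cong.hyps(3) that by (simp add: space_path_space)
      ultimately show "cylinder_approximable \<mu> f"
        unfolding cylinder_approximable_def by (simp cong: ball_cong)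
    qed
  next
    case (set A)
    show ?case
    proof (intro impI cylinder_approximableI)
      fix \<epsilon> :: real assume e: "\<epsilon> > 0"
      from cylinder_dense[OF prob sets set e]
      obtain T B where B: "finite T \<and> T \<subseteq> {0..1} \<and> B \<in> sets path_space \<and> cylinder T B \<and> measure \<mu> ((A - B) \<union> (B - A)) < \<epsilon>"
        by (elim exE) (rule that)
      let ?D = "(A - B) \<union> (B - A)"
      have D: "?D \<in> sets path_space" using B set by (intro sets.Un sets.Diff) simp_all
      have d: "depends_on T (indicator B)"
        unfolding depends_on_def
      proof (intro ballI impI)
        fix x y :: "'n path" assume *: "x \<in> paths" "y \<in> paths" "\<forall>s\<in>T. x s = y s"
        have "x \<in> B \<longleftrightarrow> y \<in> B" using B by (intro cylinderD[OF _ *]) simp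
        then show "indicator B x = (indicator B y :: ennreal)" by (simp only: indicator_def)
      qed
      have "(\<integral>\<^sup>+x. indicator ?D x \<partial>\<mu>) = ennreal (measure \<mu> ?D)"
        using D by (subst nn_integral_indicator) (simp_all add: sets mu.emeasure_eq_measure)
      also have "\<dots> \<le> ennreal \<epsilon>" using B by (intro ennreal_leI) simp
      finally have i: "(\<integral>\<^sup>+x. indicator ?D x \<partial>\<mu>) \<le> ennreal \<epsilon>" .
      have "indicator A x \<le> indicator B x + (indicator ?D x :: ennreal) \<and> indicator B x \<le> indicator A x + (indicator ?D x :: ennreal)" for x
        by (simp add: indicator_def)
      then show "\<exists>T g h. finite T \<and> T \<subseteq> {0..1} \<and> g \<in> borel_measurable path_space \<and> h \<in> borel_measurable path_space
         \<and> depends_on T g \<and> (\<forall>x\<in>paths. indicator A x \<le> g x + h x \<and> g x \<le> indicator A x + h x) \<and> (\<integral>\<^sup>+x. h x \<partial>\<mu>) \<le> ennreal \<epsilon>"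
        using B by (intro cylinder_approximation_witness[OF _ _ borel_measurable_indicator borel_measurable_indicator[OF D] d _ i]) simp_all
    qed
  next
    case (mult u c)
    show ?case
    proof (intro impI cylinder_approximableI)
      fix \<epsilon> :: real assume e: "\<epsilon> > 0" and fin: "(\<integral>\<^sup>+x. c * u x \<partial>\<mu>) < top"
      have cu: "(\<integral>\<^sup>+x. c * u x \<partial>\<mu>) = c * (\<integral>\<^sup>+x. u x \<partial>\<mu>)" by (rule nn_integral_cmult[OF mm[OF mult.hyps(2)]])
      show "\<exists>T g h. finite T \<and> T \<subseteq> {0..1} \<and> g \<in> borel_measurable path_space \<and> h \<in> borel_measurable path_space
         \<and> depends_on T g \<and> (\<forall>x\<in>paths. c * u x \<le> g x + h x \<and> g x \<le> c * u x + h x) \<and> (\<integral>\<^sup>+x. h x \<partial>\<mu>) \<le> ennreal \<epsilon>"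
      proof (cases "c = 0")
        case True
        then show ?thesis
          by (intro cylinder_approximation_witness[where T = "{}" and g = "\<lambda>_. 0" and h = "\<lambda>_. 0"]) (simp_all add: depends_on_def)
      next
        case False
        obtain r where r: "c = ennreal r" "r \<ge> 0" using mult.hyps(1) by (cases c) auto
        then have rp: "r > 0" using False by (cases "r = 0") auto
        have "(\<integral>\<^sup>+x. u x \<partial>\<mu>) < top" using fin False unfolding cu by (auto simp: ennreal_mult_less_top)
        then have "cylinder_approximable \<mu> u" using mult.IH by (rule rev_mp)
        moreover have "\<epsilon> / r > 0" using e rp by simp
        ultimately obtain T g h where A: "finite T" "T \<subseteq> {0..1}" "g \<in> borel_measurable path_space" "h \<in> borel_measurable path_space"
          "depends_on T g" "\<forall>x\<in>paths. u x \<le> g x + h x" "\<forall>x\<in>paths. g x \<le> u x + h x"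
          "(\<integral>\<^sup>+x. h x \<partial>\<mu>) \<le> ennreal (\<epsilon> / r)" by (rule cylinder_approximableE) (rule that; assumption)
        have 1: "c * u x \<le> c * g x + c * h x \<and> c * g x \<le> c * u x + c * h x" if "x \<in> paths" for x
          using mult_left_mono[OF A(6)[THEN bspec, OF that], of c] mult_left_mono[OF A(7)[THEN bspec, OF that], of c] by (simp add: distrib_left)
        have "(\<integral>\<^sup>+x. c * h x \<partial>\<mu>) = c * (\<integral>\<^sup>+x. h x \<partial>\<mu>)" by (rule nn_integral_cmult[OF mm[OF A(4)]])
        also have "\<dots> \<le> c * ennreal (\<epsilon> / r)" using A(8) by (rule mult_left_mono) simp
        also have "\<dots> = ennreal \<epsilon>" unfolding r(1) using rp e by (subst ennreal_mult[symmetric]) simp_all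
        finally have 2: "(\<integral>\<^sup>+x. c * h x \<partial>\<mu>) \<le> ennreal \<epsilon>" .
        have 3: "(\<lambda>x. c * g x) \<in> borel_measurable path_space" "(\<lambda>x. c * h x) \<in> borel_measurable path_space"
          by (intro borel_measurable_times_ennreal borel_measurable_const A(3,4))+
        have 4: "depends_on T (\<lambda>x. c * g x)" using depends_on_apply2[OF A(5) A(5), of "\<lambda>a b. c * a"] .
        show ?thesis
          by (rule cylinder_approximation_witness[OF A(1,2) 3 4 1 2])
      qed
    qed
  next
    case (add u v)
    show ?case
    proof (intro impI cylinder_approximableI)
      fix \<epsilon> :: real assume e: "\<epsilon> > 0" and fin: "(\<integral>\<^sup>+x. v x + u x \<partial>\<mu>) < top"
      have vu: "(\<integral>\<^sup>+x. v x + u x \<partial>\<mu>) = (\<integral>\<^sup>+x. v x \<partial>\<mu>) + (\<integral>\<^sup>+x. u x \<partial>\<mu>)"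
        by (rule nn_integral_add[OF mm[OF add.hyps(3)] mm[OF add.hyps(1)]])
      have "(\<integral>\<^sup>+x. u x \<partial>\<mu>) < top" "(\<integral>\<^sup>+x. v x \<partial>\<mu>) < top" using fin unfolding vu by (simp_all add: ennreal_add_less_top)
      then have ap: "cylinder_approximable \<mu> u" "cylinder_approximable \<mu> v" using add.IH by (auto)
      have e2: "\<epsilon> / 2 > 0" using e by simp
      from ap(1) e2 obtain T g h where A: "finite T" "T \<subseteq> {0..1}" "g \<in> borel_measurable path_space" "h \<in> borel_measurable path_space"
          "depends_on T g" "\<forall>x\<in>paths. u x \<le> g x + h x" "\<forall>x\<in>paths. g x \<le> u x + h x"
          "(\<integral>\<^sup>+x. h x \<partial>\<mu>) \<le> ennreal (\<epsilon> / 2)" by (rule cylinder_approximableE) (rule that; assumption)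
      from ap(2) e2 obtain T' g' h' where B: "finite T'" "T' \<subseteq> {0..1}" "g' \<in> borel_measurable path_space" "h' \<in> borel_measurable path_space"
          "depends_on T' g'" "\<forall>x\<in>paths. v x \<le> g' x + h' x" "\<forall>x\<in>paths. g' x \<le> v x + h' x"
          "(\<integral>\<^sup>+x. h' x \<partial>\<mu>) \<le> ennreal (\<epsilon> / 2)" by (rule cylinder_approximableE) (rule that; assumption)
      let ?g = "\<lambda>x. g' x + g x" and ?h = "\<lambda>x. h' x + h x"
      have 1: "v x + u x \<le> ?g x + ?h x \<and> ?g x \<le> v x + u x + ?h x" if "x \<in> paths" for x
        using add_mono[OF B(6)[THEN bspec, OF that] A(6)[THEN bspec, OF that]] add_mono[OF B(7)[THEN bspec, OF that] A(7)[THEN bspec, OF that]] by (simp add: add_ac)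
      have "(\<integral>\<^sup>+x. ?h x \<partial>\<mu>) = (\<integral>\<^sup>+x. h' x \<partial>\<mu>) + (\<integral>\<^sup>+x. h x \<partial>\<mu>)" by (rule nn_integral_add[OF mm[OF B(4)] mm[OF A(4)]])
      also have "\<dots> \<le> ennreal (\<epsilon> / 2) + ennreal (\<epsilon> / 2)" by (rule add_mono[OF B(8) A(8)])
      also have "\<dots> = ennreal \<epsilon>" using e by (subst ennreal_plus[symmetric]) simp_all
      finally have 2: "(\<integral>\<^sup>+x. ?h x \<partial>\<mu>) \<le> ennreal \<epsilon>" .
      have 3: "?g \<in> borel_measurable path_space" "?h \<in> borel_measurable path_space"
        by (intro borel_measurable_add A(3,4) B(3,4))+
      have 4: "depends_on (T \<union> T') ?g"
        by (rule depends_on_apply2[OF depends_on_mono[OF B(5)] depends_on_mono[OF A(5)]]) simp_all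
      have 5: "finite (T \<union> T')" "T \<union> T' \<subseteq> {0..1}" using A(1,2) B(1,2) by simp_all
      show "\<exists>T g h. finite T \<and> T \<subseteq> {0..1} \<and> g \<in> borel_measurable path_space \<and> h \<in> borel_measurable path_space
         \<and> depends_on T g \<and> (\<forall>x\<in>paths. v x + u x \<le> g x + h x \<and> g x \<le> v x + u x + h x) \<and> (\<integral>\<^sup>+x. h x \<partial>\<mu>) \<le> ennreal \<epsilon>"
        by (rule cylinder_approximation_witness[OF 5 3 4 1 2])
    qed
  next
    case (seq U)
    show ?case
    proof (intro impI cylinder_approximableI)
      fix \<epsilon> :: real assume e: "\<epsilon> > 0" and fin: "(\<integral>\<^sup>+x. (SUP i. U i) x \<partial>\<mu>) < top"
      let ?f = "SUP i. U i"
      have Um: "U i \<in> borel_measurable \<mu>" for i by (rule mm[OF seq.hyps(1)])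
      have Up: "U i x \<le> ?f x" for i x unfolding SUP_apply by (rule SUP_upper) simp
      have S: "(\<integral>\<^sup>+x. ?f x \<partial>\<mu>) = (SUP i. \<integral>\<^sup>+x. U i x \<partial>\<mu>)"
        unfolding SUP_apply by (rule nn_integral_monotone_convergence_SUP[OF seq.hyps(3) Um])
      have "\<exists>i\<in>UNIV. (\<integral>\<^sup>+x. ?f x \<partial>\<mu>) < (\<integral>\<^sup>+x. U i x \<partial>\<mu>) + ennreal (\<epsilon> / 2)"
        by (rule SUP_approx_ennreal[OF _ _ S]) (use e fin in simp_all)
      then obtain i where i: "(\<integral>\<^sup>+x. ?f x \<partial>\<mu>) < (\<integral>\<^sup>+x. U i x \<partial>\<mu>) + ennreal (\<epsilon> / 2)" by (elim bexE) (rule that)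
      have "(\<integral>\<^sup>+x. U i x \<partial>\<mu>) \<le> (\<integral>\<^sup>+x. ?f x \<partial>\<mu>)" by (rule nn_integral_mono) (rule Up)
      then have fi: "(\<integral>\<^sup>+x. U i x \<partial>\<mu>) < top" using fin by (rule le_less_trans)
      then have "cylinder_approximable \<mu> (U i)" using seq.IH[of i] by (rule rev_mp)
      moreover have "\<epsilon> / 2 > 0" using e by simp
      ultimately obtain T g h where A: "finite T" "T \<subseteq> {0..1}" "g \<in> borel_measurable path_space" "h \<in> borel_measurable path_space"
          "depends_on T g" "\<forall>x\<in>paths. U i x \<le> g x + h x" "\<forall>x\<in>paths. g x \<le> U i x + h x"
          "(\<integral>\<^sup>+x. h x \<partial>\<mu>) \<le> ennreal (\<epsilon> / 2)" by (rule cylinder_approximableE) (rule that; assumption)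
      have fm: "?f \<in> borel_measurable path_space" unfolding SUP_apply[abs_def]
        by (intro borel_measurable_SUP seq.hyps(1) countableI_type)
      \<comment> \<open>The second summand is the cost of replacing the limit by \<open>U i\<close>.
        The subtraction is a genuine one because \<open>U i\<close> lies below the limit, and its
        integral splits because that of \<open>U i\<close> is finite.\<close>
      let ?h = "\<lambda>x. h x + (?f x - U i x)"
      have 3: "?h \<in> borel_measurable path_space"
        by (intro borel_measurable_add borel_measurable_minus_ennreal A(4) fm seq.hyps(1))
      have 1: "?f x \<le> g x + ?h x \<and> g x \<le> ?f x + ?h x" if "x \<in> paths" for x
      proof
        have "?f x = U i x + (?f x - U i x)" by (rule add_diff_inverse_ennreal[OF Up, symmetric])
        also have "\<dots> \<le> g x + h x + (?f x - U i x)" using A(6)[THEN bspec, OF that] by (rule add_right_mono)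
        finally show "?f x \<le> g x + ?h x" by (simp only: add.assoc)
        have "g x \<le> ?f x + h x" using A(7)[THEN bspec, OF that] add_right_mono[OF Up[of i x], of "h x"] by (rule order_trans)
        also have "\<dots> \<le> ?f x + ?h x" by (intro add_left_mono) simp
        finally show "g x \<le> ?f x + ?h x" .
      qed
      have "(\<integral>\<^sup>+x. ?f x - U i x \<partial>\<mu>) = (\<integral>\<^sup>+x. ?f x \<partial>\<mu>) - (\<integral>\<^sup>+x. U i x \<partial>\<mu>)"
        by (rule nn_integral_diff[OF mm[OF fm] Um]) (use fi Up in \<open>simp_all add: less_top\<close>)
      also have "\<dots> \<le> ennreal (\<epsilon> / 2)" using fi by (intro ennreal_minus_le_iff[THEN iffD2] conjI less_imp_le[OF i] impI) simp
      finally have d: "(\<integral>\<^sup>+x. ?f x - U i x \<partial>\<mu>) \<le> ennreal (\<epsilon> / 2)" .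
      have "(\<integral>\<^sup>+x. ?h x \<partial>\<mu>) = (\<integral>\<^sup>+x. h x \<partial>\<mu>) + (\<integral>\<^sup>+x. ?f x - U i x \<partial>\<mu>)"
        by (rule nn_integral_add[OF mm[OF A(4)] borel_measurable_minus_ennreal[OF mm[OF fm] Um]])
      also have "\<dots> \<le> ennreal (\<epsilon> / 2) + ennreal (\<epsilon> / 2)" by (rule add_mono[OF A(8) d])
      also have "\<dots> = ennreal \<epsilon>" using e by (subst ennreal_plus[symmetric]) simp_all
      finally have 2: "(\<integral>\<^sup>+x. ?h x \<partial>\<mu>) \<le> ennreal \<epsilon>" .
      show "\<exists>T g h. finite T \<and> T \<subseteq> {0..1} \<and> g \<in> borel_measurable path_space \<and> h \<in> borel_measurable path_space
         \<and> depends_on T g \<and> (\<forall>x\<in>paths. ?f x \<le> g x + h x \<and> g x \<le> ?f x + h x) \<and> (\<integral>\<^sup>+x. h x \<partial>\<mu>) \<le> ennreal \<epsilon>"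
        by (rule cylinder_approximation_witness[OF A(1,2,3) 3 A(5) 1 2])
    qed
  qed
qed

subsection \<open>The inequality on path space\<close>

text \<open>The grid lists \<open>T\<close> in increasing order and may stop before time 1; a list
  with \<open>m + 1\<close> entries bounds \<open>m\<close> intervals.\<close>

lemma grid_exists:
  assumes "finite T" "T \<subseteq> {0..1}" "0 \<in> T"
  shows "\<exists>m \<tau>. time_grid m \<tau> \<and> \<tau> ` {..m} = T"
proof -
  define xs where "xs = sorted_list_of_set T"
  have xs: "set xs = T" "sorted_wrt (<) xs" "xs \<noteq> []"
    using assms by (auto simp: xs_def)
  have len: "length xs > 0" using xs(3) by simp
  have im: "(!) xs ` {..length xs - 1} = T"
  proof -
    have "{..length xs - 1} = {0..<length xs}" using len by (cases xs) auto
    then show ?thesis unfolding xs(1)[symmetric] set_conv_nth by auto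
  qed
  have "time_grid (length xs - 1) ((!) xs)"
  proof
    obtain l where l: "l < length xs" "xs ! l = 0" using assms(3) xs(1) by (auto simp: in_set_conv_nth)
    have "xs ! 0 \<in> T" using len xs(1) nth_mem by blast
    then have "0 \<le> xs ! 0" using assms(2) by auto
    moreover have "xs ! 0 \<le> xs ! l"
      using sorted_wrt_nth_less[OF xs(2), of 0 l] l by (cases "l = 0") auto
    ultimately show "xs ! 0 = 0" using l by simp
    show "xs ! i < xs ! Suc i" if "i < length xs - 1" for i
      using that by (intro sorted_wrt_nth_less[OF xs(2)]) auto
    have "xs ! (length xs - 1) \<in> T" using len xs(1) nth_mem[of "length xs - 1" xs] by simp
    then show "xs ! (length xs - 1) \<le> 1" using assms(2) by auto
  qed
  then show ?thesis using im by blast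
qed

text \<open>A limit along \<open>1 / (n + 1)\<close>. The case of a zero base is separate because
  continuity of \<open>powr\<close> is used only at nonzero bases; there the left side is 0 and
  \<open>P \<ge> 0\<close> suffices.\<close>

lemma powr_product_le_limit:
  fixes a b P t :: real
  assumes "a \<ge> 0" "b \<ge> 0" "P \<ge> 0"
    and le: "\<And>\<delta>. \<delta> > 0 \<Longrightarrow> max 0 (a - 2 * \<delta>) powr t * max 0 (b - 2 * \<delta>) powr (1 - t) \<le> P + 2 * \<delta>"
  shows "a powr t * b powr (1 - t) \<le> P"
proof (cases "a = 0 \<or> b = 0")
  case False
  let ?L = "\<lambda>n. max 0 (a - 2 * (1 / real (Suc n))) powr t * max 0 (b - 2 * (1 / real (Suc n))) powr (1 - t)"
  have lim: "(\<lambda>n. 1 / real (Suc n)) \<longlonglongrightarrow> 0" by (rule LIMSEQ_Suc[OF lim_1_over_n])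
  have c: "(\<lambda>n. max 0 (x - 2 * (1 / real (Suc n)))) \<longlonglongrightarrow> x" if "x \<ge> 0" for x :: real
    using tendsto_max[OF tendsto_const[of 0] tendsto_diff[OF tendsto_const[of x] tendsto_mult[OF tendsto_const[of 2] lim]]] that by simp
  have 1: "?L \<longlonglongrightarrow> a powr t * b powr (1 - t)"
    by (intro tendsto_mult tendsto_powr c tendsto_const) (use assms False in auto)
  have 2: "(\<lambda>n. P + 2 * (1 / real (Suc n))) \<longlonglongrightarrow> P"
    using tendsto_add[OF tendsto_const[of P] tendsto_mult[OF tendsto_const[of 2] lim]] by simp
  show ?thesis
  proof (rule LIMSEQ_le[OF 1 2], intro exI allI impI)
    fix n
    show "?L n \<le> P + 2 * (1 / real (Suc n))" by (rule le) simp
  qed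
qed (use assms in auto)

lemma powr_filterlim_at_top:
  fixes s :: real
  assumes "s > 0"
  shows "filterlim (\<lambda>x. x powr s) at_top at_top"
  unfolding filterlim_at_top
proof
  fix Z :: real
  show "\<forall>\<^sub>F x in at_top. Z \<le> x powr s"
    using eventually_ge_at_top[of "max 1 Z powr (1 / s)"]
  proof eventually_elim
    case (elim x)
    have "Z \<le> max 1 Z" by simp
    also have "\<dots> = (max 1 Z powr (1 / s)) powr s" using assms by (simp add: powr_powr)
    also have "\<dots> \<le> x powr s" using elim assms by (intro powr_mono2) auto
    finally show ?case .
  qed
qed

lemma ennreal_powr_tendsto:
  assumes t: "t > 0" and X: "X \<longlonglongrightarrow> x" and fin: "\<And>n. X n < top"
  shows "(\<lambda>n. ennreal (enn2real (X n) powr t)) \<longlonglongrightarrow> ennreal_powr x t"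
proof (cases "x = top")
  case True
  have eq: "ennreal (enn2real (X n)) = X n" for n using fin[of n] by simp
  then have "(\<lambda>n. ennreal (enn2real (X n))) \<longlonglongrightarrow> top" using X True by simp
  then have "filterlim (\<lambda>n. enn2real (X n)) at_top sequentially"
    by (simp only: ennreal_tendsto_top_eq_at_top)
  then have "filterlim (\<lambda>n. enn2real (X n) powr t) at_top sequentially"
    by (rule filterlim_compose[OF powr_filterlim_at_top[OF t]])
  then show ?thesis using t True by (simp add: ennreal_powr_def ennreal_tendsto_top_eq_at_top)
next
  case False
  then have xe: "x = ennreal (enn2real x)" by (simp add: less_top)
  have "(\<lambda>n. enn2real (X n)) \<longlonglongrightarrow> enn2real x"
    by (rule tendsto_enn2real) (use X xe in simp_all)
  then have "(\<lambda>n. enn2real (X n) powr t) \<longlonglongrightarrow> enn2real x powr t"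
    by (rule tendsto_powr'[OF _ tendsto_const]) (use t in simp)
  then have "(\<lambda>n. ennreal (enn2real (X n) powr t)) \<longlonglongrightarrow> ennreal (enn2real x powr t)"
    by (rule tendsto_ennrealI)
  then show ?thesis using t False by (simp add: ennreal_powr_def)
qed

text \<open>Multiplication on \<open>ennreal\<close> is discontinuous at zero times infinity. A
  vanishing factor is therefore treated first: the product is then 0 by convention, and elsewhere
  limits may be multiplied.\<close>

lemma ennreal_powr_mult_le:
  assumes t: "0 < t" "t < 1" and X: "X \<longlonglongrightarrow> x" "\<And>n. X n < top" and Y: "Y \<longlonglongrightarrow> y" "\<And>n. Y n < top"
    and le: "\<And>n. ennreal (enn2real (X n) powr t * enn2real (Y n) powr (1 - t)) \<le> A"
  shows "ennreal_powr x t * ennreal_powr y (1 - t) \<le> A"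
proof (cases "ennreal_powr x t = 0 \<or> ennreal_powr y (1 - t) = 0")
  case False
  have "(\<lambda>n. ennreal (enn2real (X n) powr t) * ennreal (enn2real (Y n) powr (1 - t))) \<longlonglongrightarrow> ennreal_powr x t * ennreal_powr y (1 - t)"
    by (intro tendsto_mult_ennreal ennreal_powr_tendsto X Y) (use t False in auto)
  then show ?thesis
    by (rule LIMSEQ_le_const2) (use le in \<open>simp add: ennreal_mult'\<close>)
qed auto

text \<open>Exponentiated convexity. A zero of \<open>x\<close> or \<open>y\<close> makes the left
  side vanish, and a zero of \<open>z\<close> is excluded when both are positive because an infinite
  value cannot lie below a finite one.\<close>

lemma neg_log_convexD:
  assumes t: "0 < t" "t < 1" and nn: "x \<ge> 0" "y \<ge> 0" "z \<ge> 0"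
    and le: "neg_log z \<le> ereal t * neg_log x + ereal (1 - t) * neg_log y"
  shows "x powr t * y powr (1 - t) \<le> z"
proof (cases "x = 0 \<or> y = 0")
  case False
  then have xy: "x > 0" "y > 0" using nn by auto
  have z: "z \<noteq> 0"
  proof
    assume "z = 0"
    then show False using le xy by (simp add: neg_log_def)
  qed
  then have "- ln z \<le> t * (- ln x) + (1 - t) * (- ln y)" using le xy by (simp add: neg_log_def)
  then have "t * ln x + (1 - t) * ln y \<le> ln z" by simp
  then have "exp (t * ln x + (1 - t) * ln y) \<le> exp (ln z)" by simp
  then show ?thesis using xy z nn by (simp add: powr_def exp_add)
qed (use nn t in auto)

text \<open>By the identity for \<open>N\<close>, the Gaussian weights of the two endpoints equal
  that of the convex combination times the penalty. Cancelling the common weight and multiplying by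
  the bound for \<open>d\<close> gives the inequality for the products.\<close>

lemma weighted_bound_combine:
  fixes A B C :: real
  assumes t: "0 < t" "t < 1" and pos: "A > 0" "B > 0" "C > 0" and nn: "Db \<ge> 0" "Dc \<ge> 0"
    and N: "N = t * Nh + (1 - t) * Nk - t * (1 - t) * S"
    and le: "(B * exp (- (1/2) * Nh)) powr t * (C * exp (- (1/2) * Nk)) powr (1 - t) \<le> A * exp (- (1/2) * N)"
    and D: "Db powr t * Dc powr (1 - t) \<le> Da"
  shows "(B * Db) powr t * (C * Dc) powr (1 - t) * exp (- t * (1 - t) * S / 2) \<le> A * Da"
proof -
  have "(B * exp (- (1/2) * Nh)) powr t * (C * exp (- (1/2) * Nk)) powr (1 - t)
    = B powr t * C powr (1 - t) * (exp (t * (- (1/2) * Nh)) * exp ((1 - t) * (- (1/2) * Nk)))"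
    using pos by (simp add: powr_mult exp_powr_real mult_ac)
  also have "exp (t * (- (1/2) * Nh)) * exp ((1 - t) * (- (1/2) * Nk)) = exp (- (1/2) * N) * exp (- t * (1 - t) * S / 2)"
    unfolding mult_exp_exp N by (rule arg_cong[where f = exp]) (simp add: field_simps)
  finally have "(B powr t * C powr (1 - t) * exp (- t * (1 - t) * S / 2)) * exp (- (1/2) * N) \<le> A * exp (- (1/2) * N)"
    using le by (simp only: mult_ac)
  then have 1: "B powr t * C powr (1 - t) * exp (- t * (1 - t) * S / 2) \<le> A" by (simp only: mult_le_cancel_right_pos exp_gt_zero)
  have "(B * Db) powr t * (C * Dc) powr (1 - t) * exp (- t * (1 - t) * S / 2)
    = (B powr t * C powr (1 - t) * exp (- t * (1 - t) * S / 2)) * (Db powr t * Dc powr (1 - t))"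
    using pos nn by (simp add: powr_mult)
  also have "\<dots> \<le> A * Da" using 1 D pos by (intro mult_mono) auto
  finally show ?thesis .
qed

lemma square_sum_comb:
  fixes c c' :: "'a \<Rightarrow> real"
  shows "(\<Sum>j\<in>J. (t * c j + (1 - t) * c' j)\<^sup>2) = t * (\<Sum>j\<in>J. (c j)\<^sup>2) + (1 - t) * (\<Sum>j\<in>J. (c' j)\<^sup>2) - t * (1 - t) * (\<Sum>j\<in>J. (c j - c' j)\<^sup>2)"
proof -
  have "(t * x + (1 - t) * y)\<^sup>2 = t * x\<^sup>2 + (1 - t) * y\<^sup>2 - t * (1 - t) * (x - y)\<^sup>2" for x y :: real
    by (simp add: power2_eq_square algebra_simps)
  then show ?thesis by (simp only: sum.distrib sum_subtractf sum_distrib_left)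
qed

section \<open>The inequality for bounded lower functions\<close>

context perturbed_wiener
begin

lemma integral_via_beta:
  assumes "F \<in> borel_measurable path_space" and "AE w in \<nu>. f w = F (\<beta> w)"
  shows "(\<integral>\<^sup>+x. F x \<partial>\<mu>) = (\<integral>\<^sup>+w. f w \<partial>\<nu>)"
proof -
  have "(\<integral>\<^sup>+x. F x \<partial>\<mu>) = (\<integral>\<^sup>+w. F (\<beta> w) \<partial>completion \<nu>)"
    unfolding \<mu>_def by (rule nn_integral_distr[OF beta_measurable]) (simp only: measurable_distr_eq1 assms(1))
  also have "\<dots> = (\<integral>\<^sup>+w. F (\<beta> w) \<partial>\<nu>)" by (rule nn_integral_completion)
  also have "\<dots> = (\<integral>\<^sup>+w. f w \<partial>\<nu>)"
    by (rule nn_integral_cong_AE) (use assms(2) in eventually_elim, simp)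
  finally show ?thesis .
qed

text \<open>For each tolerance three cylinder functions involve only finitely many times, so one
  grid carries all of them. The grid changes with the tolerance, which is why the hypothesis is
  required on every grid.\<close>

lemma Prekopa_Leindler_bounded:
  assumes t: "0 < t" "t < 1" and M: "M \<ge> 0"
    and p: "p \<in> borel_measurable (completion \<nu>)" and q: "q \<in> borel_measurable (completion \<nu>)" and r: "r \<in> borel_measurable (completion \<nu>)"
    and qM: "\<And>w. q w \<le> ennreal M" and rM: "\<And>w. r w \<le> ennreal M" and fin: "(\<integral>\<^sup>+w. p w \<partial>\<nu>) < top"
    and hyp: "\<And>m \<tau> c c'. time_grid m \<tau> \<Longrightarrow> AE w in \<nu>.
       ennreal (enn2real (q (W (\<lambda>_. time_grid.step_path m \<tau> c) w)) powr t
         * enn2real (r (W (\<lambda>_. time_grid.step_path m \<tau> c') w)) powr (1 - t)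
         * exp (- t * (1 - t) * (\<Sum>j\<in>time_grid.idx m. (c j - c' j)\<^sup>2) / 2))
       \<le> p (W (\<lambda>_. time_grid.step_path m \<tau> (\<lambda>j. t * c j + (1 - t) * c' j)) w)"
  shows "ennreal (enn2real (\<integral>\<^sup>+w. q w \<partial>\<nu>) powr t * enn2real (\<integral>\<^sup>+w. r w \<partial>\<nu>) powr (1 - t)) \<le> (\<integral>\<^sup>+w. p w \<partial>\<nu>)"
proof -
  interpret mu: prob_space \<mu> by (rule prob_mu)
  obtain P where P: "P \<in> borel_measurable path_space" "AE w in \<nu>. p w = P (\<beta> w)" using function_via_beta[OF p] ..
  \<comment> \<open>A factor through \<beta> inherits the bound only along almost every Brownian
    path; truncation at \<open>M\<close> extends the bound to all paths without changing the
    factorisation.\<close>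
  have bounded: "\<exists>F\<in>borel_measurable path_space. (AE w in \<nu>. f w = F (\<beta> w)) \<and> (\<forall>x. F x \<le> ennreal M)"
    if f: "f \<in> borel_measurable (completion \<nu>)" "\<And>w. f w \<le> ennreal M" for f
  proof -
    obtain F where F: "F \<in> borel_measurable path_space" "AE w in \<nu>. f w = F (\<beta> w)" using function_via_beta[OF f(1)] ..
    have "AE w in \<nu>. f w = min (F (\<beta> w)) (ennreal M)"
      using F(2)
    proof eventually_elim
      case (elim w)
      then show ?case using f(2)[of w] by (simp add: min_absorb1)
    qed
    moreover have "(\<lambda>x. min (F x) (ennreal M)) \<in> borel_measurable path_space"
      by (intro borel_measurable_min F(1) borel_measurable_const)
    ultimately show ?thesis by (intro bexI[where x = "\<lambda>x. min (F x) (ennreal M)"] conjI) simp_all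
  qed
  obtain Q where Q: "Q \<in> borel_measurable path_space" "(AE w in \<nu>. q w = Q (\<beta> w)) \<and> (\<forall>x. Q x \<le> ennreal M)" using bounded[OF q qM] ..
  obtain R where R: "R \<in> borel_measurable path_space" "(AE w in \<nu>. r w = R (\<beta> w)) \<and> (\<forall>x. R x \<le> ennreal M)" using bounded[OF r rM] ..
  have I: "(\<integral>\<^sup>+x. P x \<partial>\<mu>) = (\<integral>\<^sup>+w. p w \<partial>\<nu>)" "(\<integral>\<^sup>+x. Q x \<partial>\<mu>) = (\<integral>\<^sup>+w. q w \<partial>\<nu>)" "(\<integral>\<^sup>+x. R x \<partial>\<mu>) = (\<integral>\<^sup>+w. r w \<partial>\<nu>)"
    by (rule integral_via_beta[OF P] integral_via_beta[OF Q(1) Q(2)[THEN conjunct1]] integral_via_beta[OF R(1) R(2)[THEN conjunct1]])+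
  have bfin: "(\<integral>\<^sup>+x. F x \<partial>\<mu>) < top" if "\<forall>x. F x \<le> ennreal M" for F
  proof -
    have "(\<integral>\<^sup>+x. F x \<partial>\<mu>) \<le> (\<integral>\<^sup>+x. ennreal M \<partial>\<mu>)" using that by (intro nn_integral_mono) simp
    also have "\<dots> < top" by (simp add: mu.emeasure_space_1)
    finally show ?thesis .
  qed
  note Qf = bfin[OF Q(2)[THEN conjunct2]] and Rf = bfin[OF R(2)[THEN conjunct2]]
  have Pf: "(\<integral>\<^sup>+x. P x \<partial>\<mu>) < top" using fin I(1) by simp
  have apx: "cylinder_approximable \<mu> P" "cylinder_approximable \<mu> Q" "cylinder_approximable \<mu> R"
    by (rule integrable_cylinder_approximable[OF prob_mu sets_mu P(1), THEN mp, OF Pf]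
        integrable_cylinder_approximable[OF prob_mu sets_mu Q(1), THEN mp, OF Qf]
        integrable_cylinder_approximable[OF prob_mu sets_mu R(1), THEN mp, OF Rf])+
  define A where "A = enn2real (\<integral>\<^sup>+x. P x \<partial>\<mu>)"
  define B where "B = enn2real (\<integral>\<^sup>+x. Q x \<partial>\<mu>)"
  define C where "C = enn2real (\<integral>\<^sup>+x. R x \<partial>\<mu>)"
  have ABC: "(\<integral>\<^sup>+x. P x \<partial>\<mu>) = ennreal A" "(\<integral>\<^sup>+x. Q x \<partial>\<mu>) = ennreal B" "(\<integral>\<^sup>+x. R x \<partial>\<mu>) = ennreal C" "A \<ge> 0" "B \<ge> 0" "C \<ge> 0"
    using Pf Qf Rf by (simp_all add: A_def B_def C_def)
  have "B powr t * C powr (1 - t) \<le> A"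
  proof (rule powr_product_le_limit[OF ABC(5,6,4)])
    fix \<delta> :: real assume d: "\<delta> > 0"
    \<comment> \<open>Three errors of a quarter each add up to strictly less than \<delta>, as the
      choice of a good path requires.\<close>
    then have d4: "\<delta> / 4 > 0" by simp
    from apx(1) d4 obtain T1 g1 h1 where 1: "finite T1" "T1 \<subseteq> {0..1}" "g1 \<in> borel_measurable path_space" "h1 \<in> borel_measurable path_space"
      "depends_on T1 g1" "\<forall>x\<in>paths. P x \<le> g1 x + h1 x" "\<forall>x\<in>paths. g1 x \<le> P x + h1 x" "(\<integral>\<^sup>+x. h1 x \<partial>\<mu>) \<le> ennreal (\<delta> / 4)"
      by (rule cylinder_approximableE) (rule that; assumption)
    from apx(2) d4 obtain T2 g2 h2 where 2: "finite T2" "T2 \<subseteq> {0..1}" "g2 \<in> borel_measurable path_space" "h2 \<in> borel_measurable path_space"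
      "depends_on T2 g2" "\<forall>x\<in>paths. Q x \<le> g2 x + h2 x" "\<forall>x\<in>paths. g2 x \<le> Q x + h2 x" "(\<integral>\<^sup>+x. h2 x \<partial>\<mu>) \<le> ennreal (\<delta> / 4)"
      by (rule cylinder_approximableE) (rule that; assumption)
    from apx(3) d4 obtain T3 g3 h3 where 3: "finite T3" "T3 \<subseteq> {0..1}" "g3 \<in> borel_measurable path_space" "h3 \<in> borel_measurable path_space"
      "depends_on T3 g3" "\<forall>x\<in>paths. R x \<le> g3 x + h3 x" "\<forall>x\<in>paths. g3 x \<le> R x + h3 x" "(\<integral>\<^sup>+x. h3 x \<partial>\<mu>) \<le> ennreal (\<delta> / 4)"
      by (rule cylinder_approximableE) (rule that; assumption)
    \<comment> \<open>Time 0 is added because a grid starts there.\<close>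
    define T where "T = insert 0 (T1 \<union> T2 \<union> T3)"
    have "finite T" "T \<subseteq> {0..1}" "0 \<in> T" using 1(1,2) 2(1,2) 3(1,2) by (simp_all add: T_def)
    from grid_exists[OF this] obtain m \<tau> where g: "time_grid m \<tau>" and T: "\<tau> ` {..m} = T" by (elim exE conjE) (rule that)
    interpret wiener_grid \<nu> \<beta> W m \<tau>
      by (intro wiener_grid.intro perturbed_wiener_axioms g)
    define h where "h = (\<lambda>x. h1 x + h2 x + h3 x)"
    have hm: "h \<in> borel_measurable path_space" unfolding h_def by (intro borel_measurable_add 1(4) 2(4) 3(4))
    have "(\<integral>\<^sup>+x. h x \<partial>\<mu>) = (\<integral>\<^sup>+x. h1 x \<partial>\<mu>) + (\<integral>\<^sup>+x. h2 x \<partial>\<mu>) + (\<integral>\<^sup>+x. h3 x \<partial>\<mu>)"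
      unfolding h_def by (simp only: nn_integral_add borel_measurable_add cm.borel_measurable_mu 1(4) 2(4) 3(4))
    also have "\<dots> \<le> ennreal (\<delta> / 4) + ennreal (\<delta> / 4) + ennreal (\<delta> / 4)" by (intro add_mono 1(8) 2(8) 3(8))
    also have "\<dots> = ennreal (\<delta> / 4 + \<delta> / 4 + \<delta> / 4)" using d by (simp only: ennreal_plus add_nonneg_nonneg less_imp_le[OF d4])
    also have "\<dots> < ennreal \<delta>" using d by (intro ennreal_lessI) simp_all
    finally have hi: "(\<integral>\<^sup>+x. h x \<partial>\<mu>) < ennreal \<delta>" .
    have hle: "h1 x \<le> h x" "h2 x \<le> h x" "h3 x \<le> h x" for x
      unfolding h_def by (simp_all add: add_increasing add_increasing2)
    have dep: "cm.depends_on_T u" if "depends_on U u" "U \<subseteq> T" for U u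
      using depends_on_mono[OF that] unfolding T[symmetric] cm.depends_on_T_def depends_on_def .
    have wit: "\<exists>g. g \<in> borel_measurable path_space \<and> cm.depends_on_T g \<and> (\<forall>x\<in>paths. f x \<le> g x + h x \<and> g x \<le> f x + h x)"
      if "g \<in> borel_measurable path_space" "depends_on U g" "U \<subseteq> T" "\<forall>x\<in>paths. f x \<le> g x + k x" "\<forall>x\<in>paths. g x \<le> f x + k x" "\<And>x. k x \<le> h x"
      for f g k U
    proof (intro exI[where x = g] conjI ballI that(1) dep[OF that(2,3)])
      fix x :: "'n path" assume "x \<in> paths"
      show "f x \<le> g x + h x" by (rule order_trans[OF that(4)[THEN bspec, OF \<open>x \<in> paths\<close>] add_left_mono[OF that(6)]])
      show "g x \<le> f x + h x" by (rule order_trans[OF that(5)[THEN bspec, OF \<open>x \<in> paths\<close>] add_left_mono[OF that(6)]])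
    qed
    have sub: "T1 \<subseteq> T" "T2 \<subseteq> T" "T3 \<subseteq> T" by (auto simp: T_def)
    have approx: "\<exists>g. g \<in> borel_measurable path_space \<and> cm.depends_on_T g \<and> (\<forall>x\<in>paths. f x \<le> g x + h x \<and> g x \<le> f x + h x)"
      if "f \<in> {P, Q, R}" for f
    proof -
      from that consider "f = P" | "f = Q" | "f = R" by (elim insertE emptyE)
      then show ?thesis
      proof cases
        case 1
        then show ?thesis using wit[OF \<open>g1 \<in> _\<close> \<open>depends_on T1 g1\<close> sub(1) \<open>\<forall>x\<in>paths. P x \<le> _\<close> \<open>\<forall>x\<in>paths. g1 x \<le> _\<close> hle(1)] by (simp only:)
      next
        case 2
        then show ?thesis using wit[OF \<open>g2 \<in> _\<close> \<open>depends_on T2 g2\<close> sub(2) \<open>\<forall>x\<in>paths. Q x \<le> _\<close> \<open>\<forall>x\<in>paths. g2 x \<le> _\<close> hle(2)] by (simp only:)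
      next
        case 3
        then show ?thesis using wit[OF \<open>g3 \<in> _\<close> \<open>depends_on T3 g3\<close> sub(3) \<open>\<forall>x\<in>paths. R x \<le> _\<close> \<open>\<forall>x\<in>paths. g3 x \<le> _\<close> hle(3)] by (simp only:)
      qed
    qed
    have "cm.PL_hyp t P Q R"
      by (rule PL_hyp_transfer[OF P(1) Q(1) R(1) P(2) Q(2)[THEN conjunct1] R(2)[THEN conjunct1] hyp[OF g]])
    from cm.Prekopa_Leindler_approx[OF t P(1) Q(1) R(1) spec[OF Q(2)[THEN conjunct2]] spec[OF R(2)[THEN conjunct2]] M this hm hi ennreal_less_top approx]
    have le: "ennreal (enn2real (ennreal B - (ennreal \<delta> + ennreal \<delta>)) powr t * enn2real (ennreal C - (ennreal \<delta> + ennreal \<delta>)) powr (1 - t))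
      \<le> ennreal A + ennreal \<delta> + ennreal \<delta>"
      unfolding ABC .
    \<comment> \<open>Subtraction in \<open>ennreal\<close> is truncated at 0, which the real
      formulation records by \<open>max 0\<close>.\<close>
    have mx: "enn2real (ennreal x - (ennreal \<delta> + ennreal \<delta>)) = max 0 (x - 2 * \<delta>)" for x
    proof -
      have "ennreal x - (ennreal \<delta> + ennreal \<delta>) = ennreal (x - 2 * \<delta>)"
        using d by (simp add: ennreal_plus[symmetric] ennreal_minus del: ennreal_plus)
      then show ?thesis by (cases "x - 2 * \<delta> \<ge> 0") (simp_all add: ennreal_neg)
    qed
    have eq: "ennreal A + ennreal \<delta> + ennreal \<delta> = ennreal (A + 2 * \<delta>)"
      using d ABC(4) by (simp add: ennreal_plus[symmetric] del: ennreal_plus)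
    have nn: "0 \<le> A + 2 * \<delta>" using d ABC(4) by simp
    show "max 0 (B - 2 * \<delta>) powr t * max 0 (C - 2 * \<delta>) powr (1 - t) \<le> A + 2 * \<delta>"
      by (rule ennreal_le_iff[THEN iffD1, OF nn le[unfolded mx eq]])
  qed
  then show ?thesis unfolding I[symmetric] ABC using ABC by (simp add: ennreal_leI)
qed

end

text \<open>At an endpoint one power is 1 by positivity of its base, and the zero drift leaves the
  path unchanged; cancelling \<open>e\<close> compares the functions directly.\<close>

lemma perturbed_endpoint:
  assumes pw: "perturbed_wiener \<nu> \<beta> W"
    and f: "\<And>w. w \<in> paths \<Longrightarrow> f w > 0" and g: "\<And>w. w \<in> paths \<Longrightarrow> g w > (0::real)"
    and a: "\<And>w. w \<in> paths \<Longrightarrow> a w > 0"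
    and le: "AE w in \<nu>. (f (W (\<lambda>_ _. 0) w) * e) powr r * (g (W (\<lambda>_ _. 0) w) * e) powr (1 - r) \<le> a (W (\<lambda>_ _. 0) w) * e"
    and e: "e > 0"
  shows "r = 1 \<Longrightarrow> AE w in \<nu>. f w \<le> a w" and "r = 0 \<Longrightarrow> AE w in \<nu>. g w \<le> a w"
proof -
  interpret perturbed_wiener \<nu> \<beta> W by (rule pw)
  have main: "AE w in \<nu>. w \<in> paths \<and> (f w * e) powr r * (g w * e) powr (1 - r) \<le> a w * e"
    using le W_zero AE_space
  proof eventually_elim
    case (elim w)
    then show ?case by (simp add: space_nu)
  qed
  show "AE w in \<nu>. f w \<le> a w" if "r = 1"
    using main
  proof eventually_elim
    case (elim w)
    then have "f w > 0" "g w > 0" using f g by simp_all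
    then show ?case using elim e that by simp
  qed
  show "AE w in \<nu>. g w \<le> a w" if "r = 0"
    using main
  proof eventually_elim
    case (elim w)
    then have "f w > 0" "g w > 0" using f g by simp_all
    then show ?case using elim e that by simp
  qed
qed

theorem theorem6:
  fixes \<nu> :: "('n::finite) path measure"
    and \<beta> :: "'n path \<Rightarrow> 'n path"
    and W :: "('n path \<Rightarrow> 'n path) \<Rightarrow> 'n path \<Rightarrow> 'n path"
    and a b c d :: "'n path \<Rightarrow> real"
    and t :: real
  assumes "prob_space \<nu>" and "sets \<nu> = sets path_space"
    and "perturbation_family \<nu> \<beta> W"
    and "\<And>u. u \<in> drifts \<nu> \<Longrightarrow> AE w in \<nu>. W u w = W (\<lambda>_. u w) w"
    and "a \<in> borel_measurable (completion \<nu>)" and "\<And>w. w \<in> paths \<Longrightarrow> a w > 0"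
    and "b \<in> borel_measurable (completion \<nu>)" and "\<And>w. w \<in> paths \<Longrightarrow> b w > 0"
    and "c \<in> borel_measurable (completion \<nu>)" and "\<And>w. w \<in> paths \<Longrightarrow> c w > 0"
    and "\<And>h k r. h \<in> CM_bounded \<Longrightarrow> k \<in> CM_bounded \<Longrightarrow> r \<in> {0..1} \<Longrightarrow>
      AE w in \<nu>.
        a (W (\<lambda>_. path_comb r h k) w) * exp (- (1/2) * CM_normsq (path_comb r h k))
          \<ge> (b (W (\<lambda>_. h) w) * exp (- (1/2) * CM_normsq h)) powr r
            * (c (W (\<lambda>_. k) w) * exp (- (1/2) * CM_normsq k)) powr (1 - r)"
    and "d \<in> borel_measurable (completion \<nu>)" and "\<And>w. w \<in> paths \<Longrightarrow> d w \<ge> 0"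
    and "(\<integral>\<^sup>+w. ennreal (d w) \<partial>completion \<nu>) = 1"
    and "as_convex_neg_log \<nu> W d"
    and "t \<in> {0..1}"
  defines "\<theta> \<equiv> density (completion \<nu>) (\<lambda>w. ennreal (d w))"
  shows "(\<integral>\<^sup>+w. ennreal (a w) \<partial>\<theta>)
    \<ge> ennreal_powr (\<integral>\<^sup>+w. ennreal (b w) \<partial>\<theta>) t
      * ennreal_powr (\<integral>\<^sup>+w. ennreal (c w) \<partial>\<theta>) (1 - t)"
proof -
  interpret perturbed_wiener \<nu> \<beta> W
    by (rule perturbed_wiener.intro[OF assms(1-3)])
  note a_pos = assms(6) and b_pos = assms(8) and c_pos = assms(10) and ineq = assms(11) and d_nn = assms(13)
    and convex = assms(15)[unfolded as_convex_neg_log_def]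
  have I: "(\<integral>\<^sup>+w. ennreal (f w) \<partial>\<theta>) = (\<integral>\<^sup>+w. ennreal (d w) * ennreal (f w) \<partial>\<nu>)"
    if "f \<in> borel_measurable (completion \<nu>)" for f
  proof -
    have "(\<integral>\<^sup>+w. ennreal (f w) \<partial>\<theta>) = (\<integral>\<^sup>+w. ennreal (d w) * ennreal (f w) \<partial>completion \<nu>)"
      unfolding \<theta>_def
      by (rule nn_integral_density[OF measurable_compose[OF assms(12) measurable_ennreal] measurable_compose[OF that measurable_ennreal]])
    then show ?thesis by (simp only: nn_integral_completion)
  qed
  have zero: "(\<lambda>_. 0 :: real ^ 'n) \<in> CM_bounded"
  proof -
    have "(LINT s:{0..t}|unit_time. (0 :: real ^ 'n)) = 0" for t
      unfolding set_lebesgue_integral_def by simp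
    then have "is_density (\<lambda>_. 0 :: real ^ 'n) (\<lambda>_. 0)"
      unfolding is_density_def by (intro conjI ext) simp_all
    then show ?thesis unfolding CM_bounded_def by (intro CollectI exI[where x = "\<lambda>_. 0"] exI[where x = 0] conjI) simp_all
  qed
  have comb0: "path_comb r (\<lambda>_. 0) (\<lambda>_. 0) = (\<lambda>_. 0 :: real ^ 'n)" for r by (simp add: path_comb_def)
  \<comment> \<open>The weight of the zero path appears on both sides with total exponent 1 and
    cancels, so only its positivity is recorded.\<close>
  define e0 where "e0 = exp (- (1/2) * CM_normsq (\<lambda>_. 0 :: real ^ 'n))"
  have e0: "e0 > 0" by (simp add: e0_def)
  have end0: "AE w in \<nu>. (b (W (\<lambda>_ _. 0) w) * e0) powr r * (c (W (\<lambda>_ _. 0) w) * e0) powr (1 - r) \<le> a (W (\<lambda>_ _. 0) w) * e0"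
    if "r \<in> {0..1}" for r
    using ineq[OF zero zero that] unfolding comb0 e0_def[symmetric] .
  have endpoint: "(\<integral>\<^sup>+w. ennreal (f w) \<partial>\<theta>) \<le> (\<integral>\<^sup>+w. ennreal (a w) \<partial>\<theta>)"
    if "f \<in> borel_measurable (completion \<nu>)" "AE w in \<nu>. f w \<le> a w" for f
    unfolding I[OF that(1)] I[OF assms(5)]
  proof (rule nn_integral_mono_AE)
    show "AE w in \<nu>. ennreal (d w) * ennreal (f w) \<le> ennreal (d w) * ennreal (a w)"
      using that(2) by eventually_elim (intro mult_left_mono ennreal_leI, simp_all)
  qed
  have powr_1: "ennreal_powr x 1 = x" for x
    by (simp add: ennreal_powr_def less_top[symmetric])
  \<comment> \<open>At the ends a power with exponent 0 is 1 even for an expectation equal to 0 or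
    infinity, so the limit argument for powers does not cover them.\<close>
  consider "t = 0" | "t = 1" | "0 < t" "t < 1" using assms(16) by fastforce
  then show ?thesis
  proof cases
    case 1
    have "AE w in \<nu>. c w \<le> a w"
      by (rule perturbed_endpoint(2)[OF perturbed_wiener_axioms b_pos c_pos a_pos end0 e0, of 0]) simp_all
    then show ?thesis using endpoint[OF assms(9)] unfolding 1 by (simp add: powr_1) (simp add: ennreal_powr_def)
  next
    case 2
    have "AE w in \<nu>. b w \<le> a w"
      by (rule perturbed_endpoint(1)[OF perturbed_wiener_axioms b_pos c_pos a_pos end0 e0, of 1]) simp_all
    then show ?thesis using endpoint[OF assms(7)] unfolding 2 by (simp add: powr_1) (simp add: ennreal_powr_def)
  next
    case 3
    show ?thesis
    proof (cases "(\<integral>\<^sup>+w. ennreal (a w) \<partial>\<theta>) = top")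
      case False
      \<comment> \<open>An infinite expectation of \<open>a\<close> makes the claim trivial.
        Otherwise \<open>b d\<close> and \<open>c d\<close> are cut at level \<open>n\<close>, which
        only lowers the left side of the hypothesis, while \<open>a d\<close> keeps its full value;
        monotone convergence removes the cut.\<close>
      define F :: "('n path \<Rightarrow> real) \<Rightarrow> nat \<Rightarrow> 'n path \<Rightarrow> ennreal" where
        "F = (\<lambda>f n w. min (ennreal (d w) * ennreal (f w)) (of_nat n))"
      have pm: "(\<lambda>w. ennreal (d w) * ennreal (f w)) \<in> borel_measurable (completion \<nu>)" if "f \<in> borel_measurable (completion \<nu>)" for f
        by (intro borel_measurable_times_ennreal measurable_compose[OF assms(12) measurable_ennreal] measurable_compose[OF that measurable_ennreal])
      have Fm: "F f n \<in> borel_measurable (completion \<nu>)" if "f \<in> borel_measurable (completion \<nu>)" for f n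
        unfolding F_def by (intro borel_measurable_min pm[OF that] borel_measurable_const)
      have FM: "F f n w \<le> ennreal (real n)" for f n w by (simp add: F_def ennreal_of_nat_eq_real_of_nat)
      have lim: "(\<lambda>n. \<integral>\<^sup>+w. F f n w \<partial>\<nu>) \<longlonglongrightarrow> (\<integral>\<^sup>+w. ennreal (f w) \<partial>\<theta>)"
        if "f \<in> borel_measurable (completion \<nu>)" for f
      proof -
        have "(\<lambda>n. \<integral>\<^sup>+w. F f n w \<partial>completion \<nu>) \<longlonglongrightarrow> (\<integral>\<^sup>+w. ennreal (d w) * ennreal (f w) \<partial>completion \<nu>)"
        proof (rule nn_integral_LIMSEQ)
          show "incseq (F f)" unfolding F_def incseq_def le_fun_def by (intro allI impI min.mono order_refl) simp
          show "(\<lambda>n. F f n w) \<longlonglongrightarrow> ennreal (d w) * ennreal (f w)" for w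
            using tendsto_min[OF tendsto_const of_nat_tendsto_top_ennreal, of "ennreal (d w) * ennreal (f w)"] by (simp add: F_def)
        qed (rule Fm[OF that])
        then show ?thesis unfolding I[OF that] by (simp only: nn_integral_completion)
      qed
      have Ffin: "(\<integral>\<^sup>+w. F f n w \<partial>\<nu>) < top" for f n
      proof -
        have "(\<integral>\<^sup>+w. F f n w \<partial>\<nu>) \<le> (\<integral>\<^sup>+w. ennreal (real n) \<partial>\<nu>)" by (intro nn_integral_mono FM)
        also have "\<dots> < top" by (simp add: prob_space.emeasure_space_1[OF prob_nu])
        finally show ?thesis .
      qed
      have enn: "enn2real (F f n w) \<le> f w * d w" if "f w \<ge> 0" "d w \<ge> 0" for f n w
      proof -
        have "enn2real (F f n w) \<le> enn2real (ennreal (d w) * ennreal (f w))"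
          unfolding F_def by (intro enn2real_mono min.cobounded1) (simp add: ennreal_mult_less_top)
        also have "\<dots> = f w * d w" using that by (simp add: enn2real_mult)
        finally show ?thesis .
      qed
      have fin: "(\<integral>\<^sup>+w. ennreal (d w) * ennreal (a w) \<partial>\<nu>) < top"
        using False unfolding I[OF assms(5)] by (simp only: less_top)
      have bound: "ennreal (enn2real (\<integral>\<^sup>+w. F b n w \<partial>\<nu>) powr t * enn2real (\<integral>\<^sup>+w. F c n w \<partial>\<nu>) powr (1 - t))
        \<le> (\<integral>\<^sup>+w. ennreal (d w) * ennreal (a w) \<partial>\<nu>)" for n
      proof (rule Prekopa_Leindler_bounded[OF 3 of_nat_0_le_iff pm[OF assms(5)] Fm[OF assms(7)] Fm[OF assms(9)] FM FM fin])
        fix m :: nat and \<tau> :: "nat \<Rightarrow> real" and x y :: "nat \<times> 'n \<Rightarrow> real"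
        assume g: "time_grid m \<tau>"
        interpret wiener_grid \<nu> \<beta> W m \<tau> by (intro wiener_grid.intro perturbed_wiener_axioms g)
        let ?z = "\<lambda>j. t * x j + (1 - t) * y j"
        let ?S = "\<Sum>j\<in>idx. (x j - y j)\<^sup>2"
        have N: "CM_normsq (step_path ?z) = t * CM_normsq (step_path x) + (1 - t) * CM_normsq (step_path y) - t * (1 - t) * ?S"
          unfolding CM_normsq_step by (rule square_sum_comb)
        \<comment> \<open>The sign conditions on \<open>a\<close>, \<open>b\<close>,
          \<open>c\<close> and \<open>d\<close> are available only at paths, so the perturbed points
          must be known to be paths.\<close>
        have Wp: "AE w in \<nu>. W (\<lambda>_. step_path u) w \<in> paths" for u
          by (rule AE_W_step) (use AE_space[of \<nu>] in \<open>simp only: space_nu\<close>)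
        show "AE w in \<nu>. ennreal (enn2real (F b n (W (\<lambda>_. step_path x) w)) powr t * enn2real (F c n (W (\<lambda>_. step_path y) w)) powr (1 - t)
           * exp (- t * (1 - t) * ?S / 2))
          \<le> ennreal (d (W (\<lambda>_. step_path ?z) w)) * ennreal (a (W (\<lambda>_. step_path ?z) w))"
          using ineq[OF step_path_bounded step_path_bounded assms(16), of x y, unfolded path_comb_step]
            convex[THEN bspec, OF step_path_bounded, THEN bspec, OF step_path_bounded, THEN bspec, OF assms(16), of x y, unfolded path_comb_step]
            Wp[of x] Wp[of y] Wp[of ?z]
        proof eventually_elim
          case (elim w)
          let ?x = "W (\<lambda>_. step_path x) w" and ?y = "W (\<lambda>_. step_path y) w" and ?zz = "W (\<lambda>_. step_path ?z) w"
          note nn = d_nn[OF elim(3)] d_nn[OF elim(4)] d_nn[OF elim(5)] and pos = b_pos[OF elim(3)] c_pos[OF elim(4)] a_pos[OF elim(5)]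
          have "d ?x powr t * d ?y powr (1 - t) \<le> d ?zz"
            by (rule neg_log_convexD[OF 3 nn elim(2)])
          from weighted_bound_combine[OF 3 pos(3,1,2) nn(1,2) N elim(1) this]
          have main: "(b ?x * d ?x) powr t * (c ?y * d ?y) powr (1 - t) * exp (- t * (1 - t) * ?S / 2) \<le> a ?zz * d ?zz" .
          have "enn2real (F b n ?x) powr t * enn2real (F c n ?y) powr (1 - t) * exp (- t * (1 - t) * ?S / 2)
            \<le> (b ?x * d ?x) powr t * (c ?y * d ?y) powr (1 - t) * exp (- t * (1 - t) * ?S / 2)"
            using 3 by (intro mult_right_mono mult_mono powr_mono2 enn less_imp_le[OF pos(1)] less_imp_le[OF pos(2)] nn) simp_all
          also note main
          finally have "ennreal (enn2real (F b n ?x) powr t * enn2real (F c n ?y) powr (1 - t) * exp (- t * (1 - t) * ?S / 2)) \<le> ennreal (a ?zz * d ?zz)"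
            by (rule ennreal_leI)
          also have "\<dots> = ennreal (d ?zz) * ennreal (a ?zz)"
            using pos(3) nn(3) by (simp only: ennreal_mult less_imp_le mult.commute)
          finally show ?case .
        qed
      qed
      show ?thesis
        by (rule ennreal_powr_mult_le[OF 3 lim[OF assms(7)] Ffin lim[OF assms(9)] Ffin]) (rule bound[folded I[OF assms(5)]])
    qed simp
  qed
qed

end
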